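(* Let $r,s\ge1$, $a_1,\dots,a_r,b_1,\dots,b_s\in\mathfrak h$, $m_1,\dots,m_r,n_1,\dots,n_s\in\mathbb N$, and let $x_1,\dots,x_r,y_1,\dots,y_s$ be formal variables. Then, as formal series with coefficients in $\mathrm{End}(V)$, $$\begin{aligned} &:a_1^{(m_1)}(x_1)\cdots a_r^{(m_r)}(x_r):\;\cdot\;:b_1^{(n_1)}(y_1)\cdots b_s^{(n_s)}(y_s):\\ &=\;:a_1^{(m_1)}(x_1)\cdots a_r^{(m_r)}(x_r)\,b_1^{(n_1)}(y_1)\cdots b_s^{(n_s)}(y_s):\\ &\quad+\sum_{\rho=1}^{\min(r,s)}\ \sum_{\substack{1\le i_1<\cdots<i_\rho\le r\\1\le j_1<\cdots<j_\rho\le s}}(-1)^{i_1+\cdots+i_\rho+j_1+\cdots+j_\rho}(-1)^{r\rho+\rho(\rho+1)/2}\ \det\Big((a_{i_k},b_{j_l})\,\iota_{x_{i_k}y_{j_l}}f_{m_{i_k}n_{j_l}}(x_{i_k},y_{j_l})\Big)_{1\le k,l\le\rho}\\ &\qquad\cdot:a_1^{(m_1)}(x_1)\cdots\widehat{a_{i_1}^{(m_{i_1})}(x_{i_1})}\cdots\widehat{a_{i_\rho}^{(m_{i_\rho})}(x_{i_\rho})}\cdots a_r^{(m_r)}(x_r)\\ &\qquad\quad\cdot b_1^{(n_1)}(y_1)\cdots\widehat{b_{j_1}^{(n_{j_1})}(y_{j_1})}\cdots\widehat{b_{j_\rho}^{(n_{j_\rho})}(y_{j_\rho})}\cdots b_s^{(n_s)}(y_s):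 \end{aligned}$$ where hats denote omitted factors.
   Context: $\mathbb N=\{0,1,2,\dots\}$. Let $\mathfrak h=\mathbb C^{2M}$ with a nondegenerate symmetric bilinear form $(\cdot,\cdot)$ and $\mathfrak h=\mathfrak p\oplus\mathfrak q$ a decomposition into maximal isotropic subspaces $\mathfrak p,\mathfrak q\simeq\mathbb C^M$. Put $\hat{\mathfrak h}_{\mathbb Z+1/2}=\mathfrak h\otimes t^{1/2}\mathbb C[t,t^{-1}]\oplus\mathbb C\mathbf k$ and $\hat{\mathfrak h}^{\pm}_{\mathbb Z+1/2}=\mathfrak h\otimes t^{\pm1/2}\mathbb C[t^{\pm1}]$. Let $N(\hat{\mathfrak h}_{\mathbb Z+1/2})$ be the quotient of the tensor algebra $T(\hat{\mathfrak h}_{\mathbb Z+1/2})$ by the two-sided ideal generated by $(a\otimes t^{m+\frac12})\otimes(b\otimes t^{n+\frac12})+(b\otimes t^{n+\frac12})\otimes(a\otimes t^{m+\frac12})-(a,b)\delta_{m+n+1,0}\mathbf k$ and $(a\otimes t^{k+\frac12})\otimes\mathbf k-\mathbf k\otimes(a\otimes t^{k+\frac12})$, for $a,b\in\mathfrak h$, integers $m\ge0$, $n\le-1$, $k\in\mathbb Z$. Let $\mathbb C\mathbf 1$ be the one-dimensional module of the subalgebra $T(\hat{\mathfrak h}^+_{\mathbb Z+1/2})\otimes T(\mathbb C\mathbf k)$ on which $\hat{\mathfrak h}^+_{\mathbb Z+1/2}$ acts by $0$ and $\mathbf k$ acts by $1$, and let $V=N(\hat{\mathfrak h}_{\mathbb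 Z+1/2})\otimes_{T(\hat{\mathfrak h}^+_{\mathbb Z+1/2})\otimes T(\mathbb C\mathbf k)}\mathbb C\mathbf 1$. As a vector space $V\cong T(\hat{\mathfrak h}^-_{\mathbb Z+1/2})\otimes\mathbb C\mathbf 1$. Write $h(m+1/2)$, $m\in\mathbb Z$, for the action of $h\otimes t^{m+1/2}$ on $V$ (a positive mode if $m\ge0$, a negative mode if $m<0$). For $h\in\mathfrak h$, $m\in\mathbb N$, set $h^{(m)}(x)=\sum_{n\in\mathbb Z}\binom{-n-1}{m}h(n+1/2)x^{-n-m-1}$. The normal ordering of a product of modes is $:h_1(n_1+1/2)\cdots h_r(n_r+1/2):\;=(-1)^\sigma h_{\sigma(1)}(n_{\sigma(1)}+1/2)\cdots h_{\sigma(r)}(n_{\sigma(r)}+1/2)$, where $\sigma$ is the unique permutation of $\{1,\dots,r\}$ placing all negative modes to the left of all positive modes while preserving the relative order among the negative modes and among the positive modes, and $(-1)^\sigma$ is its sign. It is extended componentwise to products of series: $:h_1^{(m_1)}(x_1)\cdots h_r^{(m_r)}(x_r):\;=\sum_{n_1,\dots,n_r\in\mathbb Z}:h_1(n_1+1/2)\cdots h_r(n_r+1/2):\prod_i\binom{-n_i-1}{m_i}x_i^{-n_i-m_i-1}$; an empty normal-ordered product is $1_V$. $f_{mn}(x,y)=\frac1{m!n!}\frac{\partial^{m+n}}{\partial x^m\partial y^n}(x-y)^{-1}=\binom{-n-1}{m}(x-y)^{-m-n-1}$ for $m,n\ge0$, and $\iota_{xy}$ expands negative powers of $x-y$ as power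 series in $y$: $\iota_{xy}(x-y)^{-t}=\sum_{i\ge0}\binom{t+i-1}{i}x^{-t-i}y^i$. *)

theory Defs
  imports
    Complex_Main
    "HOL-Library.Product_Plus"
    "HOL-Library.Poly_Mapping"
    "HOL-Combinatorics.Permutations"
    "HOL-Algebra.QuotRing"
    "HOL-Algebra.Module"
begin

section \<open>The polarized quadratic space\<close>

definition symmetric_form ::
    "(complex \<Rightarrow> 'h::ab_group_add \<Rightarrow> 'h) \<Rightarrow> ('h \<Rightarrow> 'h \<Rightarrow> complex) \<Rightarrow> bool"
  where "symmetric_form sc B \<longleftrightarrow>
    (\<forall>x. Vector_Spaces.linear sc (*) (B x)) \<and>
    (\<forall>y. Vector_Spaces.linear sc (*) (\<lambda>x. B x y)) \<and>
    (\<forall>x y. B x y = B y x)"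

definition nondegenerate_form :: "('h::zero \<Rightarrow> 'h \<Rightarrow> complex) \<Rightarrow> bool"
  where "nondegenerate_form B \<longleftrightarrow> (\<forall>x. (\<forall>y. B x y = 0) \<longrightarrow> x = 0)"

definition isotropic_subspace ::
    "(complex \<Rightarrow> 'h::ab_group_add \<Rightarrow> 'h) \<Rightarrow> ('h \<Rightarrow> 'h \<Rightarrow> complex) \<Rightarrow> 'h set \<Rightarrow> bool"
  where "isotropic_subspace sc B P \<longleftrightarrow>
    module.subspace sc P \<and> (\<forall>x\<in>P. \<forall>y\<in>P. B x y = 0)"

definition maximal_isotropic ::
    "(complex \<Rightarrow> 'h::ab_group_add \<Rightarrow> 'h) \<Rightarrow> ('h \<Rightarrow> 'h \<Rightarrow> complex) \<Rightarrow> 'h set \<Rightarrow> bool"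
  where "maximal_isotropic sc B P \<longleftrightarrow>
    isotropic_subspace sc B P \<and> (\<forall>P'. isotropic_subspace sc B P' \<and> P \<subseteq> P' \<longrightarrow> P' = P)"

section \<open>The tensor algebra of a vector space\<close>

datatype 'w word = Word "'w list"

instantiation word :: (type) monoid_add
begin

definition zero_word :: "'a word" where "zero_word = Word []"

fun plus_word :: "'a word \<Rightarrow> 'a word \<Rightarrow> 'a word"
  where "plus_word (Word u) (Word v) = Word (u @ v)"

instance
proof
  fix a b c :: "'a word"
  show "a + b + c = a + (b + c)" by (cases a; cases b; cases c) simp
  show "0 + a = a" by (cases a) (simp add: zero_word_def)
  show "a + 0 = a" by (cases a) (simp add: zero_word_def)
qed

end

type_synonym 'w free_alg = "'w word \<Rightarrow>\<^sub>0 complex"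

text \<open>
  The product of \<^typ>\<open>'w word \<Rightarrow>\<^sub>0 complex\<close> is the convolution product with respect to
  concatenation of words, so this is the free associative unital complex algebra on the
  set of all elements of \<^typ>\<open>'w\<close>.
\<close>

definition free_algebra :: "'w free_alg ring"
  where "free_algebra = \<lparr>carrier = UNIV, monoid.mult = (*), one = 1, zero = 0, add = (+)\<rparr>"

definition letter :: "'w \<Rightarrow> 'w free_alg"
  where "letter w = Poly_Mapping.single (Word [w]) 1"

definition alg_scalar :: "complex \<Rightarrow> 'w free_alg"
  where "alg_scalar c = Poly_Mapping.single 0 c"

text \<open>
  The tensor algebra of the vector space \<^typ>\<open>'w\<close> with scalar multiplication \<open>sc\<close>: the free
  algebra on the underlying set modulo linearity of the inclusion of \<^typ>\<open>'w\<close>.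
\<close>

definition tensor_ideal :: "(complex \<Rightarrow> 'w::ab_group_add \<Rightarrow> 'w) \<Rightarrow> 'w free_alg set"
  where "tensor_ideal sc = genideal free_algebra
    ({letter (u + v) - (letter u + letter v) | u v. True} \<union>
     {letter (sc c u) - alg_scalar c * letter u | c u. True})"

definition tensor_algebra ::
    "(complex \<Rightarrow> 'w::ab_group_add \<Rightarrow> 'w) \<Rightarrow> ('w free_alg set) ring"
  where "tensor_algebra sc = free_algebra Quot tensor_ideal sc"

definition tensor_gen ::
    "(complex \<Rightarrow> 'w::ab_group_add \<Rightarrow> 'w) \<Rightarrow> 'w \<Rightarrow> 'w free_alg set"
  where "tensor_gen sc w = tensor_ideal sc +>\<^bsub>free_algebra\<^esub> letter w"

definition tensor_const ::
    "(complex \<Rightarrow> 'w::ab_group_add \<Rightarrow> 'w) \<Rightarrow> complex \<Rightarrow> 'w free_alg set"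
  where "tensor_const sc c = tensor_ideal sc +>\<^bsub>free_algebra\<^esub> alg_scalar c"

section \<open>The affinization and the algebra N\<close>

text \<open>
  The pair \<open>(f, z)\<close> stands for \<open>(\<Sum>m. f(m) \<otimes> t^(m+1/2)) + z k\<close>.
\<close>

type_synonym 'h affine = "(int \<Rightarrow>\<^sub>0 'h) \<times> complex"

definition affine_scale ::
    "(complex \<Rightarrow> 'h::ab_group_add \<Rightarrow> 'h) \<Rightarrow> complex \<Rightarrow> 'h affine \<Rightarrow> 'h affine"
  where "affine_scale sc c u = (Poly_Mapping.map (sc c) (fst u), c * snd u)"

definition loop_elt :: "'h::ab_group_add \<Rightarrow> int \<Rightarrow> 'h affine"
  where "loop_elt a m = (Poly_Mapping.single m a, 0)"

definition central_elt :: "'h::ab_group_add affine"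
  where "central_elt = (0, 1)"

abbreviation affine_tensor ::
    "(complex \<Rightarrow> 'h::ab_group_add \<Rightarrow> 'h) \<Rightarrow> ('h affine free_alg set) ring"
  where "affine_tensor sc \<equiv> tensor_algebra (affine_scale sc)"

definition N_relations ::
    "(complex \<Rightarrow> 'h::ab_group_add \<Rightarrow> 'h) \<Rightarrow> ('h \<Rightarrow> 'h \<Rightarrow> complex) \<Rightarrow> 'h affine free_alg set set"
  where "N_relations sc B =
    (let T = affine_tensor sc;
         g = (\<lambda>a m. tensor_gen (affine_scale sc) (loop_elt a m));
         k = tensor_gen (affine_scale sc) central_elt
     in {(g a m \<otimes>\<^bsub>T\<^esub> g b n \<oplus>\<^bsub>T\<^esub> g b n \<otimes>\<^bsub>T\<^esub> g a m)
           \<ominus>\<^bsub>T\<^esub> (tensor_const (affine_scale sc) (if m + n + 1 = 0 then B a b else 0) \<otimes>\<^bsub>T\<^esub> k)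
          | a b m n. m \<ge> 0 \<and> n \<le> -1} \<union>
        {(g a m \<otimes>\<^bsub>T\<^esub> k) \<ominus>\<^bsub>T\<^esub> (k \<otimes>\<^bsub>T\<^esub> g a m) | a m. True})"

type_synonym 'h N_elt = "'h affine free_alg set set"

definition N_ideal ::
    "(complex \<Rightarrow> 'h::ab_group_add \<Rightarrow> 'h) \<Rightarrow> ('h \<Rightarrow> 'h \<Rightarrow> complex) \<Rightarrow> 'h affine free_alg set set"
  where "N_ideal sc B = genideal (affine_tensor sc) (N_relations sc B)"

definition N_algebra ::
    "(complex \<Rightarrow> 'h::ab_group_add \<Rightarrow> 'h) \<Rightarrow> ('h \<Rightarrow> 'h \<Rightarrow> complex) \<Rightarrow> 'h N_elt ring"
  where "N_algebra sc B = affine_tensor sc Quot N_ideal sc B"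

definition N_gen ::
    "(complex \<Rightarrow> 'h::ab_group_add \<Rightarrow> 'h) \<Rightarrow> ('h \<Rightarrow> 'h \<Rightarrow> complex) \<Rightarrow> 'h affine \<Rightarrow> 'h N_elt"
  where "N_gen sc B u =
    N_ideal sc B +>\<^bsub>affine_tensor sc\<^esub> tensor_gen (affine_scale sc) u"

definition N_const ::
    "(complex \<Rightarrow> 'h::ab_group_add \<Rightarrow> 'h) \<Rightarrow> ('h \<Rightarrow> 'h \<Rightarrow> complex) \<Rightarrow> complex \<Rightarrow> 'h N_elt"
  where "N_const sc B c =
    N_ideal sc B +>\<^bsub>affine_tensor sc\<^esub> tensor_const (affine_scale sc) c"

section \<open>The induced module V\<close>

text \<open>
  \<open>vacuum_action sc B \<alpha> w\<close>: the element \<open>\<alpha>\<close> of the subalgebra of N generated by the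
  \<open>a \<otimes> t^(m+1/2)\<close> with \<open>m \<ge> 0\<close> and by \<open>k\<close>, i.e. the image of
  \<open>T(h^+) \<otimes> T(C k)\<close>, acts on the one-dimensional module \<open>C 1\<close> as multiplication by
  the scalar \<open>w\<close>.
\<close>

inductive vacuum_action ::
    "(complex \<Rightarrow> 'h::ab_group_add \<Rightarrow> 'h) \<Rightarrow> ('h \<Rightarrow> 'h \<Rightarrow> complex) \<Rightarrow> 'h N_elt \<Rightarrow> complex \<Rightarrow> bool"
  for sc B
where
  positive: "m \<ge> 0 \<Longrightarrow> vacuum_action sc B (N_gen sc B (loop_elt a m)) 0"
| central: "vacuum_action sc B (N_gen sc B central_elt) 1"
| const: "vacuum_action sc B (N_const sc B c) c"
| add: "vacuum_action sc B \<alpha> w \<Longrightarrow> vacuum_action sc B \<beta> w' \<Longrightarrow>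
    vacuum_action sc B (\<alpha> \<oplus>\<^bsub>N_algebra sc B\<^esub> \<beta>) (w + w')"
| mult: "vacuum_action sc B \<alpha> w \<Longrightarrow> vacuum_action sc B \<beta> w' \<Longrightarrow>
    vacuum_action sc B (\<alpha> \<otimes>\<^bsub>N_algebra sc B\<^esub> \<beta>) (w * w')"

definition complex_ring :: "complex ring"
  where "complex_ring = \<lparr>carrier = UNIV, monoid.mult = (*), one = 1, zero = 0, add = (+)\<rparr>"

text \<open>The ring multiplication and unit of a module record carry no information.\<close>

definition free_module :: "'s set \<Rightarrow> (complex, 's \<Rightarrow>\<^sub>0 complex) module"
  where "free_module S =
    \<lparr>carrier = {f. Poly_Mapping.keys f \<subseteq> S}, monoid.mult = undefined, one = undefined,
     zero = 0, add = (+), smult = (\<lambda>c. Poly_Mapping.map ((*) c))\<rparr>"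

definition submodule_generated :: "(complex, 'v) module \<Rightarrow> 'v set \<Rightarrow> 'v set"
  where "submodule_generated U S = \<Inter> {K. submodule K complex_ring U \<and> S \<subseteq> K}"

definition quotient_module :: "(complex, 'v) module \<Rightarrow> 'v set \<Rightarrow> (complex, 'v set) module"
  where "quotient_module U K =
    \<lparr>carrier = a_rcosets\<^bsub>U\<^esub> K, monoid.mult = undefined, one = undefined,
     zero = K, add = set_add U, smult = (\<lambda>c X. \<Union>x\<in>X. K +>\<^bsub>U\<^esub> (c \<odot>\<^bsub>U\<^esub> x))\<rparr>"

type_synonym 'h pre_V = "('h N_elt \<times> complex) \<Rightarrow>\<^sub>0 complex"

definition pre_V ::
    "(complex \<Rightarrow> 'h::ab_group_add \<Rightarrow> 'h) \<Rightarrow> ('h \<Rightarrow> 'h \<Rightarrow> complex) \<Rightarrow> (complex, 'h pre_V) module"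
  where "pre_V sc B = free_module (carrier (N_algebra sc B) \<times> UNIV)"

text \<open>
  The tensor product of N with \<open>C 1\<close> over the subalgebra: formal combinations of pairs
  \<open>(x, z)\<close>, standing for \<open>x \<otimes> z\<cdot>1\<close>, modulo bilinearity and
  \<open>x \<alpha> \<otimes> z\<cdot>1 = x \<otimes> \<alpha>\<cdot>(z\<cdot>1)\<close>.
\<close>

definition V_relations ::
    "(complex \<Rightarrow> 'h::ab_group_add \<Rightarrow> 'h) \<Rightarrow> ('h \<Rightarrow> 'h \<Rightarrow> complex) \<Rightarrow> 'h pre_V set"
  where "V_relations sc B =
    (let N = N_algebra sc B; p = (\<lambda>x z. Poly_Mapping.single (x, z) (1::complex))
     in {p (x \<oplus>\<^bsub>N\<^esub> y) z - (p x z + p y z) | x y z. x \<in> carrier N \<and> y \<in> carrier N} \<union>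
        {p x (z + z') - (p x z + p x z') | x z z'. x \<in> carrier N} \<union>
        {p (N_const sc B c \<otimes>\<^bsub>N\<^esub> x) z - Poly_Mapping.single (x, z) c | c x z. x \<in> carrier N} \<union>
        {p x (c * z) - Poly_Mapping.single (x, z) c | c x z. x \<in> carrier N} \<union>
        {p (x \<otimes>\<^bsub>N\<^esub> \<alpha>) z - p x (w * z) | x \<alpha> w z. x \<in> carrier N \<and> vacuum_action sc B \<alpha> w})"

definition V_kernel ::
    "(complex \<Rightarrow> 'h::ab_group_add \<Rightarrow> 'h) \<Rightarrow> ('h \<Rightarrow> 'h \<Rightarrow> complex) \<Rightarrow> 'h pre_V set"
  where "V_kernel sc B = submodule_generated (pre_V sc B) (V_relations sc B)"

definition V_space ::
    "(complex \<Rightarrow> 'h::ab_group_add \<Rightarrow> 'h) \<Rightarrow> ('h \<Rightarrow> 'h \<Rightarrow> complex) \<Rightarrow> (complex, 'h pre_V set) module"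
  where "V_space sc B = quotient_module (pre_V sc B) (V_kernel sc B)"

definition pre_left_mult ::
    "(complex \<Rightarrow> 'h::ab_group_add \<Rightarrow> 'h) \<Rightarrow> ('h \<Rightarrow> 'h \<Rightarrow> complex) \<Rightarrow> 'h N_elt \<Rightarrow> 'h pre_V \<Rightarrow> 'h pre_V"
  where "pre_left_mult sc B x f =
    (\<Sum>(y, z)\<in>Poly_Mapping.keys f.
       Poly_Mapping.single (x \<otimes>\<^bsub>N_algebra sc B\<^esub> y, z) (Poly_Mapping.lookup f (y, z)))"

text \<open>The operator on V induced by \<open>y \<otimes> z \<mapsto> x y \<otimes> z\<close>.\<close>

definition N_action ::
    "(complex \<Rightarrow> 'h::ab_group_add \<Rightarrow> 'h) \<Rightarrow> ('h \<Rightarrow> 'h \<Rightarrow> complex) \<Rightarrow>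
      'h N_elt \<Rightarrow> 'h pre_V set \<Rightarrow> 'h pre_V set"
  where "N_action sc B x =
    (\<lambda>X\<in>carrier (V_space sc B).
       \<Union>f\<in>X. V_kernel sc B +>\<^bsub>pre_V sc B\<^esub> pre_left_mult sc B x f)"

text \<open>\<open>mode sc B h m\<close> is \<open>h(m+1/2)\<close>.\<close>

definition mode ::
    "(complex \<Rightarrow> 'h::ab_group_add \<Rightarrow> 'h) \<Rightarrow> ('h \<Rightarrow> 'h \<Rightarrow> complex) \<Rightarrow>
      'h \<Rightarrow> int \<Rightarrow> 'h pre_V set \<Rightarrow> 'h pre_V set"
  where "mode sc B h m = N_action sc B (N_gen sc B (loop_elt h m))"

definition linear_endos :: "(complex, 'v) module \<Rightarrow> ('v \<Rightarrow> 'v) set"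
  where "linear_endos V =
    {f \<in> carrier V \<rightarrow>\<^sub>E carrier V.
       (\<forall>x\<in>carrier V. \<forall>y\<in>carrier V. f (x \<oplus>\<^bsub>V\<^esub> y) = f x \<oplus>\<^bsub>V\<^esub> f y) \<and>
       (\<forall>c. \<forall>x\<in>carrier V. f (c \<odot>\<^bsub>V\<^esub> x) = c \<odot>\<^bsub>V\<^esub> f x)}"

definition End_algebra :: "(complex, 'v) module \<Rightarrow> (complex, 'v \<Rightarrow> 'v) module"
  where "End_algebra V =
    \<lparr>carrier = linear_endos V, monoid.mult = compose (carrier V), one = (\<lambda>x\<in>carrier V. x),
     zero = (\<lambda>x\<in>carrier V. \<zero>\<^bsub>V\<^esub>), add = (\<lambda>f g. \<lambda>x\<in>carrier V. f x \<oplus>\<^bsub>V\<^esub> g x),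
     smult = (\<lambda>c f. \<lambda>x\<in>carrier V. c \<odot>\<^bsub>V\<^esub> f x)\<rparr>"

section \<open>Formal series\<close>

text \<open>
  The variables \<open>x_i\<close> and \<open>y_j\<close>.  A formal series maps an exponent function to the
  coefficient of the corresponding Laurent monomial; all exponents in \<open>\<int>\<close> are allowed.
\<close>

datatype var = X nat | Y nat

type_synonym 'r series = "(var \<Rightarrow> int) \<Rightarrow> 'r"

definition monomial_exponents :: "(var \<times> int) list \<Rightarrow> var \<Rightarrow> int"
  where "monomial_exponents ps = (\<lambda>v. \<Sum>(u, k)\<leftarrow>ps. if u = v then k else 0)"

text \<open>
  The Cauchy product.  It is meaningful only if each coefficient receives finitely many
  nonzero contributions, for instance for factors in disjoint sets of variables.
\<close>

definition series_mult :: "('r, 'k) ring_scheme \<Rightarrow> 'r series \<Rightarrow> 'r series \<Rightarrow> 'r series"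
  where "series_mult R F G = (\<lambda>e. finsum R (\<lambda>(d, d'). F d \<otimes>\<^bsub>R\<^esub> G d')
      {(d, d'). (\<lambda>v. d v + d' v) = e \<and> F d \<noteq> \<zero>\<^bsub>R\<^esub> \<and> G d' \<noteq> \<zero>\<^bsub>R\<^esub>})"

definition series_one :: "('r, 'k) ring_scheme \<Rightarrow> 'r series"
  where "series_one R = (\<lambda>e. if e = (\<lambda>_. 0) then \<one>\<^bsub>R\<^esub> else \<zero>\<^bsub>R\<^esub>)"

definition series_add :: "('r, 'k) ring_scheme \<Rightarrow> 'r series \<Rightarrow> 'r series \<Rightarrow> 'r series"
  where "series_add R F G = (\<lambda>e. F e \<oplus>\<^bsub>R\<^esub> G e)"

definition series_sum :: "('r, 'k) ring_scheme \<Rightarrow> ('i \<Rightarrow> 'r series) \<Rightarrow> 'i set \<Rightarrow> 'r series"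
  where "series_sum R F I = (\<lambda>e. \<Oplus>\<^bsub>R\<^esub>i \<in> I. F i e)"

definition series_smult :: "(complex, 'r) module \<Rightarrow> complex \<Rightarrow> 'r series \<Rightarrow> 'r series"
  where "series_smult A c F = (\<lambda>e. c \<odot>\<^bsub>A\<^esub> F e)"

definition scalar_series :: "(complex, 'r) module \<Rightarrow> complex series \<Rightarrow> 'r series"
  where "scalar_series A F = (\<lambda>e. F e \<odot>\<^bsub>A\<^esub> \<one>\<^bsub>A\<^esub>)"

text \<open>
  The Leibniz formula; the library determinants need a commutative ring of entries, which
  formal series are not, as their products are only partially defined.
\<close>

definition series_det :: "nat \<Rightarrow> (nat \<Rightarrow> nat \<Rightarrow> complex series) \<Rightarrow> complex series"
  where "series_det \<rho> C = (\<lambda>e. \<Sum>\<pi> | \<pi> permutes {..<\<rho>}. of_int (sign \<pi>) *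
      foldr (series_mult complex_ring) (map (\<lambda>k. C k (\<pi> k)) [0..<\<rho>]) (series_one complex_ring) e)"

text \<open>The expansion \<open>\<iota>_xy (x - y)^(-t)\<close>, for \<open>t \<ge> 1\<close>.\<close>

definition iota_inverse_power :: "nat \<Rightarrow> var \<Rightarrow> var \<Rightarrow> complex series"
  where "iota_inverse_power t x y = (\<lambda>e.
    \<Sum>i | monomial_exponents [(x, - int t - int i), (y, int i)] = e. of_nat ((t + i - 1) choose i))"

text \<open>The expansion of \<open>f_mn(x,y) = binomial(-n-1, m) (x - y)^(-m-n-1)\<close>.\<close>

definition iota_f :: "nat \<Rightarrow> nat \<Rightarrow> var \<Rightarrow> var \<Rightarrow> complex series"
  where "iota_f m n x y = (\<lambda>e.
    ((- of_nat n - 1) gchoose m) * iota_inverse_power (m + n + 1) x y e)"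

section \<open>Normal ordering\<close>

text \<open>
  The permutation is on the positions \<open>0, \<dots>, r - 1\<close>; \<open>\<sigma> i\<close> is the original position of the
  factor that is moved to position \<open>i\<close>.
\<close>

definition ordering_perm :: "int list \<Rightarrow> nat \<Rightarrow> nat"
  where "ordering_perm ns = (THE \<sigma>. \<sigma> permutes {..<length ns} \<and>
    (\<forall>i j. i < j \<and> j < length ns \<longrightarrow>
       (ns ! \<sigma> j < 0 \<longrightarrow> ns ! \<sigma> i < 0) \<and>
       ((ns ! \<sigma> i < 0 \<longleftrightarrow> ns ! \<sigma> j < 0) \<longrightarrow> \<sigma> i < \<sigma> j)))"

definition normal_modes ::
    "(complex \<Rightarrow> 'h::ab_group_add \<Rightarrow> 'h) \<Rightarrow> ('h \<Rightarrow> 'h \<Rightarrow> complex) \<Rightarrow>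
      'h list \<Rightarrow> int list \<Rightarrow> 'h pre_V set \<Rightarrow> 'h pre_V set"
  where "normal_modes sc B hs ns =
    (let A = End_algebra (V_space sc B); \<sigma> = ordering_perm ns
     in of_int (sign \<sigma>) \<odot>\<^bsub>A\<^esub>
          foldr (mult A) (map (\<lambda>i. mode sc B (hs ! \<sigma> i) (ns ! \<sigma> i)) [0..<length ns]) \<one>\<^bsub>A\<^esub>)"

text \<open>
  A factor \<open>(h, m, v)\<close> stands for \<open>h^(m)(v)\<close>; each \<open>n_i\<close> contributes the exponent
  \<open>-n_i - m_i - 1\<close> of its variable.  If the variables are pairwise distinct, then every
  coefficient is a sum with at most one term.
\<close>

definition normal_product ::
    "(complex \<Rightarrow> 'h::ab_group_add \<Rightarrow> 'h) \<Rightarrow> ('h \<Rightarrow> 'h \<Rightarrow> complex) \<Rightarrow>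
      ('h \<times> nat \<times> var) list \<Rightarrow> ('h pre_V set \<Rightarrow> 'h pre_V set) series"
  where "normal_product sc B fs = (\<lambda>e.
    let A = End_algebra (V_space sc B);
        hs = map fst fs; ms = map (fst \<circ> snd) fs; vs = map (snd \<circ> snd) fs
    in \<Oplus>\<^bsub>A\<^esub>ns \<in> {ns. length ns = length fs \<and>
           monomial_exponents (map (\<lambda>i. (vs ! i, - (ns ! i) - int (ms ! i) - 1)) [0..<length fs]) = e}.
         (\<Prod>i<length fs. (of_int (- (ns ! i) - 1) gchoose (ms ! i))) \<odot>\<^bsub>A\<^esub> normal_modes sc B hs ns)"

definition factors ::
    "(nat \<Rightarrow> 'h) \<Rightarrow> (nat \<Rightarrow> nat) \<Rightarrow> (nat \<Rightarrow> var) \<Rightarrow> nat list \<Rightarrow> ('h \<times> nat \<times> var) list"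
  where "factors a m v is = map (\<lambda>i. (a i, m i, v i)) is"

definition increasing_seqs :: "nat \<Rightarrow> nat \<Rightarrow> nat list set"
  where "increasing_seqs r \<rho> =
    {is. length is = \<rho> \<and> sorted_wrt (<) is \<and> set is \<subseteq> {1..r}}"

definition omit :: "nat \<Rightarrow> nat list \<Rightarrow> nat list"
  where "omit r is = filter (\<lambda>i. i \<notin> set is) [1..<Suc r]"

end

theory Submission
  imports Defs
begin

text \<open>
  Fix an exponent vector. The factors then become single modes, and after pulling out the
  binomial coefficients the claim is Wick's theorem for words in the modes, with \<open>a(m)\<close>, \<open>m \<ge> 0\<close>,
  and \<open>b(n)\<close> contracting to \<open>(a, b)\<close> if \<open>m + n + 1 = 0\<close>: on coefficients, \<open>\<iota> f\<close> is this Kronecker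
  delta times the two binomial coefficients. Since only positive modes anticommute with
  negative ones, the last factor \<open>a\<close> of \<open>:A:\<close> is moved to the right through the negative modes of
  \<open>B\<close>. Each contraction on the way removes one factor of \<open>B\<close>, and iterating produces the signs of
  the expansion of the determinants along the last row. All operators on V involved are images
  of elements of the free algebra, so the combinatorics takes place there, modulo the
  relation of acting equally on V.
\<close>

section \<open>Removing one entry of a list and the sign of a cycle\<close>

text \<open>No relation is imposed among negative modes or among positive modes, so the order of the
  letters inside each block has to be kept throughout. When the factors of A are taken from the
  right, one that was not contracted keeps its place between the rest of A and B, but must not be
  offered for contraction again. Hence the induction carries a third list of such factors, and its
  sign counts them. Once a factor of B is used up, the positions of the later ones drop by one,
  whereas the theorem counts original indices; the signs are therefore expressed by ranks in the set
  of factors still available and become indices only for the full set {1..s}. The free algebra suits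
  the calculation because it is a type with ordinary ring operations, while N, V and End(V) are
  records whose carriers consist of cosets or of functions on them. Equality of operators on V,
  rather than equality in N, is also what lets k count as 1. This needs k to be central in N,
  because the vacuum relation has k on the right and operators multiply from the left.\<close>

definition remove_nth :: "nat \<Rightarrow> 'x list \<Rightarrow> 'x list"
  where "remove_nth l xs = take l xs @ drop (Suc l) xs"

lemma nth_remove_nth:
  "l < length xs \<Longrightarrow> k < length xs - 1 \<Longrightarrow> remove_nth l xs ! k = xs ! (if k < l then k else Suc k)"
  by (auto simp: remove_nth_def nth_append min_def)

lemma map_remove_nth: "map f (remove_nth l xs) = remove_nth l (map f xs)"
  by (simp add: remove_nth_def take_map drop_map)

lemma remove_nth_Cons_0 [simp]: "remove_nth 0 (x # xs) = xs"
  by (simp add: remove_nth_def)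

lemma remove_nth_Cons_Suc [simp]: "remove_nth (Suc l) (x # xs) = x # remove_nth l xs"
  by (simp add: remove_nth_def)

text \<open>The cycle l -> l+1 -> ... -> n -> l. Composing with it on the left opens a gap at the
  value l and gives this value to n, which is how a permutation of n points is extended by a
  prescribed last value. It serves both the expansion of determinants and the sign of normal
  ordering.\<close>

definition cycle_up :: "nat \<Rightarrow> nat \<Rightarrow> nat \<Rightarrow> nat"
  where "cycle_up l n k = (if k = n then l else if l \<le> k \<and> k < n then Suc k else k)"

lemma cycle_up_Suc: "l \<le> n \<Longrightarrow> cycle_up l (Suc n) = cycle_up l n \<circ> Transposition.transpose n (Suc n)"
  by (auto simp: cycle_up_def fun_eq_iff Transposition.transpose_def)

text \<open>By \<open>cycle_up_Suc\<close> the cycle is a product of n - l adjacent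
  transpositions.\<close>

lemma cycle_up_permutes: "l \<le> n \<Longrightarrow> cycle_up l n permutes {..<Suc n}"
  and sign_cycle_up: "l \<le> n \<Longrightarrow> sign (cycle_up l n) = (-1) ^ (n - l)"
proof (induction rule: dec_induct)
  case base
  {
    case 1
    have "cycle_up l l = id" by (auto simp: cycle_up_def)
    then show ?case by (simp only: permutes_id)
  next
    case 2
    have "cycle_up l l = id" by (auto simp: cycle_up_def)
    then show ?case by simp
  }
next
  case (step n)
  {
    case 1
    have "cycle_up l n permutes {..<Suc (Suc n)}"
      using step(3) by (rule permutes_subset) auto
    then show ?case
      unfolding cycle_up_Suc[OF step(1)] by (intro permutes_compose permutes_swap_id) auto
  next
    case 2
    have perm: "permutation (cycle_up l n)" "permutation (Transposition.transpose n (Suc n))"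
      using step(3) by (auto intro: permutes_imp_permutation permutation_swap_id)
    show ?case
      unfolding cycle_up_Suc[OF step(1)] sign_compose[OF perm] using step
      by (simp add: sign_swap_id Suc_diff_le)
  }
qed

section \<open>The Leibniz sum and its expansion along the last row\<close>

text \<open>Rows and columns are lists of labels, so that a minor keeps the entry function
  \<open>c\<close> and only drops labels.\<close>

definition leibniz_det :: "('i \<Rightarrow> 'j \<Rightarrow> 'c::comm_ring_1) \<Rightarrow> 'i list \<Rightarrow> 'j list \<Rightarrow> 'c"
  where "leibniz_det c is js = (\<Sum>\<pi> | \<pi> permutes {..<length is}.
    of_int (sign \<pi>) * (\<Prod>k<length is. c (is ! k) (js ! \<pi> k)))"

lemma leibniz_det_Nil [simp]: "leibniz_det c [] js = 1"
  by (simp add: leibniz_det_def)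

text \<open>The permutations are grouped by the column l that they assign to the last row. Each is
  \<open>cycle_up l n\<close> after a permutation of the remaining rows, and the cycle skips the
  value l exactly as \<open>remove_nth\<close> skips the column l.\<close>

lemma leibniz_det_snoc:
  assumes js: "length js = Suc (length is)"
  shows "leibniz_det c (is @ [i]) js =
    (\<Sum>l\<le>length is. (-1) ^ (length is + l) * c i (js ! l) * leibniz_det c is (remove_nth l js))"
proof -
  define n where "n = length is"
  let ?S = "{..n} \<times> {\<tau>. \<tau> permutes {..<n}}"
  let ?f = "\<lambda>(l, \<tau>). cycle_up l n \<circ> \<tau>"
  let ?g = "\<lambda>\<pi>. (\<pi> n, inv_into UNIV (cycle_up (\<pi> n) n) \<circ> \<pi>)"
  let ?t = "\<lambda>\<pi>. of_int (sign \<pi>) * (\<Prod>k<Suc n. c ((is @ [i]) ! k) (js ! \<pi> k))"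
  have "leibniz_det c (is @ [i]) js = (\<Sum>\<pi> | \<pi> permutes {..<Suc n}. ?t \<pi>)"
    by (simp only: leibniz_det_def n_def length_append list.size One_nat_def add_0_right add_Suc_right)
  also have "\<dots> = (\<Sum>(l, \<tau>)\<in>?S. (-1) ^ (n + l) * c i (js ! l) *
      (of_int (sign \<tau>) * (\<Prod>k<n. c (is ! k) (remove_nth l js ! \<tau> k))))"
  proof (rule sum.reindex_bij_witness[of _ ?f ?g])
    fix \<pi> assume "\<pi> \<in> {\<pi>. \<pi> permutes {..<Suc n}}"
    then have \<pi>: "\<pi> permutes {..<Suc n}" by simp
    then have l: "\<pi> n \<le> n"
      using permutes_in_image[OF \<pi>, of n] by simp
    note cyc = cycle_up_permutes[OF l]
    show "?f (?g \<pi>) = \<pi>"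
      using permutes_inv_o(1)[OF cyc] by (simp add: o_assoc)
    let ?\<tau> = "inv_into UNIV (cycle_up (\<pi> n) n) \<circ> \<pi>"
    have \<tau>1: "?\<tau> permutes {..<Suc n}"
      using \<pi> permutes_inv[OF cyc] by (rule permutes_compose)
    have \<tau>n: "?\<tau> n = n"
      using permutes_inv_eq[OF cyc, of "\<pi> n" n] by (simp add: cycle_up_def)
    have \<tau>: "?\<tau> permutes {..<n}"
      using \<tau>1 by (rule permutes_superset) (use \<tau>n in \<open>auto simp: less_Suc_eq\<close>)
    then show "?g \<pi> \<in> ?S" using l by auto
    have eq: "\<pi> = cycle_up (\<pi> n) n \<circ> ?\<tau>"
      using permutes_inv_o(1)[OF cyc] by (simp add: o_assoc)
    have "sign \<pi> = sign (cycle_up (\<pi> n) n) * sign ?\<tau>"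
      by (subst eq, rule sign_compose) (use cyc \<tau> in \<open>auto intro: permutes_imp_permutation[rotated]\<close>)
    \<comment> \<open>The exponents n - l and n + l have the same parity; the sum avoids truncated
      subtraction.\<close>
    then have sgn: "sign \<pi> = (-1) ^ (n + \<pi> n) * sign ?\<tau>"
      using l by (simp add: sign_cycle_up minus_one_power_iff)
    have "(\<Prod>k<n. c ((is @ [i]) ! k) (js ! \<pi> k)) = (\<Prod>k<n. c (is ! k) (remove_nth (\<pi> n) js ! ?\<tau> k))"
    proof (rule prod.cong)
      fix k assume "k \<in> {..<n}"
      then have k: "k < n" by simp
      then have \<tau>k: "?\<tau> k < n" using permutes_in_image[OF \<tau>, of k] by simp
      then have "remove_nth (\<pi> n) js ! ?\<tau> k = js ! cycle_up (\<pi> n) n (?\<tau> k)"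
        using l js by (subst nth_remove_nth) (auto simp: n_def cycle_up_def)
      also have "cycle_up (\<pi> n) n (?\<tau> k) = \<pi> k"
        by (metis eq comp_apply)
      finally show "c ((is @ [i]) ! k) (js ! \<pi> k) = c (is ! k) (remove_nth (\<pi> n) js ! ?\<tau> k)"
        using k by (simp add: n_def nth_append)
    qed simp
    then show "(case ?g \<pi> of (l, \<tau>) \<Rightarrow> (-1) ^ (n + l) * c i (js ! l) *
        (of_int (sign \<tau>) * (\<Prod>k<n. c (is ! k) (remove_nth l js ! \<tau> k)))) = ?t \<pi>"
      by (simp add: sgn n_def algebra_simps)
  next
    fix p assume p: "p \<in> ?S"
    obtain l \<tau> where [simp]: "p = (l, \<tau>)" by (cases p)
    have l: "l \<le> n" and \<tau>: "\<tau> permutes {..<n}" using p by auto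
    have \<tau>n: "\<tau> n = n" using \<tau> by (simp add: permutes_not_in)
    note cyc = cycle_up_permutes[OF l]
    have "(cycle_up l n \<circ> \<tau>) n = l" by (simp add: \<tau>n cycle_up_def)
    then show "?g (?f p) = p"
      using permutes_inv_o(2)[OF cyc] by (simp add: o_assoc)
    have "\<tau> permutes {..<Suc n}" using \<tau> by (rule permutes_subset) auto
    then show "?f p \<in> {\<pi>. \<pi> permutes {..<Suc n}}"
      using cyc by (auto intro: permutes_compose)
  qed
  also have "\<dots> = (\<Sum>l\<le>n. (-1) ^ (n + l) * c i (js ! l) * leibniz_det c is (remove_nth l js))"
    by (simp only: sum.cartesian_product[symmetric] leibniz_det_def sum_distrib_left n_def)
  finally show ?thesis by (simp add: n_def)
qed

section \<open>Sorted lists of finite sets of indices\<close>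

abbreviation (input) sl :: "nat set \<Rightarrow> nat list"
  where "sl \<equiv> sorted_list_of_set"

text \<open>The rank of j in S, counted from 1. It replaces the column indices in the sign once
  columns have been removed; in {1..s} the rank of j is j.\<close>

definition place :: "nat set \<Rightarrow> nat \<Rightarrow> nat"
  where "place S j = card {i \<in> S. i \<le> j}"

lemma place_nth:
  assumes "finite S" and "l < card S"
  shows "place S (sl S ! l) = Suc l"
proof -
  let ?xs = "sl S"
  have len: "length ?xs = card S" by simp
  have "{i \<in> S. i \<le> ?xs ! l} = (!) ?xs ` {..l}"
  proof (intro equalityI subsetI)
    fix i assume "i \<in> {i \<in> S. i \<le> ?xs ! l}"
    then have "i \<in> set ?xs" "i \<le> ?xs ! l" using assms(1) by auto
    then obtain k where k: "k < length ?xs" "i = ?xs ! k" by (auto simp: in_set_conv_nth)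
    have "k \<le> l"
    proof (rule ccontr)
      assume "\<not> k \<le> l"
      then have "?xs ! l < ?xs ! k"
        using k(1) by (intro sorted_wrt_nth_less[OF strict_sorted_list_of_set]) auto
      then show False using k \<open>i \<le> ?xs ! l\<close> by simp
    qed
    then show "i \<in> (!) ?xs ` {..l}" using k by auto
  next
    fix i assume "i \<in> (!) ?xs ` {..l}"
    then obtain k where k: "k \<le> l" "i = ?xs ! k" by auto
    have "?xs ! k \<in> set ?xs" using k assms(2) by (intro nth_mem) simp
    moreover have "?xs ! k \<le> ?xs ! l" using k assms(2) by (intro sorted_nth_mono) auto
    ultimately show "i \<in> {i \<in> S. i \<le> ?xs ! l}" using k assms(1) by simp
  qed
  moreover have "inj_on ((!) ?xs) {..l}"
    using assms(2) by (intro inj_on_nth) auto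
  ultimately show ?thesis by (simp add: place_def card_image)
qed

lemma remove_nth_sl:
  assumes "finite S" and "l < card S"
  shows "remove_nth l (sl S) = sl (S - {sl S ! l})"
proof -
  have l: "l < length (sl S)" using assms by simp
  have split: "sl S = take l (sl S) @ sl S ! l # drop (Suc l) (sl S)"
    using l by (rule id_take_nth_drop)
  have "distinct (take l (sl S) @ sl S ! l # drop (Suc l) (sl S))"
    unfolding split[symmetric] by simp
  then have "sl S ! l \<notin> set (take l (sl S))" by auto
  then have "remove1 (sl S ! l) (take l (sl S) @ sl S ! l # drop (Suc l) (sl S)) = remove_nth l (sl S)"
    by (simp add: remove1_append remove_nth_def)
  then have "remove1 (sl S ! l) (sl S) = remove_nth l (sl S)"
    unfolding split[symmetric] .
  then show ?thesis using assms(1) by (simp add: sorted_list_of_set_remove)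
qed

text \<open>Positions in a list start at 0 and ranks at 1, hence \<open>place S j - 1\<close>.
  Position, entry and remaining list are separate arguments of f, to fit both the cofactors of a
  determinant and the contractions with the factors of B.\<close>

lemma sum_nth_sl:
  assumes "finite S"
  shows "(\<Sum>l<card S. f l (sl S ! l) (remove_nth l (sl S))) = (\<Sum>j\<in>S. f (place S j - 1) j (sl (S - {j})))"
proof -
  have "(\<Sum>l<card S. f l (sl S ! l) (remove_nth l (sl S))) =
      (\<Sum>l<card S. (\<lambda>j. f (place S j - 1) j (sl (S - {j}))) (sl S ! l))"
    using assms by (intro sum.cong) (auto simp: place_nth remove_nth_sl)
  also have "\<dots> = (\<Sum>j\<in>S. f (place S j - 1) j (sl (S - {j})))"
    using assms by (intro sum.reindex_bij_betw bij_betw_nth) auto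
  finally show ?thesis .
qed

section \<open>Wick's theorem for an algebra with contractions\<close>

text \<open>Equality of operators enters as a congruence on a ring of a type class. The contraction
  is extended by zero to all other pairs of letters, so that sums over contractions may run over
  every position.\<close>

locale contraction_algebra =
  fixes eqv :: "'r::ring_1 \<Rightarrow> 'r \<Rightarrow> bool" (infix \<open>\<approx>\<close> 50)
    and scale :: "complex \<Rightarrow> 'r \<Rightarrow> 'r" (infixr \<open>\<bullet>\<close> 75)
    and L :: "'g \<Rightarrow> 'r"
    and annih :: "'g \<Rightarrow> bool"
    and contr :: "'g \<Rightarrow> 'g \<Rightarrow> complex"
  assumes eqv_refl [simp]: "x \<approx> x"
    and eqv_sym: "x \<approx> y \<Longrightarrow> y \<approx> x"
    and eqv_trans [trans]: "x \<approx> y \<Longrightarrow> y \<approx> z \<Longrightarrow> x \<approx> z"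
    and eqv_add: "x \<approx> x' \<Longrightarrow> y \<approx> y' \<Longrightarrow> x + y \<approx> x' + y'"
    and eqv_mult: "x \<approx> x' \<Longrightarrow> y \<approx> y' \<Longrightarrow> x * y \<approx> x' * y'"
    and scale_add: "c \<bullet> (x + y) = c \<bullet> x + c \<bullet> y"
    and scale_add_left: "(c + d) \<bullet> x = c \<bullet> x + d \<bullet> x"
    and scale_scale: "c \<bullet> d \<bullet> x = (c * d) \<bullet> x"
    and scale_one [simp]: "1 \<bullet> x = x"
    and mult_scale: "x * c \<bullet> y = c \<bullet> (x * y)"
    and scale_mult: "(c \<bullet> x) * y = c \<bullet> (x * y)"
    and contraction: "annih a \<Longrightarrow> \<not> annih b \<Longrightarrow> L a * L b + L b * L a \<approx> contr a b \<bullet> 1"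
    and contr_eq_0: "\<not> annih a \<or> annih b \<Longrightarrow> contr a b = 0"
begin

lemma scale_zero [simp]: "c \<bullet> 0 = 0"
  using scale_add[of c 0 0] by simp

lemma scale_zero_left [simp]: "0 \<bullet> x = 0"
  using scale_add_left[of 0 0 x] by simp

lemma scale_minus_left: "(- c) \<bullet> x = - (c \<bullet> x)"
  using scale_add_left[of c "- c" x] by (simp add: eq_neg_iff_add_eq_0 add.commute)

lemma scale_minus: "c \<bullet> (- x) = - (c \<bullet> x)"
  using scale_add[of c x "- x"] by (simp add: eq_neg_iff_add_eq_0 add.commute)

lemma scale_sum: "c \<bullet> (\<Sum>i\<in>S. f i) = (\<Sum>i\<in>S. c \<bullet> f i)"
  by (induction S rule: infinite_finite_induct) (simp_all add: scale_add)

lemma sum_scale: "(\<Sum>i\<in>S. f i) \<bullet> x = (\<Sum>i\<in>S. f i \<bullet> x)"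
  by (induction S rule: infinite_finite_induct) (simp_all add: scale_add_left)

lemma eqv_scale:
  assumes "x \<approx> y" shows "c \<bullet> x \<approx> c \<bullet> y"
proof -
  \<comment> \<open>Scaling is multiplication by a multiple of 1, so it respects the congruence
    because products do.\<close>
  have "(c \<bullet> 1) * x \<approx> (c \<bullet> 1) * y" using assms by (intro eqv_mult) simp_all
  then show ?thesis by (simp add: scale_mult)
qed

lemma eqv_sum: "(\<And>i. i \<in> S \<Longrightarrow> f i \<approx> g i) \<Longrightarrow> (\<Sum>i\<in>S. f i) \<approx> (\<Sum>i\<in>S. g i)"
  by (induction S rule: infinite_finite_induct) (simp_all add: eqv_add)

section \<open>Creators, annihilators and the sign of normal ordering\<close>

definition cre :: "'g list \<Rightarrow> 'r"
  where "cre w = prod_list (map L (filter (\<lambda>a. \<not> annih a) w))"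

definition ann :: "'g list \<Rightarrow> 'r"
  where "ann w = prod_list (map L (filter annih w))"

definition ncre :: "'g list \<Rightarrow> nat"
  where "ncre w = length (filter (\<lambda>a. \<not> annih a) w)"

definition nann :: "'g list \<Rightarrow> nat"
  where "nann w = length (filter annih w)"

text \<open>The number of pairs in which an annihilator precedes a creator. It has the parity of the
  permutation that sorts the word, and under concatenation it is additive up to one cross
  term.\<close>

fun inversions :: "'g list \<Rightarrow> nat"
  where "inversions [] = 0"
  | "inversions (a # w) = (if annih a then ncre w else 0) + inversions w"

definition normal :: "'g list \<Rightarrow> 'r"
  where "normal w = ((-1) ^ inversions w) \<bullet> (cre w * ann w)"

lemma cre_simps [simp]:
  "cre [] = 1" "cre (a # w) = (if annih a then cre w else L a * cre w)" "cre (v @ w) = cre v * cre w"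
  by (simp_all add: cre_def)

lemma ann_simps [simp]:
  "ann [] = 1" "ann (a # w) = (if annih a then L a * ann w else ann w)" "ann (v @ w) = ann v * ann w"
  by (simp_all add: ann_def)

lemma ncre_simps [simp]:
  "ncre [] = 0" "ncre (a # w) = (if annih a then 0 else 1) + ncre w" "ncre (v @ w) = ncre v + ncre w"
  by (simp_all add: ncre_def)

lemma nann_simps [simp]:
  "nann [] = 0" "nann (a # w) = (if annih a then 1 else 0) + nann w" "nann (v @ w) = nann v + nann w"
  by (simp_all add: nann_def)

lemma length_conv_ncre_nann: "length w = ncre w + nann w"
  by (induction w) simp_all

lemma inversions_append [simp]: "inversions (v @ w) = inversions v + inversions w + nann v * ncre w"
  by (induction v) simp_all

text \<open>Each creator that is crossed costs a sign and leaves one contraction term. The sum may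
  run over all letters of w: those missing from \<open>cre w\<close> are annihilators and have
  contraction 0, and for the others the sign counts only the creators in front.\<close>

lemma annih_mult_cre:
  assumes a: "annih a"
  shows "L a * cre w \<approx> (-1) ^ ncre w \<bullet> (cre w * L a) +
    (\<Sum>j<length w. ((-1) ^ ncre (take j w) * contr a (w ! j)) \<bullet> cre (remove_nth j w))"
proof (induction w)
  case Nil
  then show ?case by simp
next
  case (Cons b w)
  let ?S = "\<lambda>w. \<Sum>j<length w. ((-1) ^ ncre (take j w) * contr a (w ! j)) \<bullet> cre (remove_nth j w)"
  show ?case
  proof (cases "annih b")
    case True
    then show ?thesis
      using Cons by (simp add: sum.lessThan_Suc_shift contr_eq_0 del: sum.lessThan_Suc)
  next
    case False
    \<comment> \<open>For a later letter, b is one more creator in front: it reverses the sign and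
      remains as the left factor \<open>L b\<close>.\<close>
    have S: "?S (b # w) = contr a b \<bullet> cre w - L b * ?S w"
      using False by (simp add: sum.lessThan_Suc_shift mult_scale sum_distrib_left scale_minus_left
          sum_negf[symmetric] del: sum.lessThan_Suc)
    have "L a * L b \<approx> contr a b \<bullet> 1 - L b * L a"
      using eqv_add[OF contraction[OF a False] eqv_refl[of "- (L b * L a)"]] by simp
    then have "(L a * L b) * cre w \<approx> (contr a b \<bullet> 1 - L b * L a) * cre w"
      by (rule eqv_mult) simp
    also have "(contr a b \<bullet> 1 - L b * L a) * cre w = contr a b \<bullet> cre w + (- L b) * (L a * cre w)"
      by (simp add: algebra_simps scale_mult)
    also have "\<dots> \<approx> contr a b \<bullet> cre w + (- L b) * ((-1) ^ ncre w \<bullet> (cre w * L a) + ?S w)"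
      by (intro eqv_add eqv_mult eqv_refl Cons)
    also have "\<dots> = (-1) ^ ncre (b # w) \<bullet> (cre (b # w) * L a) + ?S (b # w)"
      unfolding S using False
      by (simp add: algebra_simps mult_scale scale_minus_left scale_minus)
    finally show ?thesis using False by (simp add: mult.assoc)
  qed
qed

text \<open>
  The product \<open>:A: :B:\<close>, except that the factors \<open>m\<close>, which are no longer available for
  contraction, have been inserted in normal order between \<open>A\<close> and \<open>B\<close>.
\<close>

definition partial_product :: "'g list \<Rightarrow> 'g list \<Rightarrow> 'g list \<Rightarrow> 'r"
  where "partial_product A m B = ((-1) ^ (inversions (A @ m @ B) + nann A * ncre B)) \<bullet>
    (cre A * cre m * ann A * cre B * ann m * ann B)"

lemma partial_product_Nil: "partial_product [] m B = normal (m @ B)"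
  by (simp add: partial_product_def normal_def mult.assoc)

text \<open>The pairs of an annihilator in A and a creator in B are counted in
  \<open>inversions (A @ B)\<close> and once more in the extra exponent of
  \<open>partial_product\<close>. They cancel modulo 2, as they must, since these pairs are still
  unsorted in the product.\<close>

lemma normal_mult: "normal A * normal B = partial_product A [] B"
proof -
  have "(-1::complex) ^ (inversions A + inversions B + nann A * ncre B + nann A * ncre B) =
      (-1) ^ inversions A * (-1) ^ inversions B"
    by (simp add: power_add)
  then show ?thesis
    by (simp add: partial_product_def normal_def mult_scale scale_mult scale_scale mult.assoc mult.commute[of "(-1) ^ inversions B" "(-1) ^ inversions A :: complex"])
qed

text \<open>A creator a already stands where the list \<open>a # m\<close> puts it. An annihilator a
  is the last factor of \<open>ann (A @ [a])\<close>, directly to the left of \<open>cre B\<close>;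
  after crossing all of \<open>cre B\<close> it is the first factor of \<open>ann (a # m)\<close>.
  The sign of a contraction depends only on the number of letters between a and \<open>B ! j\<close>
  in the word A a m B.\<close>

lemma partial_product_snoc:
  "partial_product (A @ [a]) m B \<approx> partial_product A (a # m) B +
    (\<Sum>j<length B. ((-1) ^ (j + length m) * contr a (B ! j)) \<bullet> partial_product A m (remove_nth j B))"
proof (cases "annih a")
  case False
  then show ?thesis
    by (simp add: partial_product_def contr_eq_0 mult.assoc add.assoc)
next
  case True
  let ?e = "(-1) ^ (inversions (A @ a # m @ B) + (nann A + 1) * ncre B) :: complex"
  let ?l = "cre A * cre m * ann A" and ?r = "ann m * ann B"
  have "?l * (L a * cre B) * ?r \<approx> ?l * ((-1) ^ ncre B \<bullet> (cre B * L a) +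
      (\<Sum>j<length B. ((-1) ^ ncre (take j B) * contr a (B ! j)) \<bullet> cre (remove_nth j B))) * ?r"
    by (intro eqv_mult annih_mult_cre True) simp_all
  then have "?e \<bullet> (?l * (L a * cre B) * ?r) \<approx> ?e \<bullet> (?l * ((-1) ^ ncre B \<bullet> (cre B * L a) +
      (\<Sum>j<length B. ((-1) ^ ncre (take j B) * contr a (B ! j)) \<bullet> cre (remove_nth j B))) * ?r)"
    by (rule eqv_scale)
  also have "\<dots> = (?e * (-1) ^ ncre B) \<bullet> (?l * cre B * L a * ?r) +
      (\<Sum>j<length B. (?e * ((-1) ^ ncre (take j B) * contr a (B ! j))) \<bullet> (?l * cre (remove_nth j B) * ?r))"
    by (simp only: ring_distribs scale_add sum_distrib_left sum_distrib_right scale_sum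
        mult_scale scale_mult scale_scale mult.assoc)
  also have "(?e * (-1) ^ ncre B) \<bullet> (?l * cre B * L a * ?r) = partial_product A (a # m) B"
  proof -
    \<comment> \<open>Having crossed the creators of B, a no longer belongs to the unsorted
      annihilators, and one multiple of \<open>ncre B\<close> cancels.\<close>
    have "?e * (-1) ^ ncre B = (-1) ^ (inversions (A @ (a # m) @ B) + nann A * ncre B)"
      by (simp add: power_add)
    then show ?thesis
      using True by (simp add: partial_product_def mult.assoc)
  qed
  also have "(\<Sum>j<length B. (?e * ((-1) ^ ncre (take j B) * contr a (B ! j))) \<bullet> (?l * cre (remove_nth j B) * ?r)) =
    (\<Sum>j<length B. ((-1) ^ (j + length m) * contr a (B ! j)) \<bullet> partial_product A m (remove_nth j B))"
  proof (rule sum.cong[OF refl])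
    fix j assume "j \<in> {..<length B}"
    then have j: "j < length B" by simp
    show "(?e * ((-1) ^ ncre (take j B) * contr a (B ! j))) \<bullet> (?l * cre (remove_nth j B) * ?r) =
      ((-1) ^ (j + length m) * contr a (B ! j)) \<bullet> partial_product A m (remove_nth j B)"
    proof (cases "annih (B ! j)")
      case True
      then show ?thesis by (simp add: contr_eq_0)
    next
      case False
      define u v where "u = take j B" and "v = drop (Suc j) B"
      have B: "B = u @ B ! j # v" unfolding u_def v_def by (rule id_take_nth_drop[OF j])
      have u: "j = ncre u + nann u" using j by (simp add: u_def flip: length_conv_ncre_nann)
      have rem: "remove_nth j B = u @ v" by (simp add: remove_nth_def u_def v_def)
      have nB: "ncre B = ncre u + ncre v + 1" by (subst B) (use False in simp)
      have iB: "inversions B = inversions u + inversions v + nann u * (ncre v + 1)"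
        by (subst B) (use False in \<open>simp add: algebra_simps\<close>)
      have aB: "ann B = ann (u @ v)" by (subst B) (use False in simp)
      have "?e * (-1) ^ ncre u =
          (-1) ^ (j + length m) * (-1) ^ (inversions (A @ m @ u @ v) + nann A * ncre (u @ v))"
      proof -
        \<comment> \<open>Lost are the inversions of a with the creators of m and B, and those of
          \<open>B ! j\<close> with the annihilators of A, m and u. Creators and annihilators of m
          together give \<open>length m\<close>, those of u give j, and everything else in the two
          exponents occurs an even number of times.\<close>
        have "even (inversions (A @ a # m @ B) + (nann A + 1) * ncre B + ncre u) \<longleftrightarrow>
            even (j + length m + (inversions (A @ m @ u @ v) + nann A * ncre (u @ v)))"
          by (simp add: iB nB u length_conv_ncre_nann True) argo
        then show ?thesis unfolding power_add[symmetric] unfolding minus_one_power_iff by (simp only:)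
      qed
      then have "?e * ((-1) ^ ncre u * contr a (B ! j)) = (-1) ^ (j + length m) * contr a (B ! j) *
          (-1) ^ (inversions (A @ m @ u @ v) + nann A * ncre (u @ v))"
        by (simp only: mult_ac)
      then show ?thesis
        unfolding rem aB partial_product_def scale_scale u_def[symmetric] by (simp only: mult.assoc)
    qed
  qed
  finally show ?thesis
    using True by (simp add: partial_product_def mult.assoc)
qed

end

section \<open>Signs of contractions in terms of ranks among the remaining columns\<close>

lemma sum_place_remove:
  assumes S: "finite S" and J: "J \<subseteq> S" and j: "j \<in> J"
  shows "(\<Sum>i\<in>J. place S i) + place J j =
    place S j + (\<Sum>i\<in>J - {j}. place (S - {j}) i) + card J"
proof -
  have fJ: "finite J" using S J by (rule finite_subset[rotated])
  \<comment> \<open>Deleting j lowers by one the ranks of the elements above j; in J there are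
    \<open>card J - place J j\<close> of these.\<close>
  have step: "place S i = place (S - {j}) i + (if j < i then 1 else 0)" if "i \<in> J - {j}" for i
  proof (cases "j < i")
    case True
    then have "{k \<in> S. k \<le> i} = insert j {k \<in> S - {j}. k \<le> i}" using J j by auto
    then show ?thesis using True S by (simp add: place_def)
  next
    case False
    then have "{k \<in> S. k \<le> i} = {k \<in> S - {j}. k \<le> i}" using that by auto
    then show ?thesis using False by (simp add: place_def)
  qed
  have "(\<Sum>i\<in>J. place S i) = place S j + (\<Sum>i\<in>J - {j}. place S i)"
    using fJ j by (rule sum.remove)
  also have "(\<Sum>i\<in>J - {j}. place S i) =
      (\<Sum>i\<in>J - {j}. place (S - {j}) i) + (\<Sum>i\<in>J - {j}. if j < i then 1 else 0)"
    unfolding sum.distrib[symmetric] using step by (intro sum.cong) auto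
  also have "(\<Sum>i\<in>J - {j}. if j < i then 1 else 0) = card {i \<in> J. j < i}"
    using fJ by (simp add: sum.If_cases) (rule arg_cong[where f = card], auto)
  finally have "(\<Sum>i\<in>J. place S i) = place S j + (\<Sum>i\<in>J - {j}. place (S - {j}) i) + card {i \<in> J. j < i}"
    by simp
  moreover have "card J = card ({i \<in> J. i \<le> j} \<union> {i \<in> J. j < i})"
    by (rule arg_cong[where f = card]) auto
  then have "card J = place J j + card {i \<in> J. j < i}"
    unfolding place_def using fJ by (subst (asm) card_Un_disjoint) auto
  ultimately show ?thesis by simp
qed

lemma leibniz_det_expand_set:
  assumes "finite J" and "card J = Suc (length is)"
  shows "leibniz_det c (is @ [i]) (sl J) =
    (\<Sum>j\<in>J. (-1) ^ (length is + (place J j - 1)) * c i j * leibniz_det c is (sl (J - {j})))"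
proof -
  have "leibniz_det c (is @ [i]) (sl J) =
    (\<Sum>l<card J. (-1) ^ (length is + l) * c i (sl J ! l) * leibniz_det c is (remove_nth l (sl J)))"
    using assms by (simp add: leibniz_det_snoc lessThan_Suc_atMost)
  then show ?thesis
    by (simp only: sum_nth_sl[OF assms(1),
          of "\<lambda>l j js. (-1) ^ (length is + l) * c i j * leibniz_det c is js"])
qed

text \<open>The exponent of the theorem with ranks in S for the column indices. The extra
  \<open>k * card I\<close> arises because every contracted factor of A also crosses the k factors
  that stand between A and B.\<close>

definition wick_sign :: "nat \<Rightarrow> nat \<Rightarrow> nat set \<Rightarrow> nat set \<Rightarrow> nat set \<Rightarrow> complex"
  where "wick_sign r k S I J = (-1) ^ (\<Sum>I + (\<Sum>j\<in>J. place S j) +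
    (r * card I + card I * (card I + 1) div 2) + k * card I)"

text \<open>Contracting factor r + 1 with j and then I with J - {j} must agree with contracting the
  enlarged set of rows with J, up to the cofactor sign of column j in the last row. Two effects
  balance: deleting j shifts the later ranks, and the triangular number grows by
  \<open>card I + 1\<close>.\<close>

lemma wick_sign_remove:
  assumes S: "finite S" and J: "J \<subseteq> S" and j: "j \<in> J" and I: "I \<subseteq> {1..r}" and c: "card J = Suc (card I)"
  shows "wick_sign (Suc r) k S (insert (Suc r) I) J * (-1) ^ (card I + (place J j - 1)) =
    (-1) ^ (place S j - 1 + k) * wick_sign r k (S - {j}) I (J - {j})"
proof -
  have fI: "finite I" using I by (rule finite_subset) simp
  have r: "Suc r \<notin> I" using I by auto
  have fJ: "finite J" using S J by (rule finite_subset[rotated])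
  \<comment> \<open>Ranks of members are positive, so the subtractions of 1 are exact.\<close>
  have pos: "place T j \<ge> 1" if "finite T" "j \<in> T" for T
  proof -
    have "{i \<in> T. i \<le> j} \<noteq> {}" using that by auto
    then show ?thesis using that(1) unfolding place_def by (simp add: Suc_le_eq card_gt_0_iff)
  qed
  obtain u where u: "place J j = Suc u" using pos[OF fJ j] by (cases "place J j") auto
  obtain v where v: "place S j = Suc v" using pos[of S] S J j by (cases "place S j") auto
  have e: "(\<Sum>i\<in>J. place S i) + u = v + (\<Sum>i\<in>J - {j}. place (S - {j}) i) + Suc (card I)"
    using sum_place_remove[OF S J j] u v c by simp
  define t where "t = card I * (card I + 1) div 2"
  have t: "Suc (card I) * (Suc (card I) + 1) div 2 = t + Suc (card I)"
  proof -
    have "Suc (card I) * (Suc (card I) + 1) = card I * (card I + 1) + Suc (card I) * 2" by simp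
    then show ?thesis unfolding t_def by (simp only: div_mult_self1[OF zero_neq_numeral[symmetric]])
  qed
  define x y w where "x = (\<Sum>i\<in>J. place S i)" and "y = (\<Sum>i\<in>J - {j}. place (S - {j}) i)" and "w = card I"
  have "even (x + u) = even (v + y + Suc w)" using e unfolding x_def y_def w_def by simp
  then have "even (Suc r + \<Sum>I + x + (Suc r * Suc w + (t + Suc w)) + k * Suc w + (w + u)) =
    even (v + k + (\<Sum>I + y + (r * w + t) + k * w))"
    by simp argo
  then have "(-1::complex) ^ (Suc r + \<Sum>I + x + (Suc r * Suc w + (t + Suc w)) + k * Suc w + (w + u)) =
    (-1) ^ (v + k + (\<Sum>I + y + (r * w + t) + k * w))"
    unfolding minus_one_power_iff by (simp only:)
  then show ?thesis
    using fI r u v t unfolding wick_sign_def x_def y_def w_def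
    by (simp only: card_insert_disjoint sum.insert diff_Suc_1 t_def power_add[symmetric] simp_thms)
qed

text \<open>Both sides run over the subsets of size \<rho> + 1 with a distinguished element; on the
  right the element is chosen first.\<close>

lemma sum_subsets_remove:
  fixes g :: "'x \<Rightarrow> 'x set \<Rightarrow> 'y::comm_monoid_add"
  assumes "finite S"
  shows "(\<Sum>J | J \<subseteq> S \<and> card J = Suc \<rho>. \<Sum>j\<in>J. g j (J - {j})) =
    (\<Sum>j\<in>S. \<Sum>J | J \<subseteq> S - {j} \<and> card J = \<rho>. g j J)"
proof -
  have fin: "finite {J. J \<subseteq> T \<and> card J = k}" if "finite T" for T :: "'x set" and k
    using that by simp
  have "(\<Sum>J | J \<subseteq> S \<and> card J = Suc \<rho>. \<Sum>j\<in>J. g j (J - {j})) =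
      (\<Sum>(J, j)\<in>(SIGMA J:{J. J \<subseteq> S \<and> card J = Suc \<rho>}. J). g j (J - {j}))"
    using assms by (intro sum.Sigma) (auto intro: finite_subset)
  also have "\<dots> = (\<Sum>(j, J)\<in>(SIGMA j:S. {J. J \<subseteq> S - {j} \<and> card J = \<rho>}). g j J)"
    by (rule sum.reindex_bij_witness[of _ "\<lambda>(j, J). (insert j J, j)" "\<lambda>(J, j). (j, J - {j})"])
      (use assms in \<open>auto simp: card_insert_disjoint finite_subset insert_absorb subset_Diff_insert
        card_Diff_singleton intro: finite_subset\<close>)
  also have "\<dots> = (\<Sum>j\<in>S. \<Sum>J | J \<subseteq> S - {j} \<and> card J = \<rho>. g j J)"
    using assms by (intro sum.Sigma[symmetric]) auto
  finally show ?thesis .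
qed

lemma sl_Suc_Diff:
  assumes "I \<subseteq> {1..r}"
  shows "sl ({1..Suc r} - I) = sl ({1..r} - I) @ [Suc r]"
proof -
  have "{1..Suc r} - I = insert (Suc r) ({1..r} - I)" using assms by auto
  then show ?thesis by (simp add: sorted_list_of_set_insert_remove) (rule sorted_insort_is_snoc, auto)
qed

lemma sl_insert_Suc:
  assumes "I \<subseteq> {1..r}"
  shows "sl (insert (Suc r) I) = sl I @ [Suc r]"
proof -
  have fin: "finite I" using assms by (rule finite_subset) simp
  have "Suc r \<notin> I" using assms by auto
  with fin show ?thesis
    by (simp add: sorted_list_of_set_insert_remove) (rule sorted_insort_is_snoc, use assms fin in auto)
qed

section \<open>Wick's theorem by removing the factors of A from the right\<close>

context contraction_algebra
begin

text \<open>The list m and the set S must vary in the induction on r: factor r + 1 either joins m,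
  which accounts for the sets I without r + 1, or it is contracted with some j in S, which leaves S
  - {j}. In the second case the sum over j is the expansion of a determinant along its last
  row.\<close>

lemma wick_partial:
  fixes \<alpha> \<beta> :: "nat \<Rightarrow> 'g"
  defines "c \<equiv> (\<lambda>i j. contr (\<alpha> i) (\<beta> j))"
  assumes "finite S"
  shows "partial_product (map \<alpha> [1..<Suc r]) (map \<alpha> m) (map \<beta> (sl S)) \<approx>
    (\<Sum>I\<in>Pow {1..r}. \<Sum>J | J \<subseteq> S \<and> card J = card I.
      (wick_sign r (length m) S I J * leibniz_det c (sl I) (sl J)) \<bullet>
      normal (map \<alpha> (sl ({1..r} - I) @ m) @ map \<beta> (sl (S - J))))"
  using assms(2)
proof (induction r arbitrary: m S)
  case 0
  have "{J. J \<subseteq> S \<and> card J = 0} = {{}}" using 0 by (auto dest: finite_subset)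
  then show ?case by (simp add: partial_product_Nil wick_sign_def)
next
  case (Suc r)
  let ?term = "\<lambda>r m S I J. (wick_sign r (length m) S I J * leibniz_det c (sl I) (sl J)) \<bullet>
      normal (map \<alpha> (sl ({1..r} - I) @ m) @ map \<beta> (sl (S - J)))"
  let ?rhs = "\<lambda>r m S. \<Sum>I\<in>Pow {1..r}. \<Sum>J | J \<subseteq> S \<and> card J = card I. ?term r m S I J"
  let ?A = "map \<alpha> [1..<Suc r]"
  let ?k = "\<lambda>j. (-1) ^ (place S j - 1 + length m) * c (Suc r) j"
  have "partial_product (map \<alpha> [1..<Suc (Suc r)]) (map \<alpha> m) (map \<beta> (sl S)) =
      partial_product (?A @ [\<alpha> (Suc r)]) (map \<alpha> m) (map \<beta> (sl S))" by simp
  also have "\<dots> \<approx> partial_product ?A (map \<alpha> (Suc r # m)) (map \<beta> (sl S)) +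
      (\<Sum>l<card S. ((-1) ^ (l + length m) * c (Suc r) (sl S ! l)) \<bullet>
        partial_product ?A (map \<alpha> m) (map \<beta> (remove_nth l (sl S))))"
    using partial_product_snoc[of ?A "\<alpha> (Suc r)" "map \<alpha> m" "map \<beta> (sl S)"]
    by (simp add: c_def map_remove_nth)
  also have "(\<Sum>l<card S. ((-1) ^ (l + length m) * c (Suc r) (sl S ! l)) \<bullet>
        partial_product ?A (map \<alpha> m) (map \<beta> (remove_nth l (sl S)))) =
      (\<Sum>j\<in>S. ?k j \<bullet> partial_product ?A (map \<alpha> m) (map \<beta> (sl (S - {j}))))"
    by (simp only: sum_nth_sl[OF Suc.prems, of "\<lambda>l j js. ((-1) ^ (l + length m) * c (Suc r) j) \<bullet>
        partial_product ?A (map \<alpha> m) (map \<beta> js)"])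
  also have "partial_product ?A (map \<alpha> (Suc r # m)) (map \<beta> (sl S)) +
      (\<Sum>j\<in>S. ?k j \<bullet> partial_product ?A (map \<alpha> m) (map \<beta> (sl (S - {j})))) \<approx>
      ?rhs r (Suc r # m) S + (\<Sum>j\<in>S. ?k j \<bullet> ?rhs r m (S - {j}))"
    using Suc.prems by (intro eqv_add eqv_sum eqv_scale Suc.IH) auto
  \<comment> \<open>Whether r + 1 is counted among the inserted factors or among the rows makes no
    difference to the sign: either way the exponent grows by \<open>card I\<close>.\<close>
  also have "?rhs r (Suc r # m) S =
      (\<Sum>I\<in>Pow {1..r}. \<Sum>J | J \<subseteq> S \<and> card J = card I. ?term (Suc r) m S I J)"
    by (intro sum.cong refl) (simp add: sl_Suc_Diff[unfolded One_nat_def] wick_sign_def algebra_simps)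
  also have "(\<Sum>j\<in>S. ?k j \<bullet> ?rhs r m (S - {j})) =
      (\<Sum>I\<in>Pow {1..r}. \<Sum>J | J \<subseteq> S \<and> card J = card (insert (Suc r) I).
        ?term (Suc r) m S (insert (Suc r) I) J)"
  proof -
    have "(\<Sum>j\<in>S. ?k j \<bullet> ?rhs r m (S - {j})) =
        (\<Sum>I\<in>Pow {1..r}. \<Sum>j\<in>S. \<Sum>J | J \<subseteq> S - {j} \<and> card J = card I. ?k j \<bullet> ?term r m (S - {j}) I J)"
      unfolding scale_sum by (rule sum.swap)
    \<comment> \<open>From here on J contains the column j of the new row besides those of the
      minor.\<close>
    also have "\<dots> = (\<Sum>I\<in>Pow {1..r}. \<Sum>J | J \<subseteq> S \<and> card J = Suc (card I).
        \<Sum>j\<in>J. ?k j \<bullet> ?term r m (S - {j}) I (J - {j}))"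
      using sum_subsets_remove[OF Suc.prems, of "\<lambda>j J. ?k j \<bullet> ?term r m (S - {j}) _ J"]
      by (intro sum.cong refl) simp
    also have "\<dots> = (\<Sum>I\<in>Pow {1..r}. \<Sum>J | J \<subseteq> S \<and> card J = card (insert (Suc r) I).
        ?term (Suc r) m S (insert (Suc r) I) J)"
    proof (intro sum.cong refl)
      fix I assume "I \<in> Pow {1..r}"
      then have I: "I \<subseteq> {1..r}" by simp
      then have fI: "finite I" by (rule finite_subset) simp
      have r: "Suc r \<notin> I" using I by auto
      show "{J. J \<subseteq> S \<and> card J = Suc (card I)} = {J. J \<subseteq> S \<and> card J = card (insert (Suc r) I)}"
        using fI r by simp
      fix J assume "J \<in> {J. J \<subseteq> S \<and> card J = card (insert (Suc r) I)}"
      then have J: "J \<subseteq> S" and c: "card J = Suc (card I)" using fI r by auto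
      have fJ: "finite J" using Suc.prems J by (rule finite_subset[rotated])
      have D: "{1..Suc r} - insert (Suc r) I = {1..r} - I" using r by auto
      \<comment> \<open>The expansion is carried out on the larger determinant, to be compared with
        the sum over j term by term.\<close>
      have "?term (Suc r) m S (insert (Suc r) I) J =
        (\<Sum>j\<in>J. (wick_sign (Suc r) (length m) S (insert (Suc r) I) J *
          ((-1) ^ (card I + (place J j - 1)) * c (Suc r) j * leibniz_det c (sl I) (sl (J - {j})))) \<bullet>
          normal (map \<alpha> (sl ({1..r} - I) @ m) @ map \<beta> (sl (S - J))))"
        using fJ c
        by (simp add: D[unfolded One_nat_def] sl_insert_Suc[OF I] leibniz_det_expand_set sum_distrib_left sum_scale)
      also have "\<dots> = (\<Sum>j\<in>J. ?k j \<bullet> ?term r m (S - {j}) I (J - {j}))"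
      proof (intro sum.cong refl)
        fix j assume j: "j \<in> J"
        have "S - {j} - (J - {j}) = S - J" using j by auto
        then show "(wick_sign (Suc r) (length m) S (insert (Suc r) I) J *
            ((-1) ^ (card I + (place J j - 1)) * c (Suc r) j * leibniz_det c (sl I) (sl (J - {j})))) \<bullet>
            normal (map \<alpha> (sl ({1..r} - I) @ m) @ map \<beta> (sl (S - J))) =
          ?k j \<bullet> ?term r m (S - {j}) I (J - {j})"
          using wick_sign_remove[OF Suc.prems J j I c, of "length m"]
          by (simp add: scale_scale mult.assoc[symmetric]) (simp add: mult_ac)
      qed
      finally show "(\<Sum>j\<in>J. ?k j \<bullet> ?term r m (S - {j}) I (J - {j})) =
          ?term (Suc r) m S (insert (Suc r) I) J" ..
    qed
    finally show ?thesis .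
  qed
  also have "(\<Sum>I\<in>Pow {1..r}. \<Sum>J | J \<subseteq> S \<and> card J = card I. ?term (Suc r) m S I J) +
      (\<Sum>I\<in>Pow {1..r}. \<Sum>J | J \<subseteq> S \<and> card J = card (insert (Suc r) I).
        ?term (Suc r) m S (insert (Suc r) I) J) = ?rhs (Suc r) m S"
  proof -
    \<comment> \<open>The subsets without r + 1 and those with r + 1 are the two cases treated
      above.\<close>
    have "Pow {1..Suc r} = Pow {1..r} \<union> insert (Suc r) ` Pow {1..r}"
      by (simp add: atLeastAtMostSuc_conv Pow_insert)
    moreover have "Pow {1..r} \<inter> insert (Suc r) ` Pow {1..r} = {}" by auto
    moreover have "inj_on (insert (Suc r)) (Pow {1..r})"
      by (rule inj_on_inverseI[where g = "\<lambda>I. I - {Suc r}"]) auto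
    ultimately show ?thesis by (simp add: sum.union_disjoint sum.reindex del: Pow_insert)
  qed
  finally show ?case .
qed

text \<open>With no inserted factors and all of {1..s} available, ranks are the indices themselves
  and the sign becomes that of the theorem.\<close>

theorem wick:
  fixes \<alpha> \<beta> :: "nat \<Rightarrow> 'g"
  shows "normal (map \<alpha> [1..<Suc r]) * normal (map \<beta> [1..<Suc s]) \<approx>
    (\<Sum>I\<in>Pow {1..r}. \<Sum>J | J \<subseteq> {1..s} \<and> card J = card I.
      ((-1) ^ (\<Sum>I + \<Sum>J) * (-1) ^ (r * card I + card I * (card I + 1) div 2) *
        leibniz_det (\<lambda>i j. contr (\<alpha> i) (\<beta> j)) (sl I) (sl J)) \<bullet>
      normal (map \<alpha> (sl ({1..r} - I)) @ map \<beta> (sl ({1..s} - J))))"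
proof -
  have sl: "sl {1..s} = [1..<Suc s]"
    by (metis atLeastLessThanSuc_atLeastAtMost sorted_list_of_set_range)
  have place: "place {1..s} j = j" if "j \<in> {1..s}" for j
  proof -
    have "{i \<in> {1..s}. i \<le> j} = {1..j}" using that by auto
    then show ?thesis by (simp add: place_def)
  qed
  have "(\<Sum>j\<in>J. place {1..s} j) = \<Sum>J" if "J \<subseteq> {1..s}" for J
    using that by (intro sum.cong refl place) blast
  then have sign: "wick_sign r 0 {1..s} I J =
      (-1) ^ (\<Sum>I + \<Sum>J) * (-1) ^ (r * card I + card I * (card I + 1) div 2)"
    if "J \<subseteq> {1..s}" for I J
    using that by (simp only: wick_sign_def power_add mult_zero_left power_0 mult_1_right)
  have "normal (map \<alpha> [1..<Suc r]) * normal (map \<beta> [1..<Suc s]) =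
      partial_product (map \<alpha> [1..<Suc r]) (map \<alpha> []) (map \<beta> (sl {1..s}))"
    by (simp only: sl normal_mult list.map)
  also have "\<dots> \<approx> (\<Sum>I\<in>Pow {1..r}. \<Sum>J | J \<subseteq> {1..s} \<and> card J = card I.
      (wick_sign r (length ([] :: nat list)) {1..s} I J *
        leibniz_det (\<lambda>i j. contr (\<alpha> i) (\<beta> j)) (sl I) (sl J)) \<bullet>
      normal (map \<alpha> (sl ({1..r} - I) @ []) @ map \<beta> (sl ({1..s} - J))))"
    by (rule wick_partial) simp
  also have "\<dots> = (\<Sum>I\<in>Pow {1..r}. \<Sum>J | J \<subseteq> {1..s} \<and> card J = card I.
      ((-1) ^ (\<Sum>I + \<Sum>J) * (-1) ^ (r * card I + card I * (card I + 1) div 2) *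
        leibniz_det (\<lambda>i j. contr (\<alpha> i) (\<beta> j)) (sl I) (sl J)) \<bullet>
      normal (map \<alpha> (sl ({1..r} - I)) @ map \<beta> (sl ({1..s} - J))))"
    by (intro sum.cong refl) (simp only: mem_Collect_eq sign append_Nil2 list.size)
  finally show ?thesis .
qed

end

section \<open>The algebra N as a quotient of the free algebra\<close>

lemma abelian_group_free_algebra: "abelian_group (free_algebra :: 'w free_alg ring)"
  by (rule abelian_groupI) (auto simp: free_algebra_def algebra_simps intro: exI[of _ "- x" for x])

lemma ring_free_algebra: "ring (free_algebra :: 'w free_alg ring)"
  by (rule ringI[OF abelian_group_free_algebra])
    (auto simp: free_algebra_def algebra_simps intro: Group.monoidI)

lemma free_algebra_simps [simp]:
  "carrier (free_algebra :: 'w free_alg ring) = UNIV"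
  "x \<otimes>\<^bsub>free_algebra\<^esub> y = x * (y :: 'w free_alg)"
  "x \<oplus>\<^bsub>free_algebra\<^esub> y = x + (y :: 'w free_alg)"
  "\<one>\<^bsub>free_algebra\<^esub> = (1 :: 'w free_alg)"
  "\<zero>\<^bsub>free_algebra\<^esub> = (0 :: 'w free_alg)"
  by (simp_all add: free_algebra_def)

lemma free_algebra_minus [simp]: "x \<ominus>\<^bsub>free_algebra\<^esub> y = x - (y :: 'w free_alg)"
proof -
  interpret ring "free_algebra :: 'w free_alg ring" by (rule ring_free_algebra)
  have "\<ominus>\<^bsub>free_algebra\<^esub> y = - y" by (rule minus_equality) simp_all
  then show ?thesis by (simp add: a_minus_def)
qed

lemma alg_scalar_0: "alg_scalar 0 = 0"
  by (simp add: alg_scalar_def)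

lemma alg_scalar_1: "alg_scalar 1 = 1"
  by (simp add: alg_scalar_def)

lemma alg_scalar_add: "alg_scalar (c + d) = alg_scalar c + alg_scalar d"
  by (simp add: alg_scalar_def single_add)

lemma alg_scalar_mult: "alg_scalar (c * d) = alg_scalar c * alg_scalar d"
  by (simp add: alg_scalar_def mult_single)

lemma poly_mapping_expand: "f = (\<Sum>k\<in>Poly_Mapping.keys f. Poly_Mapping.single k (Poly_Mapping.lookup f k))"
  by (rule poly_mapping_eqI) (auto simp: lookup_sum lookup_single when_def in_keys_iff)

lemma alg_scalar_commute:
  fixes x :: "'w free_alg"
  shows "x * alg_scalar c = alg_scalar c * x"
proof -
  have "Poly_Mapping.single w d * alg_scalar c = alg_scalar c * Poly_Mapping.single w d" for w :: "'w word" and d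
    by (simp add: alg_scalar_def mult_single mult.commute)
  then show ?thesis
    by (subst (1 2) poly_mapping_expand[of x]) (simp add: sum_distrib_left sum_distrib_right)
qed

lemma free_alg_induct [case_names add mult const letter]:
  fixes x :: "'w free_alg"
  assumes add: "\<And>x y. P x \<Longrightarrow> P y \<Longrightarrow> P (x + y)"
    and mult: "\<And>x y. P x \<Longrightarrow> P y \<Longrightarrow> P (x * y)"
    and const: "\<And>c. P (alg_scalar c)"
    and letter: "\<And>w. P (letter w)"
  shows "P x"
proof -
  have words: "P (Poly_Mapping.single (Word ws) 1)" for ws
  proof (induction ws)
    case Nil
    then show ?case using const[of 1] by (simp add: alg_scalar_def zero_word_def)
  next
    case (Cons w ws)
    have "Poly_Mapping.single (Word (w # ws)) 1 = letter w * Poly_Mapping.single (Word ws) 1"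
      by (simp add: letter_def mult_single)
    then show ?case using Cons letter mult by simp
  qed
  have single: "P (Poly_Mapping.single w c)" for w c
  proof (cases w)
    case (Word ws)
    then have "Poly_Mapping.single w c = alg_scalar c * Poly_Mapping.single (Word ws) 1"
      by (simp add: alg_scalar_def mult_single)
    then show ?thesis using const words mult by simp
  qed
  have zero: "P 0" using const[of 0] by (simp add: alg_scalar_0)
  have "P (\<Sum>k\<in>A. Poly_Mapping.single k (Poly_Mapping.lookup x k))" if "finite A" for A
    using that by induction (auto intro: zero add single)
  from this[OF finite_keys[of x]] show ?thesis by (simp flip: poly_mapping_expand)
qed

lemma ideal_tensor_ideal: "ideal (tensor_ideal sc) free_algebra"
  unfolding tensor_ideal_def by (rule ring.genideal_ideal[OF ring_free_algebra]) simp

lemma ring_tensor_algebra: "ring (tensor_algebra sc)"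
  unfolding tensor_algebra_def by (rule ideal.quotient_is_ring[OF ideal_tensor_ideal])

definition tensor_class ::
    "(complex \<Rightarrow> 'w::ab_group_add \<Rightarrow> 'w) \<Rightarrow> 'w free_alg \<Rightarrow> 'w free_alg set"
  where "tensor_class sc x = tensor_ideal sc +>\<^bsub>free_algebra\<^esub> x"

lemma tensor_class_hom: "tensor_class sc \<in> ring_hom free_algebra (tensor_algebra sc)"
  using ideal.rcos_ring_hom[OF ideal_tensor_ideal]
  unfolding tensor_class_def[abs_def] tensor_algebra_def .

lemma tensor_class_eqI: "x - y \<in> tensor_ideal sc \<Longrightarrow> tensor_class sc x = tensor_class sc y"
  using ring.quotient_eq_iff_same_a_r_cos[OF ring_free_algebra ideal_tensor_ideal, of x y]
  by (simp add: tensor_class_def)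

lemma tensor_class_letter_add:
  "tensor_class sc (letter (u + v)) = tensor_class sc (letter u + letter v)"
  and tensor_class_letter_scale:
  "tensor_class sc (letter (sc c u)) = tensor_class sc (alg_scalar c * letter u)"
proof -
  let ?R = "{letter (u + v) - (letter u + letter v) | u v. True} \<union>
     {letter (sc c u) - alg_scalar c * letter u | c u. True}"
  have "?R \<subseteq> tensor_ideal sc"
    unfolding tensor_ideal_def by (rule ring.genideal_self[OF ring_free_algebra]) simp
  then show "tensor_class sc (letter (u + v)) = tensor_class sc (letter u + letter v)"
    and "tensor_class sc (letter (sc c u)) = tensor_class sc (alg_scalar c * letter u)"
    by (intro tensor_class_eqI; blast)+
qed

lemma N_relations_subset: "N_relations sc B \<subseteq> carrier (affine_tensor sc)"
proof -
  interpret T: ring "affine_tensor sc" by (rule ring_tensor_algebra)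
  have gen: "tensor_gen (affine_scale sc) u \<in> carrier (affine_tensor sc)" for u
    using ring_hom_closed[OF tensor_class_hom] by (simp add: tensor_gen_def tensor_class_def)
  have const: "tensor_const (affine_scale sc) c \<in> carrier (affine_tensor sc)" for c
    using ring_hom_closed[OF tensor_class_hom] by (simp add: tensor_const_def tensor_class_def)
  show ?thesis unfolding N_relations_def Let_def
    by (rule subsetI, elim UnE CollectE exE conjE)
      (simp_all only:, (intro T.minus_closed T.add.m_closed T.m_closed gen const)+)
qed

lemma ideal_N_ideal: "ideal (N_ideal sc B) (affine_tensor sc)"
  unfolding N_ideal_def by (rule ring.genideal_ideal[OF ring_tensor_algebra N_relations_subset])

lemma ring_N_algebra: "ring (N_algebra sc B)"
  unfolding N_algebra_def by (rule ideal.quotient_is_ring[OF ideal_N_ideal])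

text \<open>A single homomorphism from the free algebra covers both the generators and the constants
  of N. It is onto, so statements about elements of N can be proved for representatives in the free
  algebra.\<close>

definition N_class ::
    "(complex \<Rightarrow> 'h::ab_group_add \<Rightarrow> 'h) \<Rightarrow> ('h \<Rightarrow> 'h \<Rightarrow> complex) \<Rightarrow> 'h affine free_alg \<Rightarrow> 'h N_elt"
  where "N_class sc B x = N_ideal sc B +>\<^bsub>affine_tensor sc\<^esub> tensor_class (affine_scale sc) x"

lemma N_gen_conv: "N_gen sc B u = N_class sc B (letter u)"
  by (simp add: N_gen_def tensor_gen_def N_class_def tensor_class_def)

lemma N_const_conv: "N_const sc B c = N_class sc B (alg_scalar c)"
  by (simp add: N_const_def tensor_const_def N_class_def tensor_class_def)

lemma N_class_hom: "N_class sc B \<in> ring_hom free_algebra (N_algebra sc B)"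
  using ring_hom_trans[OF tensor_class_hom ideal.rcos_ring_hom[OF ideal_N_ideal]]
  by (simp add: N_class_def[abs_def] N_algebra_def comp_def)

lemma N_class_closed [simp]: "N_class sc B x \<in> carrier (N_algebra sc B)"
  using ring_hom_closed[OF N_class_hom] by simp

lemma N_class_mult: "N_class sc B (x * y) = N_class sc B x \<otimes>\<^bsub>N_algebra sc B\<^esub> N_class sc B y"
  using ring_hom_mult[OF N_class_hom, of x y] by simp

lemma N_class_add: "N_class sc B (x + y) = N_class sc B x \<oplus>\<^bsub>N_algebra sc B\<^esub> N_class sc B y"
  using ring_hom_add[OF N_class_hom, of x y] by simp

lemma N_class_one: "N_class sc B 1 = \<one>\<^bsub>N_algebra sc B\<^esub>"
  using ring_hom_one[OF N_class_hom] by simp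

lemma carrier_N_algebra: "carrier (N_algebra sc B) = range (N_class sc B)"
proof
  show "carrier (N_algebra sc B) \<subseteq> range (N_class sc B)"
    by (auto simp: N_algebra_def tensor_algebra_def FactRing_def A_RCOSETS_def' N_class_def tensor_class_def)
qed auto

lemma N_class_cong_tensor:
  "tensor_class (affine_scale sc) x = tensor_class (affine_scale sc) y \<Longrightarrow> N_class sc B x = N_class sc B y"
  by (simp add: N_class_def)

lemma N_class_cong_mult:
  "N_class sc B x = N_class sc B x' \<Longrightarrow> N_class sc B y = N_class sc B y' \<Longrightarrow>
    N_class sc B (x * y) = N_class sc B (x' * y')"
  by (simp add: N_class_mult)

lemma N_class_cong_add:
  "N_class sc B x = N_class sc B x' \<Longrightarrow> N_class sc B y = N_class sc B y' \<Longrightarrow>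
    N_class sc B (x + y) = N_class sc B (x' + y')"
  by (simp add: N_class_add)

lemmas N_class_letter_add = N_class_cong_tensor[OF tensor_class_letter_add]
lemmas N_class_letter_scale = N_class_cong_tensor[OF tensor_class_letter_scale]

abbreviation mode_letter :: "'h::ab_group_add \<Rightarrow> int \<Rightarrow> 'h affine free_alg"
  where "mode_letter a m \<equiv> letter (loop_elt a m)"

abbreviation central_letter :: "'h::ab_group_add affine free_alg"
  where "central_letter \<equiv> letter central_elt"

lemma N_class_anticommutator:
  "m \<ge> 0 \<Longrightarrow> n \<le> -1 \<Longrightarrow>
    N_class sc B (mode_letter a m * mode_letter b n + mode_letter b n * mode_letter a m) =
    N_class sc B (alg_scalar (if m + n + 1 = 0 then B a b else 0) * central_letter)"
  and N_class_central_mode: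
  "N_class sc B (mode_letter a k * central_letter) = N_class sc B (central_letter * mode_letter a k)"
proof -
  let ?T = "affine_tensor sc" and ?t = "tensor_class (affine_scale sc)"
  interpret T: ring ?T by (rule ring_tensor_algebra)
  have sub: "N_relations sc B \<subseteq> N_ideal sc B"
    unfolding N_ideal_def by (rule T.genideal_self[OF N_relations_subset])
  have clos: "?t x \<in> carrier ?T" for x
    using ring_hom_closed[OF tensor_class_hom] by simp
  have eqI: "N_class sc B x = N_class sc B y" if "?t x \<ominus>\<^bsub>?T\<^esub> ?t y \<in> N_relations sc B" for x y
    using T.quotient_eq_iff_same_a_r_cos[OF ideal_N_ideal clos clos] that sub
    by (auto simp: N_class_def)
  have tmult: "?t (x * y) = ?t x \<otimes>\<^bsub>?T\<^esub> ?t y" for x y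
    using ring_hom_mult[OF tensor_class_hom, of x y] by simp
  have tadd: "?t (x + y) = ?t x \<oplus>\<^bsub>?T\<^esub> ?t y" for x y
    using ring_hom_add[OF tensor_class_hom, of x y] by simp
  note rel = N_relations_def Let_def tensor_gen_def tensor_const_def tensor_class_def[symmetric]
  show "N_class sc B (mode_letter a m * mode_letter b n + mode_letter b n * mode_letter a m) =
    N_class sc B (alg_scalar (if m + n + 1 = 0 then B a b else 0) * central_letter)" if "m \<ge> 0" "n \<le> -1"
    by (rule eqI) (use that in \<open>unfold rel tmult tadd, blast\<close>)
  show "N_class sc B (mode_letter a k * central_letter) = N_class sc B (central_letter * mode_letter a k)"
    by (rule eqI) (unfold rel tmult tadd, blast)
qed

text \<open>There is a letter for every vector of the affinization, whereas the relations of N speak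
  only of homogeneous vectors and k. Every vector is a finite sum of homogeneous ones and a multiple
  of k, so additive properties extend from these to all letters.\<close>

lemma affine_letter_induct [case_names zero add loop central]:
  fixes u :: "'h::ab_group_add affine"
  assumes "P 0" and add: "\<And>u v. P u \<Longrightarrow> P v \<Longrightarrow> P (u + v)"
    and loop: "\<And>a m. P (loop_elt a m)" and central: "\<And>c. P (affine_scale sc c central_elt)"
  shows "P u"
proof -
  obtain f z where u: "u = (f, z)" by (cases u)
  have "P (\<Sum>m\<in>A. loop_elt (Poly_Mapping.lookup f m) m)" if "finite A" for A
    using that by induction (auto intro: assms)
  note this[OF finite_keys[of f]]
  also have "(\<Sum>m\<in>Poly_Mapping.keys f. loop_elt (Poly_Mapping.lookup f m) m) = (f, 0)"
  proof (rule prod_eqI)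
    show "fst (\<Sum>m\<in>Poly_Mapping.keys f. loop_elt (Poly_Mapping.lookup f m) m) = fst (f, 0::complex)"
      unfolding fst_sum loop_elt_def fst_conv by (rule poly_mapping_expand[symmetric])
  qed (simp add: snd_sum loop_elt_def)
  finally have "P (f, 0)" .
  \<comment> \<open>\<open>Poly_Mapping.map\<close> keeps zero coefficients at 0, whatever
    \<open>sc z 0\<close> is.\<close>
  moreover have "affine_scale sc z central_elt = (0, z)"
    by (simp add: affine_scale_def central_elt_def poly_mapping_eq_iff Poly_Mapping.map.rep_eq fun_eq_iff)
  then have "P (0, z)" using central[of z] by simp
  ultimately have "P ((f, 0) + (0, z))" by (rule add)
  then show ?thesis by (simp add: u)
qed

text \<open>Only commutation with the homogeneous generators is imposed. It passes to sums and
  products in the free algebra and, within a single letter, along the linear structure of the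
  affinization. That k acts as 1 on V rests on this.\<close>

lemma N_class_central: "N_class sc B (x * central_letter) = N_class sc B (central_letter * x)"
proof (induction x rule: free_alg_induct)
  case (add x y)
  then show ?case unfolding ring_distribs by (rule N_class_cong_add)
next
  case (mult x y)
  have "N_class sc B (x * (y * central_letter)) = N_class sc B (x * (central_letter * y))"
    by (rule N_class_cong_mult[OF refl mult(2)])
  also have "\<dots> = N_class sc B ((x * central_letter) * y)" by (simp add: mult.assoc)
  also have "\<dots> = N_class sc B ((central_letter * x) * y)"
    by (rule N_class_cong_mult[OF mult(1) refl])
  finally show ?case by (simp add: mult.assoc)
next
  case (const c)
  then show ?case by (simp add: alg_scalar_commute)
next
  case (letter w)
  let ?P = "\<lambda>w. N_class sc B (letter w * central_letter) = N_class sc B (central_letter * letter w)"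
  show ?case
  proof (induction w rule: affine_letter_induct[where sc = sc])
    case zero
    \<comment> \<open>The letter of the zero vector is not 0 in the free algebra. It is 0 in N,
      where it equals 0 times itself.\<close>
    have "affine_scale sc 0 0 = 0"
      by (simp add: affine_scale_def zero_prod_def poly_mapping_eq_iff Poly_Mapping.map.rep_eq fun_eq_iff)
    then have "N_class sc B (letter 0) = N_class sc B 0"
      using N_class_letter_scale[of sc B 0 0] by (simp add: alg_scalar_0)
    from N_class_cong_mult[OF this refl, of central_letter] N_class_cong_mult[OF refl this, of central_letter]
    show ?case by simp
  next
    case (add u v)
    have "N_class sc B (letter (u + v) * central_letter) = N_class sc B ((letter u + letter v) * central_letter)"
      by (intro N_class_cong_mult N_class_letter_add refl)
    also have "\<dots> = N_class sc B (central_letter * (letter u + letter v))"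
      using add unfolding ring_distribs by (rule N_class_cong_add)
    also have "\<dots> = N_class sc B (central_letter * letter (u + v))"
      by (intro N_class_cong_mult N_class_letter_add[symmetric] refl)
    finally show ?case .
  next
    case (loop a m)
    then show ?case by (rule N_class_central_mode)
  next
    case (central c)
    have "N_class sc B (letter (affine_scale sc c central_elt) * central_letter) =
        N_class sc B ((alg_scalar c * central_letter) * central_letter)"
      by (intro N_class_cong_mult N_class_letter_scale refl)
    also have "\<dots> = N_class sc B (central_letter * (alg_scalar c * central_letter))"
      by (metis alg_scalar_commute mult.assoc)
    also have "\<dots> = N_class sc B (central_letter * letter (affine_scale sc c central_elt))"
      by (intro N_class_cong_mult N_class_letter_scale[symmetric] refl)
    finally show ?case .
  qed
qed

section \<open>Free modules, quotients and endomorphisms\<close>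

lemma complex_ring_simps [simp]:
  "carrier complex_ring = UNIV" "x \<otimes>\<^bsub>complex_ring\<^esub> y = x * y" "x \<oplus>\<^bsub>complex_ring\<^esub> y = x + y"
  "\<one>\<^bsub>complex_ring\<^esub> = 1" "\<zero>\<^bsub>complex_ring\<^esub> = 0"
  by (simp_all add: complex_ring_def)

lemma cring_complex_ring: "cring complex_ring"
  by (rule cringI[OF abelian_groupI Group.comm_monoidI])
    (auto simp: algebra_simps intro: exI[of _ "- x" for x])

abbreviation pm_scale :: "complex \<Rightarrow> ('s \<Rightarrow>\<^sub>0 complex) \<Rightarrow> 's \<Rightarrow>\<^sub>0 complex"
  where "pm_scale c \<equiv> Poly_Mapping.map ((*) c)"

lemma lookup_pm_scale [simp]: "Poly_Mapping.lookup (pm_scale c f) k = c * Poly_Mapping.lookup f k"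
  by (simp add: Poly_Mapping.map.rep_eq when_def)

lemma keys_pm_scale: "Poly_Mapping.keys (pm_scale c f) \<subseteq> Poly_Mapping.keys f"
  by (auto simp: in_keys_iff)

lemma pm_scale_single [simp]: "pm_scale c (Poly_Mapping.single k d) = Poly_Mapping.single k (c * d)"
  by (rule poly_mapping_eqI) (simp add: lookup_single when_def)

lemma pm_scale_add: "pm_scale c (f + g) = pm_scale c f + pm_scale c g"
  by (rule poly_mapping_eqI) (simp add: lookup_add algebra_simps)

lemma pm_scale_diff: "pm_scale c (f - g) = pm_scale c f - pm_scale c g"
  by (rule poly_mapping_eqI) (simp add: lookup_minus algebra_simps)

lemma pm_scale_add_left: "pm_scale (c + d) f = pm_scale c f + pm_scale d f"
  by (rule poly_mapping_eqI) (simp add: lookup_add algebra_simps)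

lemma pm_scale_scale: "pm_scale c (pm_scale d f) = pm_scale (c * d) f"
  by (rule poly_mapping_eqI) simp

lemma pm_scale_one [simp]: "pm_scale 1 f = f"
  by (rule poly_mapping_eqI) simp

lemma pm_scale_minus_one: "pm_scale (-1) f = - f"
  by (rule poly_mapping_eqI) simp

lemma free_module_simps [simp]:
  "carrier (free_module S) = {f. Poly_Mapping.keys f \<subseteq> S}"
  "\<zero>\<^bsub>free_module S\<^esub> = 0"
  "f \<oplus>\<^bsub>free_module S\<^esub> g = f + g"
  "c \<odot>\<^bsub>free_module S\<^esub> f = pm_scale c f"
  by (simp_all add: free_module_def)

lemma keys_add_subset:
  "Poly_Mapping.keys f \<subseteq> S \<Longrightarrow> Poly_Mapping.keys g \<subseteq> S \<Longrightarrow> Poly_Mapping.keys (f + g) \<subseteq> S"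
  using keys_add[of f g] by blast

lemma keys_pm_scale_subset: "Poly_Mapping.keys f \<subseteq> S \<Longrightarrow> Poly_Mapping.keys (pm_scale c f) \<subseteq> S"
  using keys_pm_scale[of c f] by blast

lemma abelian_group_free_module: "abelian_group (free_module S)"
proof (rule abelian_groupI)
  fix f assume "f \<in> carrier (free_module S)"
  then show "\<exists>g\<in>carrier (free_module S). g \<oplus>\<^bsub>free_module S\<^esub> f = \<zero>\<^bsub>free_module S\<^esub>"
    by (intro bexI[of _ "- f"]) auto
qed (simp_all add: keys_add_subset add_ac)

lemma module_free_module: "module complex_ring (free_module S)"
proof (rule moduleI[OF cring_complex_ring abelian_group_free_module])
  fix c f assume "f \<in> carrier (free_module S)"
  then show "c \<odot>\<^bsub>free_module S\<^esub> f \<in> carrier (free_module S)"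
    using keys_pm_scale[of c f] by auto
qed (auto simp: pm_scale_add pm_scale_add_left pm_scale_scale)

lemma a_inv_free_module:
  assumes "f \<in> carrier (free_module S)"
  shows "\<ominus>\<^bsub>free_module S\<^esub> f = - f"
proof -
  interpret abelian_group "free_module S" by (rule abelian_group_free_module)
  show ?thesis using assms by (intro minus_equality) auto
qed

text \<open>The axioms for subtraction follow from scaling by -1.\<close>

definition free_submodule :: "'s set \<Rightarrow> ('s \<Rightarrow>\<^sub>0 complex) set \<Rightarrow> bool"
  where "free_submodule S K \<longleftrightarrow> (\<forall>f\<in>K. Poly_Mapping.keys f \<subseteq> S) \<and> 0 \<in> K \<and>
    (\<forall>f\<in>K. \<forall>g\<in>K. f + g \<in> K) \<and> (\<forall>c. \<forall>f\<in>K. pm_scale c f \<in> K)"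

lemma submodule_free_module_iff: "submodule K complex_ring (free_module S) \<longleftrightarrow> free_submodule S K"
proof -
  interpret module complex_ring "free_module S" by (rule module_free_module)
  show ?thesis
  proof
    assume K: "submodule K complex_ring (free_module S)"
    note E = submoduleE[OF K]
    obtain f where f: "f \<in> K" using E(2) by blast
    have "f + \<ominus>\<^bsub>free_module S\<^esub> f \<in> K"
      using E(5)[OF f E(3)[OF f]] by simp
    moreover have "\<ominus>\<^bsub>free_module S\<^esub> f = - f"
      using f E(1) by (intro a_inv_free_module) auto
    ultimately have "0 \<in> K" by simp
    then show "free_submodule S K"
      using E(1,4,5) by (auto simp: free_submodule_def)
  next
    assume K: "free_submodule S K"
    show "submodule K complex_ring (free_module S)"
    proof (rule submoduleI)
      fix f assume f: "f \<in> K"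
      then have "\<ominus>\<^bsub>free_module S\<^esub> f = pm_scale (-1) f"
        using K by (subst a_inv_free_module) (auto simp: free_submodule_def pm_scale_minus_one)
      then show "\<ominus>\<^bsub>free_module S\<^esub> f \<in> K"
        using K f by (auto simp: free_submodule_def)
    qed (use K in \<open>auto simp: free_submodule_def\<close>)
  qed
qed

lemma free_submodule_zero: "free_submodule S K \<Longrightarrow> 0 \<in> K"
  and free_submodule_add: "free_submodule S K \<Longrightarrow> f \<in> K \<Longrightarrow> g \<in> K \<Longrightarrow> f + g \<in> K"
  and free_submodule_scale: "free_submodule S K \<Longrightarrow> f \<in> K \<Longrightarrow> pm_scale c f \<in> K"
  by (simp_all add: free_submodule_def)

lemma free_submodule_diff: "free_submodule S K \<Longrightarrow> f \<in> K \<Longrightarrow> g \<in> K \<Longrightarrow> f - g \<in> K"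
  unfolding diff_conv_add_uminus[of f g] pm_scale_minus_one[symmetric] by (simp add: free_submodule_def)

lemma free_submodule_generated:
  assumes "\<And>f. f \<in> R \<Longrightarrow> Poly_Mapping.keys f \<subseteq> S"
  shows "free_submodule S (submodule_generated (free_module S) R)"
proof -
  have "free_submodule S {f. Poly_Mapping.keys f \<subseteq> S}"
    unfolding free_submodule_def by (simp add: keys_add_subset keys_pm_scale_subset)
  moreover have "R \<subseteq> {f. Poly_Mapping.keys f \<subseteq> S}" using assms by blast
  ultimately have sub: "submodule_generated (free_module S) R \<subseteq> {f. Poly_Mapping.keys f \<subseteq> S}"
    unfolding submodule_generated_def submodule_free_module_iff by (intro Inter_lower) simp
  show ?thesis
    unfolding free_submodule_def
  proof (intro conjI ballI allI)
    show "Poly_Mapping.keys f \<subseteq> S" if "f \<in> submodule_generated (free_module S) R" for f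
      using that sub by blast
  qed (auto simp: submodule_generated_def submodule_free_module_iff
      intro: free_submodule_zero free_submodule_add free_submodule_scale)
qed

lemma submodule_generated_base: "R \<subseteq> submodule_generated U R"
  by (auto simp: submodule_generated_def)

lemma submodule_generated_least:
  "free_submodule S K \<Longrightarrow> R \<subseteq> K \<Longrightarrow> submodule_generated (free_module S) R \<subseteq> K"
  by (auto simp: submodule_generated_def submodule_free_module_iff)

text \<open>The linear extension of a map between bases; coefficients of basis elements with the
  same image are added.\<close>

definition push :: "('s \<Rightarrow> 't) \<Rightarrow> ('s \<Rightarrow>\<^sub>0 complex) \<Rightarrow> 't \<Rightarrow>\<^sub>0 complex"
  where "push g f = (\<Sum>p\<in>Poly_Mapping.keys f. Poly_Mapping.single (g p) (Poly_Mapping.lookup f p))"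

lemma push_eq_sum:
  "finite A \<Longrightarrow> Poly_Mapping.keys f \<subseteq> A \<Longrightarrow>
    push g f = (\<Sum>p\<in>A. Poly_Mapping.single (g p) (Poly_Mapping.lookup f p))"
  unfolding push_def by (intro sum.mono_neutral_left) (auto simp: in_keys_iff)

lemma push_single [simp]: "push g (Poly_Mapping.single p c) = Poly_Mapping.single (g p) c"
  by (simp add: push_def)

lemma push_0 [simp]: "push g 0 = 0"
  by (simp add: push_def)

lemma push_add: "push g (f + f') = push g f + push g f'"
proof -
  let ?A = "Poly_Mapping.keys f \<union> Poly_Mapping.keys f'"
  have "push g h = (\<Sum>p\<in>?A. Poly_Mapping.single (g p) (Poly_Mapping.lookup h p))"
    if "Poly_Mapping.keys h \<subseteq> ?A" for h
    using that by (intro push_eq_sum) auto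
  moreover have "Poly_Mapping.keys (f + f') \<subseteq> ?A" by (rule keys_add)
  ultimately show ?thesis by (simp add: lookup_add single_add sum.distrib)
qed

lemma push_scale: "push g (pm_scale c f) = pm_scale c (push g f)"
proof -
  have "push g (pm_scale c f) =
      (\<Sum>p\<in>Poly_Mapping.keys f. Poly_Mapping.single (g p) (Poly_Mapping.lookup (pm_scale c f) p))"
    by (intro push_eq_sum keys_pm_scale) simp
  also have "\<dots> = (\<Sum>p\<in>Poly_Mapping.keys f. pm_scale c (Poly_Mapping.single (g p) (Poly_Mapping.lookup f p)))"
    by simp
  also have "\<dots> = pm_scale c (push g f)"
    unfolding push_def
    by (induction rule: infinite_finite_induct[of _ "Poly_Mapping.keys f"])
      (auto simp: pm_scale_add intro!: poly_mapping_eqI)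
  finally show ?thesis .
qed

lemma push_diff: "push g (f - f') = push g f - push g f'"
  using push_add[of g "f - f'" f'] by (simp add: algebra_simps)

lemma push_sum: "push g (\<Sum>i\<in>A. f i) = (\<Sum>i\<in>A. push g (f i))"
  by (induction A rule: infinite_finite_induct) (simp_all add: push_add)

lemma push_push: "push g (push h f) = push (\<lambda>p. g (h p)) f"
  unfolding push_def[of h f] push_sum push_single by (simp add: push_def)

lemma push_cong: "(\<And>p. p \<in> Poly_Mapping.keys f \<Longrightarrow> g p = h p) \<Longrightarrow> push g f = push h f"
  unfolding push_def by (intro sum.cong) simp_all

lemma push_id: "(\<And>p. p \<in> Poly_Mapping.keys f \<Longrightarrow> g p = p) \<Longrightarrow> push g f = f"
  unfolding push_def by (subst poly_mapping_expand[of f], intro sum.cong) simp_all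

lemma keys_push: "Poly_Mapping.keys (push g f) \<subseteq> g ` Poly_Mapping.keys f"
  unfolding push_def using keys_sum[of "\<lambda>p. Poly_Mapping.single (g p) (Poly_Mapping.lookup f p)"]
  by (force split: if_splits)

section \<open>Cosets and the quotient module\<close>

context
  fixes S :: "'s set" and K :: "('s \<Rightarrow>\<^sub>0 complex) set"
  assumes K: "free_submodule S K"
begin

lemma coset_conv: "K +>\<^bsub>free_module S\<^esub> f = {h. h - f \<in> K}"
proof (intro equalityI subsetI)
  fix h assume "h \<in> {h. h - f \<in> K}"
  then show "h \<in> K +>\<^bsub>free_module S\<^esub> f"
    unfolding a_r_coset_def' by (auto intro!: bexI[of _ "h - f"])
qed (auto simp: a_r_coset_def')

lemma mem_coset_iff: "h \<in> K +>\<^bsub>free_module S\<^esub> f \<longleftrightarrow> h - f \<in> K"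
  by (simp add: coset_conv)

lemma coset_eq_iff: "K +>\<^bsub>free_module S\<^esub> f = K +>\<^bsub>free_module S\<^esub> g \<longleftrightarrow> f - g \<in> K"
proof
  have "0 \<in> K" using K by (simp add: free_submodule_def)
  assume "K +>\<^bsub>free_module S\<^esub> f = K +>\<^bsub>free_module S\<^esub> g"
  then have "f \<in> K +>\<^bsub>free_module S\<^esub> g" using \<open>0 \<in> K\<close> by (auto simp: coset_conv)
  then show "f - g \<in> K" by (simp add: coset_conv)
next
  assume fg: "f - g \<in> K"
  have "h - f \<in> K \<longleftrightarrow> h - g \<in> K" for h
  proof
    assume "h - f \<in> K"
    from free_submodule_add[OF K this fg] show "h - g \<in> K" by simp
  next
    assume "h - g \<in> K"
    from free_submodule_diff[OF K this fg] show "h - f \<in> K" by simp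
  qed
  then show "K +>\<^bsub>free_module S\<^esub> f = K +>\<^bsub>free_module S\<^esub> g" by (simp add: coset_conv)
qed

text \<open>Operations on the quotient are defined as unions over all representatives. If g respects
  congruence modulo K, all cosets in such a union coincide.\<close>

lemma coset_union:
  assumes "\<And>f'. f' - f \<in> K \<Longrightarrow> g f' - g f \<in> K"
  shows "(\<Union>f'\<in>K +>\<^bsub>free_module S\<^esub> f. K +>\<^bsub>free_module S\<^esub> g f') = K +>\<^bsub>free_module S\<^esub> g f"
proof -
  have "0 \<in> K" using K by (simp add: free_submodule_def)
  then have "f \<in> K +>\<^bsub>free_module S\<^esub> f" by (simp add: mem_coset_iff)
  moreover have "K +>\<^bsub>free_module S\<^esub> g f' = K +>\<^bsub>free_module S\<^esub> g f"
    if "f' \<in> K +>\<^bsub>free_module S\<^esub> f" for f'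
    using that assms by (simp add: coset_eq_iff mem_coset_iff)
  ultimately show ?thesis by blast
qed

lemma quotient_module_carrier:
  "carrier (quotient_module (free_module S) K) =
    (\<lambda>f. K +>\<^bsub>free_module S\<^esub> f) ` {f. Poly_Mapping.keys f \<subseteq> S}"
  by (auto simp: quotient_module_def A_RCOSETS_def')

lemma quotient_module_zero: "\<zero>\<^bsub>quotient_module (free_module S) K\<^esub> = K +>\<^bsub>free_module S\<^esub> 0"
  by (auto simp: quotient_module_def mem_coset_iff)

lemma quotient_module_add:
  "(K +>\<^bsub>free_module S\<^esub> f) \<oplus>\<^bsub>quotient_module (free_module S) K\<^esub> (K +>\<^bsub>free_module S\<^esub> g) =
    K +>\<^bsub>free_module S\<^esub> (f + g)"
proof -
  have "(K +>\<^bsub>free_module S\<^esub> f) \<oplus>\<^bsub>quotient_module (free_module S) K\<^esub> (K +>\<^bsub>free_module S\<^esub> g) =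
      {h. \<exists>u v. u - f \<in> K \<and> v - g \<in> K \<and> h = u + v}"
    by (auto simp: quotient_module_def set_add_def' mem_coset_iff)
  also have "\<dots> = {h. h - (f + g) \<in> K}"
  proof (intro equalityI subsetI; clarsimp)
    fix u v assume "u - f \<in> K" "v - g \<in> K"
    then have "(u - f) + (v - g) \<in> K" using K by (simp add: free_submodule_def)
    then show "u + v - (f + g) \<in> K" by (simp add: algebra_simps)
  next
    fix h assume "h - (f + g) \<in> K"
    moreover have "0 \<in> K" using K by (simp add: free_submodule_def)
    ultimately show "\<exists>u. u - f \<in> K \<and> (\<exists>v. v - g \<in> K \<and> h = u + v)"
      by (intro exI[of _ "h - g"] conjI exI[of _ g]) (simp_all add: algebra_simps)
  qed
  finally show ?thesis by (simp only: coset_conv)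
qed

lemma quotient_module_smult:
  "c \<odot>\<^bsub>quotient_module (free_module S) K\<^esub> (K +>\<^bsub>free_module S\<^esub> f) = K +>\<^bsub>free_module S\<^esub> pm_scale c f"
proof -
  have "(\<Union>f'\<in>K +>\<^bsub>free_module S\<^esub> f. K +>\<^bsub>free_module S\<^esub> pm_scale c f') = K +>\<^bsub>free_module S\<^esub> pm_scale c f"
    using K by (intro coset_union) (simp add: free_submodule_def flip: pm_scale_diff)
  then show ?thesis by (simp add: quotient_module_def)
qed

lemma module_quotient_module: "module complex_ring (quotient_module (free_module S) K)"
proof (rule moduleI[OF cring_complex_ring abelian_groupI])
  note simps = quotient_module_carrier quotient_module_zero quotient_module_add quotient_module_smult
  let ?V = "quotient_module (free_module S) K"
  fix x assume x: "x \<in> carrier ?V"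
  then obtain f where f: "x = K +>\<^bsub>free_module S\<^esub> f" "Poly_Mapping.keys f \<subseteq> S"
    by (auto simp: simps)
  show "\<exists>y\<in>carrier ?V. y \<oplus>\<^bsub>?V\<^esub> x = \<zero>\<^bsub>?V\<^esub>"
    by (rule bexI[of _ "K +>\<^bsub>free_module S\<^esub> (- f)"]) (use f in \<open>auto simp: simps\<close>)
  show "\<zero>\<^bsub>?V\<^esub> \<oplus>\<^bsub>?V\<^esub> x = x" using f by (simp add: simps)
  show "\<one>\<^bsub>complex_ring\<^esub> \<odot>\<^bsub>?V\<^esub> x = x" using f by (simp add: simps)
  fix c :: complex
  show "c \<odot>\<^bsub>?V\<^esub> x \<in> carrier ?V"
    using f keys_pm_scale[of c f] by (auto simp: simps)
  fix d :: complex
  show "(c \<oplus>\<^bsub>complex_ring\<^esub> d) \<odot>\<^bsub>?V\<^esub> x = c \<odot>\<^bsub>?V\<^esub> x \<oplus>\<^bsub>?V\<^esub> d \<odot>\<^bsub>?V\<^esub> x"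
    and "(c \<otimes>\<^bsub>complex_ring\<^esub> d) \<odot>\<^bsub>?V\<^esub> x = c \<odot>\<^bsub>?V\<^esub> (d \<odot>\<^bsub>?V\<^esub> x)"
    using f by (simp_all add: simps pm_scale_add_left pm_scale_scale)
next
  note simps = quotient_module_carrier quotient_module_zero quotient_module_add quotient_module_smult
  let ?V = "quotient_module (free_module S) K"
  show "\<zero>\<^bsub>?V\<^esub> \<in> carrier ?V" by (auto simp: simps)
  fix x y assume "x \<in> carrier ?V" "y \<in> carrier ?V"
  then obtain f g where f: "x = K +>\<^bsub>free_module S\<^esub> f" "Poly_Mapping.keys f \<subseteq> S"
    and g: "y = K +>\<^bsub>free_module S\<^esub> g" "Poly_Mapping.keys g \<subseteq> S"
    by (auto simp: simps)
  show "x \<oplus>\<^bsub>?V\<^esub> y \<in> carrier ?V"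
    using f g keys_add[of f g] by (auto simp: simps)
  show "x \<oplus>\<^bsub>?V\<^esub> y = y \<oplus>\<^bsub>?V\<^esub> x" using f g by (simp add: simps add.commute)
  fix c :: complex
  show "c \<odot>\<^bsub>?V\<^esub> (x \<oplus>\<^bsub>?V\<^esub> y) = c \<odot>\<^bsub>?V\<^esub> x \<oplus>\<^bsub>?V\<^esub> c \<odot>\<^bsub>?V\<^esub> y"
    using f g by (simp add: simps pm_scale_add)
  fix z assume "z \<in> carrier ?V"
  then show "x \<oplus>\<^bsub>?V\<^esub> y \<oplus>\<^bsub>?V\<^esub> z = x \<oplus>\<^bsub>?V\<^esub> (y \<oplus>\<^bsub>?V\<^esub> z)"
    using f g by (auto simp: simps add.assoc)
qed

end

section \<open>The algebra of linear endomorphisms\<close>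

lemma End_algebra_simps [simp]:
  "carrier (End_algebra V) = linear_endos V"
  "f \<otimes>\<^bsub>End_algebra V\<^esub> g = compose (carrier V) f g"
  "\<one>\<^bsub>End_algebra V\<^esub> = (\<lambda>x\<in>carrier V. x)"
  "\<zero>\<^bsub>End_algebra V\<^esub> = (\<lambda>x\<in>carrier V. \<zero>\<^bsub>V\<^esub>)"
  "f \<oplus>\<^bsub>End_algebra V\<^esub> g = (\<lambda>x\<in>carrier V. f x \<oplus>\<^bsub>V\<^esub> g x)"
  "c \<odot>\<^bsub>End_algebra V\<^esub> f = (\<lambda>x\<in>carrier V. c \<odot>\<^bsub>V\<^esub> f x)"
  by (simp_all add: End_algebra_def)

text \<open>Semirings are the setting in which finite sums and products of series in disjoint
  variables are treated below. Endomorphisms have a fixed default value outside the carrier, so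
  equality on the carrier is equality.\<close>

lemma semiring_End_algebra:
  assumes "module complex_ring V"
  shows "semiring (End_algebra V)"
proof -
  interpret module complex_ring V by (rule assms)
  have closed: "f x \<in> carrier V" if "f \<in> linear_endos V" "x \<in> carrier V" for f x
    using that by (auto simp: linear_endos_def)
  have add: "f (x \<oplus>\<^bsub>V\<^esub> y) = f x \<oplus>\<^bsub>V\<^esub> f y" if "f \<in> linear_endos V" "x \<in> carrier V" "y \<in> carrier V" for f x y
    using that by (auto simp: linear_endos_def)
  have smult: "f (c \<odot>\<^bsub>V\<^esub> x) = c \<odot>\<^bsub>V\<^esub> f x" if "f \<in> linear_endos V" "x \<in> carrier V" for f x c
    using that by (auto simp: linear_endos_def)
  have sm_closed: "c \<odot>\<^bsub>V\<^esub> x \<in> carrier V" if "x \<in> carrier V" for c x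
    using smult_closed[of c x] that by simp
  have sm_add: "c \<odot>\<^bsub>V\<^esub> (x \<oplus>\<^bsub>V\<^esub> y) = c \<odot>\<^bsub>V\<^esub> x \<oplus>\<^bsub>V\<^esub> c \<odot>\<^bsub>V\<^esub> y" if "x \<in> carrier V" "y \<in> carrier V" for c x y
    using smult_r_distr[of c x y] that by simp
  have sm_zero: "c \<odot>\<^bsub>V\<^esub> \<zero>\<^bsub>V\<^esub> = \<zero>\<^bsub>V\<^esub>" for c
    using smult_r_null[of c] by simp
  have zero: "f \<zero>\<^bsub>V\<^esub> = \<zero>\<^bsub>V\<^esub>" if "f \<in> linear_endos V" for f
  proof -
    have "f (0 \<odot>\<^bsub>V\<^esub> \<zero>\<^bsub>V\<^esub>) = 0 \<odot>\<^bsub>V\<^esub> f \<zero>\<^bsub>V\<^esub>" by (rule smult[OF that]) simp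
    then show ?thesis using smult_l_null[of "f \<zero>\<^bsub>V\<^esub>"] closed[OF that] by (simp add: sm_zero)
  qed
  have ext: "f = g" if "f \<in> linear_endos V" "g \<in> linear_endos V" "\<And>x. x \<in> carrier V \<Longrightarrow> f x = g x" for f g
    using that by (auto simp: linear_endos_def intro: PiE_ext)
  have add_mem: "(\<lambda>x\<in>carrier V. f x \<oplus>\<^bsub>V\<^esub> g x) \<in> linear_endos V"
    if "f \<in> linear_endos V" "g \<in> linear_endos V" for f g
    unfolding linear_endos_def using that
    by (auto simp: closed add smult sm_closed sm_add M.add.m_ac)
  have comp_mem: "compose (carrier V) f g \<in> linear_endos V"
    if "f \<in> linear_endos V" "g \<in> linear_endos V" for f g
    unfolding linear_endos_def using that
    by (auto simp: closed add smult sm_closed compose_def)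
  have zero_mem: "(\<lambda>x\<in>carrier V. \<zero>\<^bsub>V\<^esub>) \<in> linear_endos V"
    by (auto simp: linear_endos_def sm_zero sm_closed)
  have one_mem: "(\<lambda>x\<in>carrier V. x) \<in> linear_endos V"
    by (auto simp: linear_endos_def sm_closed)
  show ?thesis
  proof (intro semiring.intro abelian_monoidI Group.monoidI semiring_axioms.intro)
    fix f g h
    assume "f \<in> carrier (End_algebra V)" "g \<in> carrier (End_algebra V)" "h \<in> carrier (End_algebra V)"
    then have f: "f \<in> linear_endos V" and g: "g \<in> linear_endos V" and h: "h \<in> linear_endos V" by simp_all
    let ?E = "End_algebra V"
    show "f \<oplus>\<^bsub>?E\<^esub> g \<oplus>\<^bsub>?E\<^esub> h = f \<oplus>\<^bsub>?E\<^esub> (g \<oplus>\<^bsub>?E\<^esub> h)"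
      using f g h by (auto simp: closed M.add.m_assoc)
    show "f \<otimes>\<^bsub>?E\<^esub> g \<otimes>\<^bsub>?E\<^esub> h = f \<otimes>\<^bsub>?E\<^esub> (g \<otimes>\<^bsub>?E\<^esub> h)"
      using f g h by (auto simp: closed compose_def)
    show "(f \<oplus>\<^bsub>?E\<^esub> g) \<otimes>\<^bsub>?E\<^esub> h = f \<otimes>\<^bsub>?E\<^esub> h \<oplus>\<^bsub>?E\<^esub> g \<otimes>\<^bsub>?E\<^esub> h"
      "h \<otimes>\<^bsub>?E\<^esub> (f \<oplus>\<^bsub>?E\<^esub> g) = h \<otimes>\<^bsub>?E\<^esub> f \<oplus>\<^bsub>?E\<^esub> h \<otimes>\<^bsub>?E\<^esub> g"
      using f g h by (auto simp: closed compose_def add)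
  next
    fix f g
    assume "f \<in> carrier (End_algebra V)" "g \<in> carrier (End_algebra V)"
    then have f: "f \<in> linear_endos V" and g: "g \<in> linear_endos V" by simp_all
    let ?E = "End_algebra V"
    show "f \<oplus>\<^bsub>?E\<^esub> g \<in> carrier ?E" "f \<otimes>\<^bsub>?E\<^esub> g \<in> carrier ?E"
      using f g by (simp_all add: add_mem comp_mem)
    show "f \<oplus>\<^bsub>?E\<^esub> g = g \<oplus>\<^bsub>?E\<^esub> f"
      using f g by (auto simp: closed M.add.m_comm)
  next
    fix f
    assume "f \<in> carrier (End_algebra V)"
    then have f: "f \<in> linear_endos V" by simp
    let ?E = "End_algebra V"
    show "\<zero>\<^bsub>?E\<^esub> \<oplus>\<^bsub>?E\<^esub> f = f"
      using add_mem[OF zero_mem f] f by (intro ext) (auto simp: closed)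
    show "\<one>\<^bsub>?E\<^esub> \<otimes>\<^bsub>?E\<^esub> f = f"
      using comp_mem[OF one_mem f] f by (intro ext) (auto simp: closed compose_def)
    show "f \<otimes>\<^bsub>?E\<^esub> \<one>\<^bsub>?E\<^esub> = f"
      using comp_mem[OF f one_mem] f by (intro ext) (auto simp: closed compose_def)
    show "\<zero>\<^bsub>?E\<^esub> \<otimes>\<^bsub>?E\<^esub> f = \<zero>\<^bsub>?E\<^esub>" "f \<otimes>\<^bsub>?E\<^esub> \<zero>\<^bsub>?E\<^esub> = \<zero>\<^bsub>?E\<^esub>"
      using f by (auto simp: closed compose_def zero)
  qed (simp_all add: zero_mem one_mem)
qed

section \<open>The representation of the free algebra on V\<close>

abbreviation V_basis ::
    "(complex \<Rightarrow> 'h::ab_group_add \<Rightarrow> 'h) \<Rightarrow> ('h \<Rightarrow> 'h \<Rightarrow> complex) \<Rightarrow> ('h N_elt \<times> complex) set"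
  where "V_basis sc B \<equiv> carrier (N_algebra sc B) \<times> UNIV"

abbreviation pure :: "'x \<Rightarrow> 'z \<Rightarrow> ('x \<times> 'z) \<Rightarrow>\<^sub>0 complex"
  where "pure x z \<equiv> Poly_Mapping.single (x, z) 1"

lemma V_relation_add:
    "x \<in> carrier (N_algebra sc B) \<Longrightarrow> y \<in> carrier (N_algebra sc B) \<Longrightarrow>
      pure (x \<oplus>\<^bsub>N_algebra sc B\<^esub> y) z - (pure x z + pure y z) \<in> V_relations sc B"
  and V_relation_add_right:
    "x \<in> carrier (N_algebra sc B) \<Longrightarrow>
      pure x (z + z') - (pure x z + pure x z') \<in> V_relations sc B"
  and V_relation_const:
    "x \<in> carrier (N_algebra sc B) \<Longrightarrow>
      pure (N_const sc B c \<otimes>\<^bsub>N_algebra sc B\<^esub> x) z - Poly_Mapping.single (x, z) c \<in> V_relations sc B"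
  and V_relation_const_right:
    "x \<in> carrier (N_algebra sc B) \<Longrightarrow>
      pure x (c * z) - Poly_Mapping.single (x, z) c \<in> V_relations sc B"
  and V_relation_vacuum:
    "x \<in> carrier (N_algebra sc B) \<Longrightarrow> vacuum_action sc B \<alpha> w \<Longrightarrow>
      pure (x \<otimes>\<^bsub>N_algebra sc B\<^esub> \<alpha>) z - pure x (w * z) \<in> V_relations sc B"
  unfolding V_relations_def Let_def by blast+

lemma V_relations_cases:
  assumes "f \<in> V_relations sc B"
  obtains (add) x y z where "x \<in> carrier (N_algebra sc B)" "y \<in> carrier (N_algebra sc B)"
      "f = pure (x \<oplus>\<^bsub>N_algebra sc B\<^esub> y) z - (pure x z + pure y z)"
  | (add_right) x z z' where "x \<in> carrier (N_algebra sc B)"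
      "f = pure x (z + z') - (pure x z + pure x z')"
  | (const) c x z where "x \<in> carrier (N_algebra sc B)"
      "f = pure (N_const sc B c \<otimes>\<^bsub>N_algebra sc B\<^esub> x) z - Poly_Mapping.single (x, z) c"
  | (const_right) c x z where "x \<in> carrier (N_algebra sc B)"
      "f = pure x (c * z) - Poly_Mapping.single (x, z) c"
  | (vacuum) x \<alpha> w z where "x \<in> carrier (N_algebra sc B)" "vacuum_action sc B \<alpha> w"
      "f = pure (x \<otimes>\<^bsub>N_algebra sc B\<^esub> \<alpha>) z - pure x (w * z)"
  using assms unfolding V_relations_def Let_def by blast

lemma vacuum_action_closed: "vacuum_action sc B \<alpha> w \<Longrightarrow> \<alpha> \<in> carrier (N_algebra sc B)"
proof (induction rule: vacuum_action.induct)
  interpret N: ring "N_algebra sc B" by (rule ring_N_algebra)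
  {
    case add then show ?case by simp
  next
    case mult then show ?case by simp
  }
qed (simp_all add: N_gen_conv N_const_conv)

lemma keys_V_relations:
  assumes "f \<in> V_relations sc B"
  shows "Poly_Mapping.keys f \<subseteq> V_basis sc B"
proof -
  interpret N: ring "N_algebra sc B" by (rule ring_N_algebra)
  have single: "Poly_Mapping.keys (Poly_Mapping.single (x, z) c) \<subseteq> V_basis sc B"
    if "x \<in> carrier (N_algebra sc B)" for x z and c :: complex
    using that by simp
  have diff: "Poly_Mapping.keys (f - g) \<subseteq> V_basis sc B"
    if "Poly_Mapping.keys f \<subseteq> V_basis sc B" "Poly_Mapping.keys g \<subseteq> V_basis sc B" for f g :: "'a pre_V"
    using keys_diff[of f g] that by blast
  show ?thesis
    using assms
  proof (cases rule: V_relations_cases)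
    case add
    then show ?thesis
      by (simp only:) (intro diff keys_add_subset single N.add.m_closed; assumption)
  next
    case add_right
    then show ?thesis
      by (simp only:) (intro diff keys_add_subset single; assumption)
  next
    case const
    then show ?thesis unfolding N_const_conv
      by (simp only:) (intro diff single N.m_closed N_class_closed; assumption)
  next
    case const_right
    then show ?thesis
      by (simp only:) (intro diff single; assumption)
  next
    case (vacuum x \<alpha> w z)
    then show ?thesis
      using vacuum_action_closed[OF vacuum(2)]
      by (simp only:) (intro diff single N.m_closed; assumption)
  qed
qed

lemma free_submodule_V_kernel: "free_submodule (V_basis sc B) (V_kernel sc B)"
  unfolding V_kernel_def pre_V_def by (rule free_submodule_generated) (rule keys_V_relations)

lemma V_relations_subset: "V_relations sc B \<subseteq> V_kernel sc B"
  unfolding V_kernel_def by (rule submodule_generated_base)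

lemma pre_left_mult_conv:
  "pre_left_mult sc B x f = push (\<lambda>p. (x \<otimes>\<^bsub>N_algebra sc B\<^esub> fst p, snd p)) f"
  unfolding pre_left_mult_def push_def by (intro sum.cong) auto

definition lmult ::
    "(complex \<Rightarrow> 'h::ab_group_add \<Rightarrow> 'h) \<Rightarrow> ('h \<Rightarrow> 'h \<Rightarrow> complex) \<Rightarrow> 'h affine free_alg \<Rightarrow>
      'h pre_V \<Rightarrow> 'h pre_V"
  where "lmult sc B x = push (\<lambda>p. (N_class sc B x \<otimes>\<^bsub>N_algebra sc B\<^esub> fst p, snd p))"

lemma lmult_add: "lmult sc B x (f + g) = lmult sc B x f + lmult sc B x g"
  by (simp add: lmult_def push_add)

lemma lmult_scale: "lmult sc B x (pm_scale c f) = pm_scale c (lmult sc B x f)"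
  by (simp add: lmult_def push_scale)

lemma keys_lmult:
  assumes "Poly_Mapping.keys f \<subseteq> V_basis sc B"
  shows "Poly_Mapping.keys (lmult sc B x f) \<subseteq> V_basis sc B"
proof -
  interpret N: ring "N_algebra sc B" by (rule ring_N_algebra)
  show ?thesis
    using keys_push[of "\<lambda>p. (N_class sc B x \<otimes>\<^bsub>N_algebra sc B\<^esub> fst p, snd p)" f] assms
    by (fastforce simp: lmult_def)
qed

text \<open>The elements sent into the kernel form a submodule, so the defining relations suffice.
  Left multiplication takes each of them to a relation of the same kind: additivity by
  distributivity, and the vacuum relation by associativity, since its \<alpha> is on the
  right.\<close>

lemma lmult_V_kernel:
  assumes "f \<in> V_kernel sc B"
  shows "lmult sc B x f \<in> V_kernel sc B"
proof -
  interpret N: ring "N_algebra sc B" by (rule ring_N_algebra)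
  let ?S = "V_basis sc B" and ?K = "V_kernel sc B"
  let ?L = "{f. Poly_Mapping.keys f \<subseteq> ?S \<and> lmult sc B x f \<in> ?K}"
  note K = free_submodule_V_kernel[of sc B]
  have "free_submodule ?S ?L"
    unfolding free_submodule_def lmult_def
    using K by (auto simp: push_add push_scale keys_add_subset keys_pm_scale_subset
        free_submodule_zero free_submodule_add free_submodule_scale)
  moreover have "V_relations sc B \<subseteq> ?L"
  proof
    fix g assume g: "g \<in> V_relations sc B"
    have "lmult sc B x g \<in> V_relations sc B"
      using g
    proof (cases rule: V_relations_cases)
      case (add u v z)
      have "lmult sc B x g = pure ((N_class sc B x \<otimes>\<^bsub>N_algebra sc B\<^esub> u) \<oplus>\<^bsub>N_algebra sc B\<^esub> (N_class sc B x \<otimes>\<^bsub>N_algebra sc B\<^esub> v)) z -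
          (pure (N_class sc B x \<otimes>\<^bsub>N_algebra sc B\<^esub> u) z + pure (N_class sc B x \<otimes>\<^bsub>N_algebra sc B\<^esub> v) z)"
        using add by (simp add: lmult_def push_add push_diff N.r_distr)
      then show ?thesis using add by (simp only: V_relation_add N.m_closed N_class_closed)
    next
      case (add_right u z z')
      then show ?thesis by (simp add: lmult_def push_add push_diff V_relation_add_right)
    next
      case (const c u z)
      \<comment> \<open>The scalar has to be moved past x. Scalars are central already in the free
        algebra, hence the representative y.\<close>
      obtain y where u: "u = N_class sc B y" using const by (auto simp: carrier_N_algebra)
      have "N_class sc B x \<otimes>\<^bsub>N_algebra sc B\<^esub> (N_const sc B c \<otimes>\<^bsub>N_algebra sc B\<^esub> u) =
          N_const sc B c \<otimes>\<^bsub>N_algebra sc B\<^esub> (N_class sc B x \<otimes>\<^bsub>N_algebra sc B\<^esub> u)"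
        unfolding u N_const_conv N_class_mult[symmetric]
        by (metis alg_scalar_commute mult.assoc)
      then have "lmult sc B x g = pure (N_const sc B c \<otimes>\<^bsub>N_algebra sc B\<^esub> (N_class sc B x \<otimes>\<^bsub>N_algebra sc B\<^esub> u)) z -
          Poly_Mapping.single (N_class sc B x \<otimes>\<^bsub>N_algebra sc B\<^esub> u, z) c"
        using const by (simp add: lmult_def push_diff)
      then show ?thesis using const by (simp only: V_relation_const N.m_closed N_class_closed)
    next
      case (const_right c u z)
      then show ?thesis by (simp add: lmult_def push_diff V_relation_const_right)
    next
      case (vacuum u \<alpha> w z)
      then show ?thesis
        using vacuum_action_closed[OF vacuum(2)]
        by (simp add: lmult_def push_diff V_relation_vacuum flip: N.m_assoc)
    qed
    then show "g \<in> ?L" using keys_V_relations[OF g] V_relations_subset by blast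
  qed
  ultimately have "?K \<subseteq> ?L"
    unfolding V_kernel_def pre_V_def by (rule submodule_generated_least)
  then show ?thesis using assms by blast
qed

definition V_class ::
    "(complex \<Rightarrow> 'h::ab_group_add \<Rightarrow> 'h) \<Rightarrow> ('h \<Rightarrow> 'h \<Rightarrow> complex) \<Rightarrow> 'h pre_V \<Rightarrow> 'h pre_V set"
  where "V_class sc B f = V_kernel sc B +>\<^bsub>pre_V sc B\<^esub> f"

definition V_rep ::
    "(complex \<Rightarrow> 'h::ab_group_add \<Rightarrow> 'h) \<Rightarrow> ('h \<Rightarrow> 'h \<Rightarrow> complex) \<Rightarrow> 'h affine free_alg \<Rightarrow>
      'h pre_V set \<Rightarrow> 'h pre_V set"
  where "V_rep sc B x = N_action sc B (N_class sc B x)"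

lemma V_class_eqI: "f - g \<in> V_kernel sc B \<Longrightarrow> V_class sc B f = V_class sc B g"
  using coset_eq_iff[OF free_submodule_V_kernel[of sc B]] by (simp add: V_class_def pre_V_def)

lemma carrier_V_space: "carrier (V_space sc B) = V_class sc B ` {f. Poly_Mapping.keys f \<subseteq> V_basis sc B}"
  using quotient_module_carrier[OF free_submodule_V_kernel, of sc B]
  by (simp add: V_space_def V_class_def[abs_def] pre_V_def)

lemma V_class_add: "V_class sc B f \<oplus>\<^bsub>V_space sc B\<^esub> V_class sc B g = V_class sc B (f + g)"
  using quotient_module_add[OF free_submodule_V_kernel[of sc B]]
  by (simp add: V_space_def V_class_def pre_V_def)

lemma V_class_smult: "c \<odot>\<^bsub>V_space sc B\<^esub> V_class sc B f = V_class sc B (pm_scale c f)"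
  using quotient_module_smult[OF free_submodule_V_kernel[of sc B]]
  by (simp add: V_space_def V_class_def pre_V_def)

lemma module_V_space: "module complex_ring (V_space sc B)"
  using module_quotient_module[OF free_submodule_V_kernel[of sc B]]
  by (simp add: V_space_def pre_V_def)

lemma V_rep_class:
  assumes "Poly_Mapping.keys f \<subseteq> V_basis sc B"
  shows "V_rep sc B x (V_class sc B f) = V_class sc B (lmult sc B x f)"
proof -
  have "V_class sc B f \<in> carrier (V_space sc B)"
    using assms by (auto simp: carrier_V_space)
  moreover have "(\<Union>f'\<in>V_class sc B f. V_class sc B (lmult sc B x f')) = V_class sc B (lmult sc B x f)"
    unfolding V_class_def pre_V_def
    by (rule coset_union[OF free_submodule_V_kernel[of sc B]])
      (use lmult_V_kernel in \<open>simp add: lmult_def flip: push_diff\<close>)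
  ultimately show ?thesis
    by (simp add: V_rep_def N_action_def pre_left_mult_conv flip: lmult_def V_class_def)
qed

lemma V_rep_linear_endos: "V_rep sc B x \<in> linear_endos (V_space sc B)"
  unfolding linear_endos_def
proof (intro CollectI conjI ballI allI)
  show "V_rep sc B x \<in> carrier (V_space sc B) \<rightarrow>\<^sub>E carrier (V_space sc B)"
  proof (rule PiE_I)
    fix v assume "v \<in> carrier (V_space sc B)"
    then show "V_rep sc B x v \<in> carrier (V_space sc B)"
      by (auto simp: carrier_V_space V_rep_class intro!: imageI keys_lmult)
  next
    fix v assume "v \<notin> carrier (V_space sc B)"
    then show "V_rep sc B x v = undefined" by (simp add: V_rep_def N_action_def)
  qed
next
  fix v w assume "v \<in> carrier (V_space sc B)" "w \<in> carrier (V_space sc B)"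
  then show "V_rep sc B x (v \<oplus>\<^bsub>V_space sc B\<^esub> w) = V_rep sc B x v \<oplus>\<^bsub>V_space sc B\<^esub> V_rep sc B x w"
    by (auto simp: carrier_V_space V_rep_class V_class_add keys_add_subset lmult_add)
next
  fix c v assume "v \<in> carrier (V_space sc B)"
  then show "V_rep sc B x (c \<odot>\<^bsub>V_space sc B\<^esub> v) = c \<odot>\<^bsub>V_space sc B\<^esub> V_rep sc B x v"
    by (auto simp: carrier_V_space V_rep_class V_class_smult keys_pm_scale_subset lmult_scale)
qed

lemma V_kernel_sum_single:
  assumes "\<And>y z. y \<in> carrier (N_algebra sc B) \<Longrightarrow> F (pure y z) \<in> V_kernel sc B"
    and "\<And>f g. F (f + g) = F f + F g" and "\<And>c f. F (pm_scale c f) = pm_scale c (F f)"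
    and "Poly_Mapping.keys f \<subseteq> V_basis sc B"
  shows "F f \<in> V_kernel sc B"
proof -
  note K = free_submodule_V_kernel[of sc B]
  have zero: "F 0 = 0" using assms(2)[of 0 0] by simp
  have single: "F (Poly_Mapping.single p c) \<in> V_kernel sc B" if "p \<in> V_basis sc B" for p c
  proof -
    obtain y z where p: "p = (y, z)" by (cases p)
    have "pm_scale c (F (pure y z)) \<in> V_kernel sc B"
      using that p by (intro free_submodule_scale[OF K] assms(1)) simp
    then show ?thesis by (simp add: p flip: assms(3))
  qed
  have "F (\<Sum>p\<in>A. Poly_Mapping.single p (Poly_Mapping.lookup f p)) \<in> V_kernel sc B"
    if "finite A" "A \<subseteq> V_basis sc B" for A
    using that
    by (induction) (auto simp: zero assms(2)
        intro: free_submodule_zero[OF K] free_submodule_add[OF K] single)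
  from this[OF finite_keys[of f] assms(4)] show ?thesis by (simp flip: poly_mapping_expand)
qed

text \<open>To recognize a map F of formal combinations as the action of x, it suffices to compare
  it with left multiplication on pure tensors modulo the kernel, both being linear.\<close>

lemma V_rep_eqI:
  assumes "\<And>y z. y \<in> carrier (N_algebra sc B) \<Longrightarrow> F (pure y z) - lmult sc B x (pure y z) \<in> V_kernel sc B"
    and "\<And>f g. F (f + g) = F f + F g" and "\<And>c f. F (pm_scale c f) = pm_scale c (F f)"
    and "Poly_Mapping.keys f \<subseteq> V_basis sc B"
  shows "V_class sc B (F f) = V_rep sc B x (V_class sc B f)"
proof -
  have "F f - lmult sc B x f \<in> V_kernel sc B"
    by (rule V_kernel_sum_single[where F = "\<lambda>f. F f - lmult sc B x f"])
      (use assms in \<open>auto simp: lmult_def push_add push_scale pm_scale_diff\<close>)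
  then show ?thesis by (simp add: V_rep_class[OF assms(4)] V_class_eqI)
qed

lemma linear_endos_eqI:
  assumes "F \<in> linear_endos (V_space sc B)" "G \<in> linear_endos (V_space sc B)"
    and "\<And>f. Poly_Mapping.keys f \<subseteq> V_basis sc B \<Longrightarrow> F (V_class sc B f) = G (V_class sc B f)"
  shows "F = G"
proof (rule PiE_ext)
  show "F \<in> carrier (V_space sc B) \<rightarrow>\<^sub>E carrier (V_space sc B)"
    "G \<in> carrier (V_space sc B) \<rightarrow>\<^sub>E carrier (V_space sc B)"
    using assms(1,2) by (auto simp: linear_endos_def)
  show "F v = G v" if "v \<in> carrier (V_space sc B)" for v
    using that assms(3) by (auto simp: carrier_V_space)
qed

section \<open>The homomorphism from the free algebra to End(V)\<close>

abbreviation (input) V_End ::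
    "(complex \<Rightarrow> 'h::ab_group_add \<Rightarrow> 'h) \<Rightarrow> ('h \<Rightarrow> 'h \<Rightarrow> complex) \<Rightarrow>
      (complex, 'h pre_V set \<Rightarrow> 'h pre_V set) module"
  where "V_End sc B \<equiv> End_algebra (V_space sc B)"

lemma semiring_V_End: "semiring (V_End sc B)"
  by (rule semiring_End_algebra[OF module_V_space])

lemma V_class_mem: "Poly_Mapping.keys f \<subseteq> V_basis sc B \<Longrightarrow> V_class sc B f \<in> carrier (V_space sc B)"
  by (auto simp: carrier_V_space)

lemma V_rep_mult: "V_rep sc B (x * y) = V_rep sc B x \<otimes>\<^bsub>V_End sc B\<^esub> V_rep sc B y"
proof -
  interpret N: ring "N_algebra sc B" by (rule ring_N_algebra)
  interpret E: semiring "V_End sc B" by (rule semiring_V_End)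
  have clos: "V_rep sc B x \<otimes>\<^bsub>V_End sc B\<^esub> V_rep sc B y \<in> linear_endos (V_space sc B)"
    by (rule E.m_closed[unfolded End_algebra_simps(1), OF V_rep_linear_endos V_rep_linear_endos])
  show ?thesis
  proof (rule linear_endos_eqI[OF V_rep_linear_endos clos])
    fix f :: "'a pre_V" assume f: "Poly_Mapping.keys f \<subseteq> V_basis sc B"
    have "lmult sc B (x * y) f = lmult sc B x (lmult sc B y f)"
      unfolding lmult_def push_push
      by (rule push_cong) (use f in \<open>auto simp: N_class_mult N.m_assoc\<close>)
    then show "V_rep sc B (x * y) (V_class sc B f) =
        (V_rep sc B x \<otimes>\<^bsub>V_End sc B\<^esub> V_rep sc B y) (V_class sc B f)"
      using f keys_lmult[OF f] V_class_mem[OF f]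
      by (simp add: V_rep_class compose_def)
  qed
qed

lemma V_rep_one: "V_rep sc B 1 = \<one>\<^bsub>V_End sc B\<^esub>"
proof -
  interpret N: ring "N_algebra sc B" by (rule ring_N_algebra)
  interpret E: semiring "V_End sc B" by (rule semiring_V_End)
  have clos: "\<one>\<^bsub>V_End sc B\<^esub> \<in> linear_endos (V_space sc B)"
    by (rule E.one_closed[unfolded End_algebra_simps(1)])
  show ?thesis
  proof (rule linear_endos_eqI[OF V_rep_linear_endos clos])
    fix f :: "'a pre_V" assume f: "Poly_Mapping.keys f \<subseteq> V_basis sc B"
    have "lmult sc B 1 f = f"
      unfolding lmult_def by (rule push_id) (use f in \<open>auto simp: N_class_one\<close>)
    then show "V_rep sc B 1 (V_class sc B f) = \<one>\<^bsub>V_End sc B\<^esub> (V_class sc B f)"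
      using f V_class_mem[OF f] by (simp add: V_rep_class)
  qed
qed

text \<open>Unlike for products, the two sides differ on formal combinations: the pair of (x + y) u
  and z is in general a basis element of its own, and only the additivity relation of V splits
  it.\<close>

lemma V_rep_add: "V_rep sc B (x + y) = V_rep sc B x \<oplus>\<^bsub>V_End sc B\<^esub> V_rep sc B y"
proof -
  interpret N: ring "N_algebra sc B" by (rule ring_N_algebra)
  interpret E: semiring "V_End sc B" by (rule semiring_V_End)
  have clos: "V_rep sc B x \<oplus>\<^bsub>V_End sc B\<^esub> V_rep sc B y \<in> linear_endos (V_space sc B)"
    by (rule E.add.m_closed[unfolded End_algebra_simps(1), OF V_rep_linear_endos V_rep_linear_endos])
  show ?thesis
  proof (rule linear_endos_eqI[OF V_rep_linear_endos clos])
    fix f :: "'a pre_V" assume f: "Poly_Mapping.keys f \<subseteq> V_basis sc B"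
    have "V_class sc B (lmult sc B x f + lmult sc B y f) = V_rep sc B (x + y) (V_class sc B f)"
    proof (rule V_rep_eqI[where F = "\<lambda>f. lmult sc B x f + lmult sc B y f"])
      fix u z assume u: "u \<in> carrier (N_algebra sc B)"
      let ?x = "N_class sc B x \<otimes>\<^bsub>N_algebra sc B\<^esub> u" and ?y = "N_class sc B y \<otimes>\<^bsub>N_algebra sc B\<^esub> u"
      have "- (pure (?x \<oplus>\<^bsub>N_algebra sc B\<^esub> ?y) z - (pure ?x z + pure ?y z)) \<in> V_kernel sc B"
        unfolding pm_scale_minus_one[symmetric]
        by (intro free_submodule_scale[OF free_submodule_V_kernel] subsetD[OF V_relations_subset]
            V_relation_add N.m_closed N_class_closed u)
      then show "lmult sc B x (pure u z) + lmult sc B y (pure u z) - lmult sc B (x + y) (pure u z) \<in> V_kernel sc B"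
        using u by (simp add: lmult_def N_class_add N.l_distr)
    qed (use f in \<open>simp_all add: lmult_def push_add push_scale pm_scale_add\<close>)
    then show "V_rep sc B (x + y) (V_class sc B f) =
        (V_rep sc B x \<oplus>\<^bsub>V_End sc B\<^esub> V_rep sc B y) (V_class sc B f)"
      using V_class_mem[OF f] f by (simp add: V_rep_class V_class_add)
  qed
qed

text \<open>By multiplicativity it is enough that the constant c acts as the scalar c, and the
  relation of V for constants says so on pure tensors.\<close>

lemma V_rep_scale: "V_rep sc B (alg_scalar c * x) = c \<odot>\<^bsub>V_End sc B\<^esub> V_rep sc B x"
proof -
  interpret N: ring "N_algebra sc B" by (rule ring_N_algebra)
  interpret V: module complex_ring "V_space sc B" by (rule module_V_space)
  have V: "V_rep sc B (alg_scalar c) v = c \<odot>\<^bsub>V_space sc B\<^esub> v" if v: "v \<in> carrier (V_space sc B)" for v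
  proof -
    obtain f where v: "v = V_class sc B f" and f: "Poly_Mapping.keys f \<subseteq> V_basis sc B"
      using v by (auto simp: carrier_V_space)
    have "V_class sc B (pm_scale c f) = V_rep sc B (alg_scalar c) (V_class sc B f)"
    proof (rule V_rep_eqI[where F = "pm_scale c"])
      fix u z assume u: "u \<in> carrier (N_algebra sc B)"
      have "- (pure (N_const sc B c \<otimes>\<^bsub>N_algebra sc B\<^esub> u) z - Poly_Mapping.single (u, z) c) \<in> V_kernel sc B"
        unfolding pm_scale_minus_one[symmetric]
        by (intro free_submodule_scale[OF free_submodule_V_kernel] subsetD[OF V_relations_subset]
            V_relation_const u)
      then show "pm_scale c (pure u z) - lmult sc B (alg_scalar c) (pure u z) \<in> V_kernel sc B"
        by (simp add: lmult_def N_const_conv)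
    qed (use f in \<open>simp_all add: pm_scale_add pm_scale_scale mult.commute\<close>)
    then show ?thesis by (simp add: v V_class_smult)
  qed
  have closed: "V_rep sc B x v \<in> carrier (V_space sc B)" if "v \<in> carrier (V_space sc B)" for v
    using that V_rep_linear_endos[of sc B x] by (auto simp: linear_endos_def)
  show ?thesis
    unfolding V_rep_mult End_algebra_simps compose_def by (intro restrict_ext V closed)
qed

text \<open>The vacuum relation identifies u k \<otimes> z with u \<otimes> z and so has k on the
  right of u, while the operator multiplies by k from the left. Centrality of k in N joins the
  two.\<close>

lemma V_rep_central: "V_rep sc B central_letter = \<one>\<^bsub>V_End sc B\<^esub>"
proof -
  interpret N: ring "N_algebra sc B" by (rule ring_N_algebra)
  interpret E: semiring "V_End sc B" by (rule semiring_V_End)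
  have clos: "\<one>\<^bsub>V_End sc B\<^esub> \<in> linear_endos (V_space sc B)"
    by (rule E.one_closed[unfolded End_algebra_simps(1)])
  show ?thesis
  proof (rule linear_endos_eqI[OF V_rep_linear_endos clos])
    fix f :: "'a pre_V" assume f: "Poly_Mapping.keys f \<subseteq> V_basis sc B"
    have "V_class sc B f = V_rep sc B central_letter (V_class sc B f)"
    proof (rule V_rep_eqI[where F = "\<lambda>f. f"])
      fix u z assume u: "u \<in> carrier (N_algebra sc B)"
      then obtain y where y: "u = N_class sc B y" by (auto simp: carrier_N_algebra)
      have "- (pure (u \<otimes>\<^bsub>N_algebra sc B\<^esub> N_gen sc B central_elt) z - pure u (1 * z)) \<in> V_kernel sc B"
        unfolding pm_scale_minus_one[symmetric]
        by (intro free_submodule_scale[OF free_submodule_V_kernel] subsetD[OF V_relations_subset]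
            V_relation_vacuum u vacuum_action.central)
      then show "pure u z - lmult sc B central_letter (pure u z) \<in> V_kernel sc B"
        unfolding y N_gen_conv lmult_def push_single
        by (simp add: N_class_central flip: N_class_mult)
    qed (use f in simp_all)
    then show "V_rep sc B central_letter (V_class sc B f) = \<one>\<^bsub>V_End sc B\<^esub> (V_class sc B f)"
      using V_class_mem[OF f] by simp
  qed
qed

lemma V_rep_cong_N: "N_class sc B x = N_class sc B y \<Longrightarrow> V_rep sc B x = V_rep sc B y"
  by (simp add: V_rep_def)

lemma mode_conv: "mode sc B h m = V_rep sc B (mode_letter h m)"
  by (simp add: mode_def V_rep_def N_gen_conv)

text \<open>The two conditions force \<open>snd q < 0\<close>. Thus the contraction vanishes unless
  p is a positive and q a negative mode, as the axiom \<open>contr_eq_0\<close> demands.\<close>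

definition mode_contr :: "('h \<Rightarrow> 'h \<Rightarrow> complex) \<Rightarrow> 'h \<times> int \<Rightarrow> 'h \<times> int \<Rightarrow> complex"
  where "mode_contr B p q = (if snd p \<ge> 0 \<and> snd p + snd q + 1 = 0 then B (fst p) (fst q) else 0)"

text \<open>In N the anticommutator is a multiple of k, not of 1. The contraction axiom holds for
  equality of operators on V, where k acts as 1.\<close>

lemma contraction_algebra_V_rep:
  "contraction_algebra (\<lambda>x y. V_rep sc B x = V_rep sc B y) (\<lambda>c x. alg_scalar c * x)
    (\<lambda>p. mode_letter (fst p) (snd p)) (\<lambda>p. snd p \<ge> 0) (mode_contr B)"
proof
  fix p q :: "'a \<times> int"
  assume p: "snd p \<ge> 0" and q: "\<not> snd q \<ge> 0"
  let ?c = "alg_scalar (if snd p + snd q + 1 = 0 then B (fst p) (fst q) else 0)"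
  have "V_rep sc B (mode_letter (fst p) (snd p) * mode_letter (fst q) (snd q) +
      mode_letter (fst q) (snd q) * mode_letter (fst p) (snd p)) = V_rep sc B (?c * central_letter)"
    by (rule V_rep_cong_N, rule N_class_anticommutator) (use p q in auto)
  also have "\<dots> = V_rep sc B (?c * 1)"
    by (simp only: V_rep_mult V_rep_central V_rep_one)
  finally show "V_rep sc B (mode_letter (fst p) (snd p) * mode_letter (fst q) (snd q) +
      mode_letter (fst q) (snd q) * mode_letter (fst p) (snd p)) = V_rep sc B (alg_scalar (mode_contr B p q) * 1)"
    using p by (simp add: mode_contr_def)
next
  fix c and x y :: "'a affine free_alg"
  show "x * (alg_scalar c * y) = alg_scalar c * (x * y)"
    by (metis alg_scalar_commute mult.assoc)
qed (auto simp: V_rep_add V_rep_mult ring_distribs alg_scalar_add alg_scalar_mult alg_scalar_1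
    mult.assoc mode_contr_def simp del: End_algebra_simps)

section \<open>Normal ordering of modes\<close>

definition ordered_positions :: "int list \<Rightarrow> nat list"
  where "ordered_positions ns =
    filter (\<lambda>i. ns ! i < 0) [0..<length ns] @ filter (\<lambda>i. \<not> ns ! i < 0) [0..<length ns]"

text \<open>Beyond the length of \<open>ns\<close> it is the identity, as \<open>permutes\<close>
  requires.\<close>

definition position_perm :: "int list \<Rightarrow> nat \<Rightarrow> nat"
  where "position_perm ns i = (if i < length ns then ordered_positions ns ! i else i)"

lemma length_ordered_positions [simp]: "length (ordered_positions ns) = length ns"
  unfolding ordered_positions_def length_append by (subst sum_length_filter_compl) simp

lemma set_ordered_positions: "set (ordered_positions ns) = {..<length ns}"
  by (auto simp: ordered_positions_def)

lemma distinct_ordered_positions: "distinct (ordered_positions ns)"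
  by (auto simp: ordered_positions_def)

lemma map_position_perm: "map (position_perm ns) [0..<length ns] = ordered_positions ns"
  by (rule nth_equalityI) (simp_all add: position_perm_def)

lemma position_perm_permutes: "position_perm ns permutes {..<length ns}"
proof (rule bij_imp_permutes)
  have "bij_betw ((!) (ordered_positions ns)) {..<length ns} {..<length ns}"
    by (rule bij_betw_nth) (simp_all add: distinct_ordered_positions set_ordered_positions)
  then show "bij_betw (position_perm ns) {..<length ns} {..<length ns}"
    by (rule bij_betw_cong[THEN iffD1, rotated]) (simp add: position_perm_def)
qed (simp add: position_perm_def)

text \<open>
  Negative modes get the smaller keys, so that the ordering permutation is the one that sorts
  the keys increasingly.
\<close>

definition position_key :: "int list \<Rightarrow> nat \<Rightarrow> nat"
  where "position_key ns i = (if ns ! i < 0 then i else length ns + i)"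

lemma position_key_less_iff:
  "p < length ns \<Longrightarrow> q < length ns \<Longrightarrow> position_key ns p < position_key ns q \<longleftrightarrow>
    (ns ! q < 0 \<longrightarrow> ns ! p < 0) \<and> ((ns ! p < 0 \<longleftrightarrow> ns ! q < 0) \<longrightarrow> p < q)"
  by (auto simp: position_key_def)

lemma ordering_condition_iff:
  assumes \<sigma>: "\<sigma> permutes {..<length ns}"
  shows "(\<forall>i j. i < j \<and> j < length ns \<longrightarrow>
       (ns ! \<sigma> j < 0 \<longrightarrow> ns ! \<sigma> i < 0) \<and>
       ((ns ! \<sigma> i < 0 \<longleftrightarrow> ns ! \<sigma> j < 0) \<longrightarrow> \<sigma> i < \<sigma> j)) \<longleftrightarrow>
    sorted_wrt (<) (map (position_key ns) (map \<sigma> [0..<length ns]))"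
proof -
  have "\<sigma> i < length ns" if "i < length ns" for i
    using permutes_in_image[OF \<sigma>, of i] that by simp
  then show ?thesis
    by (auto simp: sorted_wrt_iff_nth_less position_key_less_iff)
qed

lemma sorted_position_key:
  "sorted_wrt (<) (map (position_key ns) (ordered_positions ns))"
proof -
  have sorted: "sorted_wrt (<) (filter P [0..<length ns])" for P
    by (intro sorted_wrt_filter) simp
  have "sorted_wrt (\<lambda>i j. position_key ns i < position_key ns j) (filter (\<lambda>i. ns ! i < 0) [0..<length ns])"
    by (rule sorted_wrt_mono_rel[OF _ sorted]) (simp add: position_key_def)
  moreover have "sorted_wrt (\<lambda>i j. position_key ns i < position_key ns j)
      (filter (\<lambda>i. \<not> ns ! i < 0) [0..<length ns])"
    by (rule sorted_wrt_mono_rel[OF _ sorted]) (simp add: position_key_def)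
  ultimately show ?thesis
    unfolding sorted_wrt_map ordered_positions_def sorted_wrt_append
    by (auto simp: position_key_def)
qed

text \<open>The ordering condition says that the keys increase along the sequence of positions. A
  strictly increasing list is determined by its set of entries and the keys are injective on
  positions, so only one permutation qualifies.\<close>

lemma ordering_perm_eq: "ordering_perm ns = position_perm ns"
  unfolding ordering_perm_def
proof (rule the_equality)
  show "position_perm ns permutes {..<length ns} \<and>
    (\<forall>i j. i < j \<and> j < length ns \<longrightarrow>
       (ns ! position_perm ns j < 0 \<longrightarrow> ns ! position_perm ns i < 0) \<and>
       ((ns ! position_perm ns i < 0 \<longleftrightarrow> ns ! position_perm ns j < 0) \<longrightarrow>
         position_perm ns i < position_perm ns j))"
    unfolding ordering_condition_iff[OF position_perm_permutes] map_position_perm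
    by (intro conjI position_perm_permutes sorted_position_key)
next
  fix \<sigma>
  assume "\<sigma> permutes {..<length ns} \<and> (\<forall>i j. i < j \<and> j < length ns \<longrightarrow>
       (ns ! \<sigma> j < 0 \<longrightarrow> ns ! \<sigma> i < 0) \<and>
       ((ns ! \<sigma> i < 0 \<longleftrightarrow> ns ! \<sigma> j < 0) \<longrightarrow> \<sigma> i < \<sigma> j))"
  then have \<sigma>: "\<sigma> permutes {..<length ns}"
    and sorted: "sorted_wrt (<) (map (position_key ns) (map \<sigma> [0..<length ns]))"
    by (auto simp only: ordering_condition_iff)
  have set: "set (map \<sigma> [0..<length ns]) = {..<length ns}"
    using permutes_image[OF \<sigma>] by (simp add: lessThan_atLeast0)
  have "map (position_key ns) (map \<sigma> [0..<length ns]) = map (position_key ns) (ordered_positions ns)"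
    using sorted_position_key sorted
    by (rule strict_sorted_equal) (simp only: set_map[of "position_key ns"] set set_ordered_positions)
  moreover have "inj_on (position_key ns) {..<length ns}"
    by (rule inj_onI) (auto simp: position_key_def split: if_splits)
  ultimately have "map \<sigma> [0..<length ns] = ordered_positions ns"
    by (subst (asm) inj_on_map_eq_map) (simp_all only: set set_ordered_positions Un_absorb)
  then have "\<sigma> i = position_perm ns i" if "i < length ns" for i
    using that by (metis add_0 diff_zero length_upt map_position_perm nth_map nth_upt)
  moreover have "\<sigma> i = i" if "\<not> i < length ns" for i
    using permutes_not_in[OF \<sigma>] that by simp
  ultimately show "\<sigma> = position_perm ns"
    by (auto simp: fun_eq_iff position_perm_def)
qed

lemma ordered_positions_snoc:
  "ordered_positions (ns @ [k]) = filter (\<lambda>i. ns ! i < 0) [0..<length ns] @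
    (if k < 0 then [length ns] else []) @ filter (\<lambda>i. \<not> ns ! i < 0) [0..<length ns] @
    (if k < 0 then [] else [length ns])"
proof -
  have "filter (\<lambda>i. P ((ns @ [k]) ! i)) [0..<length ns] = filter (\<lambda>i. P (ns ! i)) [0..<length ns]" for P
    by (rule filter_cong) (simp_all add: nth_append)
  from this[of "\<lambda>x. x < 0"] this[of "\<lambda>x. \<not> x < 0"] show ?thesis
    by (simp add: ordered_positions_def)
qed

lemma position_perm_snoc_nonneg:
  assumes "\<not> k < 0"
  shows "position_perm (ns @ [k]) = position_perm ns"
proof
  fix i
  have "ordered_positions (ns @ [k]) = ordered_positions ns @ [length ns]"
    using assms by (simp add: ordered_positions_snoc) (simp add: ordered_positions_def)
  then show "position_perm (ns @ [k]) i = position_perm ns i"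
    by (auto simp: position_perm_def nth_append)
qed

text \<open>The new position is listed directly behind the old negative ones and pushes the
  nonnegative block one place to the right. The cycle compensates this shift and sends the slot
  \<open>length ns\<close>, fixed by the old permutation, to the place of the new entry.\<close>

lemma position_perm_snoc_neg:
  assumes "k < 0"
  shows "position_perm ns =
    position_perm (ns @ [k]) \<circ> cycle_up (length (filter (\<lambda>i. ns ! i < 0) [0..<length ns])) (length ns)"
proof
  fix i
  define u v where "u = filter (\<lambda>i. ns ! i < 0) [0..<length ns]"
    and "v = filter (\<lambda>i. \<not> ns ! i < 0) [0..<length ns]"
  have old: "ordered_positions ns = u @ v" by (simp add: ordered_positions_def u_def v_def)
  have new: "ordered_positions (ns @ [k]) = u @ length ns # v"
    using assms by (simp add: ordered_positions_snoc u_def v_def)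
  have len: "length ns = length u + length v"
    using length_ordered_positions[of ns] by (simp add: old)
  show "position_perm ns i = (position_perm (ns @ [k]) \<circ> cycle_up (length u) (length ns)) i"
    using len by (auto simp: position_perm_def cycle_up_def old new nth_append Suc_diff_le nth_Cons')
qed

lemma sign_position_perm_snoc_neg:
  assumes "k < 0"
  shows "sign (position_perm (ns @ [k])) =
    sign (position_perm ns) * (-1) ^ length (filter (\<lambda>i. \<not> ns ! i < 0) [0..<length ns])"
proof -
  let ?u = "length (filter (\<lambda>i. ns ! i < 0) [0..<length ns])"
    and ?v = "length (filter (\<lambda>i. \<not> ns ! i < 0) [0..<length ns])"
  have len: "length ns = ?u + ?v"
    using length_ordered_positions[of ns] unfolding ordered_positions_def length_append by simp
  then have le: "?u \<le> length ns" by linarith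
  have "permutation (position_perm (ns @ [k]))" "permutation (cycle_up ?u (length ns))"
    using position_perm_permutes[of "ns @ [k]"] cycle_up_permutes[OF le]
    by (auto intro: permutes_imp_permutation[rotated])
  then have "sign (position_perm ns) = sign (position_perm (ns @ [k])) * sign (cycle_up ?u (length ns))"
    by (subst position_perm_snoc_neg[OF assms], rule sign_compose)
  also have "sign (cycle_up ?u (length ns)) = (-1) ^ ?v"
    unfolding sign_cycle_up[OF le] using len by (metis add_diff_cancel_left')
  finally show ?thesis by (simp add: mult.assoc flip: power_mult_distrib)
qed

abbreviation mode_normal :: "('h::ab_group_add \<times> int) list \<Rightarrow> 'h affine free_alg"
  where "mode_normal \<equiv> contraction_algebra.normal (\<lambda>c x. alg_scalar c * x)
    (\<lambda>p. mode_letter (fst p) (snd p)) (\<lambda>p. snd p \<ge> 0)"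

lemma V_rep_prod_list:
  "foldr (mult (V_End sc B)) (map (\<lambda>x. V_rep sc B (f x)) xs) \<one>\<^bsub>V_End sc B\<^esub> =
    V_rep sc B (prod_list (map f xs))"
  by (induction xs) (simp_all add: V_rep_one V_rep_mult del: End_algebra_simps)

lemma filter_nth_conv: "map ((!) w) (filter (\<lambda>i. P (w ! i)) [0..<length w]) = filter P w"
  using filter_map[of P "(!) w" "[0..<length w]"] by (simp add: map_nth comp_def)

lemma normal_modes_conv:
  "normal_modes sc B (map fst w) (map snd w) = V_rep sc B (mode_normal w)"
proof -
  interpret C: contraction_algebra "\<lambda>x y. V_rep sc B x = V_rep sc B y" "\<lambda>c x. alg_scalar c * x"
    "\<lambda>p. mode_letter (fst p) (snd p)" "\<lambda>p. snd p \<ge> 0" "mode_contr B"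
    by (rule contraction_algebra_V_rep)
  let ?ns = "map snd w" and ?L = "\<lambda>p. mode_letter (fst p) (snd p)"
  let ?\<sigma> = "position_perm ?ns"
  have filt: "map ((!) w) (filter (\<lambda>i. P (?ns ! i)) [0..<length w]) = filter (\<lambda>p. P (snd p)) w" for P
  proof -
    have "filter (\<lambda>i. P (?ns ! i)) [0..<length w] = filter (\<lambda>i. P (snd (w ! i))) [0..<length w]"
      by (rule filter_cong) simp_all
    then show ?thesis by (simp add: filter_nth_conv[of w "\<lambda>p. P (snd p)"])
  qed
  \<comment> \<open>Appending a mode on the right changes both signs alike: a negative mode has to
    pass all positive ones of w, a positive mode passes none.\<close>
  have sgn: "sign ?\<sigma> = (-1) ^ C.inversions w"
  proof (induction w rule: rev_induct)
    case Nil
    have "position_perm [] = id" by (auto simp: position_perm_def)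
    then show ?case by simp
  next
    case (snoc p w)
    show ?case
    proof (cases "snd p < 0")
      case True
      have "length (filter (\<lambda>i. \<not> map snd w ! i < 0) [0..<length w]) = length (filter (\<lambda>p. \<not> snd p < 0) w)"
      proof -
        have "filter (\<lambda>i. \<not> map snd w ! i < 0) [0..<length w] = filter (\<lambda>i. \<not> snd (w ! i) < 0) [0..<length w]"
          by (rule filter_cong) simp_all
        then show ?thesis
          by (metis (no_types) filter_nth_conv[of w "\<lambda>p. \<not> snd p < 0"] length_map)
      qed
      also have "\<dots> = C.nann w" by (simp add: C.nann_def not_less)
      finally show ?thesis
        using True snoc by (simp add: sign_position_perm_snoc_neg power_add)
    next
      case False
      then show ?thesis using snoc by (simp add: position_perm_snoc_nonneg)
    qed
  qed
  have "map (\<lambda>i. ?L (w ! ?\<sigma> i)) [0..<length w] = map (\<lambda>i. ?L (w ! i)) (ordered_positions ?ns)"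
    by (simp only: map_position_perm[of ?ns, symmetric] length_map map_map o_def)
  also have "\<dots> = map ?L (map ((!) w) (ordered_positions ?ns))" by simp
  also have "map ((!) w) (ordered_positions ?ns) =
      filter (\<lambda>p. snd p < 0) w @ filter (\<lambda>p. \<not> snd p < 0) w"
    unfolding ordered_positions_def map_append length_map
    using filt[of "\<lambda>x. x < 0"] filt[of "\<lambda>x. \<not> x < 0"] by simp
  finally have prod: "prod_list (map (\<lambda>i. ?L (w ! ?\<sigma> i)) [0..<length w]) = C.cre w * C.ann w"
    by (simp add: C.cre_def C.ann_def not_le not_less)
  have \<sigma>_less: "?\<sigma> i < length w" if "i < length w" for i
    using permutes_in_image[OF position_perm_permutes[of ?ns], of i] that by simp
  have "map (\<lambda>i. mode sc B (map fst w ! ?\<sigma> i) (?ns ! ?\<sigma> i)) [0..<length w] =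
      map (\<lambda>i. V_rep sc B (?L (w ! ?\<sigma> i))) [0..<length w]"
  proof (intro map_cong refl)
    fix i assume "i \<in> set [0..<length w]"
    then have "?\<sigma> i < length w" by (intro \<sigma>_less) simp
    then show "mode sc B (map fst w ! ?\<sigma> i) (?ns ! ?\<sigma> i) = V_rep sc B (?L (w ! ?\<sigma> i))"
      by (simp only: mode_conv nth_map)
  qed
  then have "normal_modes sc B (map fst w) ?ns =
      of_int (sign ?\<sigma>) \<odot>\<^bsub>V_End sc B\<^esub> V_rep sc B (C.cre w * C.ann w)"
    unfolding normal_modes_def Let_def ordering_perm_eq length_map
    by (simp only: V_rep_prod_list prod)
  then show ?thesis
    by (simp only: sgn C.normal_def V_rep_scale of_int_power of_int_minus of_int_1)
qed

section \<open>Products of series in disjoint sets of variables\<close>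

definition supported :: "var set \<Rightarrow> (var \<Rightarrow> int) \<Rightarrow> bool"
  where "supported U e \<longleftrightarrow> (\<forall>v. v \<notin> U \<longrightarrow> e v = 0)"

definition cut :: "var set \<Rightarrow> (var \<Rightarrow> int) \<Rightarrow> var \<Rightarrow> int"
  where "cut U e = (\<lambda>v. if v \<in> U then e v else 0)"

lemma cut_mem [simp]: "v \<in> U \<Longrightarrow> cut U e v = e v"
  by (simp add: cut_def)

lemma supported_cut: "supported U (cut U e)"
  by (simp add: supported_def cut_def)

lemma cut_cut: "U \<subseteq> W \<Longrightarrow> cut U (cut W e) = cut U e"
  by (rule ext) (auto simp: cut_def)

text \<open>An exponent is in at most one way a sum of exponents supported in U and in W, namely of
  its two restrictions, so the Cauchy product has at most one term.\<close>

lemma series_mult_disjoint: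
  assumes R: "semiring R" and F: "\<And>d. F d \<in> carrier R" and G: "\<And>d. G d \<in> carrier R"
    and suppF: "\<And>d. F d \<noteq> \<zero>\<^bsub>R\<^esub> \<Longrightarrow> supported U d"
    and suppG: "\<And>d. G d \<noteq> \<zero>\<^bsub>R\<^esub> \<Longrightarrow> supported W d"
    and disj: "U \<inter> W = {}"
  shows "series_mult R F G e =
    (if supported (U \<union> W) e then F (cut U e) \<otimes>\<^bsub>R\<^esub> G (cut W e) else \<zero>\<^bsub>R\<^esub>)"
proof -
  interpret semiring R by (rule R)
  let ?D = "{(d, d'). (\<lambda>v. d v + d' v) = e \<and> F d \<noteq> \<zero>\<^bsub>R\<^esub> \<and> G d' \<noteq> \<zero>\<^bsub>R\<^esub>}"
  have D: "d = cut U e \<and> d' = cut W e \<and> supported (U \<union> W) e" if "(d, d') \<in> ?D" for d d'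
  proof -
    have e: "e = (\<lambda>v. d v + d' v)" and d: "supported U d" and d': "supported W d'"
      using that suppF suppG by auto
    have "d v = cut U e v \<and> d' v = cut W e v" for v
      using d d' disj by (cases "v \<in> U"; cases "v \<in> W") (auto simp: e supported_def cut_def)
    moreover have "supported (U \<union> W) e"
      using d d' by (simp add: e supported_def)
    ultimately show ?thesis by auto
  qed
  show ?thesis
  proof (cases "supported (U \<union> W) e \<and> F (cut U e) \<noteq> \<zero>\<^bsub>R\<^esub> \<and> G (cut W e) \<noteq> \<zero>\<^bsub>R\<^esub>")
    case True
    have "(\<lambda>v. cut U e v + cut W e v) = e"
      using True disj by (auto simp: fun_eq_iff cut_def supported_def)
    then have "(cut U e, cut W e) \<in> ?D" using True by simp
    moreover have "p = (cut U e, cut W e)" if "p \<in> ?D" for p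
      using that D[of "fst p" "snd p"] by (cases p) simp
    ultimately have "?D = {(cut U e, cut W e)}" by (intro equalityI subsetI) auto
    then show ?thesis using True F G by (simp add: series_mult_def)
  next
    case False
    have "p \<notin> ?D" for p
    proof
      assume p: "p \<in> ?D"
      obtain d d' where dd: "p = (d, d')" by (cases p)
      from D[of d d'] p have "d = cut U e" "d' = cut W e" "supported (U \<union> W) e" by (simp_all add: dd)
      then show False using False p by (simp add: dd)
    qed
    then have "?D = {}" by (simp only: set_eq_iff empty_iff simp_thms)
    then have "series_mult R F G e = \<zero>\<^bsub>R\<^esub>" by (simp only: series_mult_def finsum_empty)
    \<comment> \<open>The index set omits vanishing coefficients, and then the product on the right
      is 0 as well.\<close>
    moreover have "F (cut U e) \<otimes>\<^bsub>R\<^esub> G (cut W e) = \<zero>\<^bsub>R\<^esub>" if "supported (U \<union> W) e"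
      using False that l_null[OF G] r_null[OF F] by fastforce
    ultimately show ?thesis by simp
  qed
qed

lemma series_prod_disjoint:
  assumes supp: "\<And>k d. k \<in> set ks \<Longrightarrow> F k d \<noteq> 0 \<Longrightarrow> supported (U k) d"
    and disj: "\<And>k l. k \<in> set ks \<Longrightarrow> l \<in> set ks \<Longrightarrow> k \<noteq> l \<Longrightarrow> U k \<inter> U l = {}"
    and dist: "distinct ks"
  shows "foldr (series_mult complex_ring) (map F ks) (series_one complex_ring) e =
    (if supported (\<Union>k\<in>set ks. U k) e then \<Prod>k\<in>set ks. F k (cut (U k) e) else 0)"
  using assms
proof (induction ks arbitrary: e)
  case Nil
  then show ?case by (auto simp: series_one_def supported_def fun_eq_iff)
next
  case (Cons k ks)
  interpret cring complex_ring by (rule cring_complex_ring)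
  let ?G = "foldr (series_mult complex_ring) (map F ks) (series_one complex_ring)"
  let ?W = "\<Union>l\<in>set ks. U l"
  have IH: "?G e = (if supported ?W e then \<Prod>l\<in>set ks. F l (cut (U l) e) else 0)" for e
    using Cons.prems by (intro Cons.IH) auto
  have cutW: "(\<Prod>l\<in>set ks. F l (cut (U l) (cut ?W e))) = (\<Prod>l\<in>set ks. F l (cut (U l) e))"
    by (intro prod.cong refl arg_cong2[where f = F] cut_cut) auto
  have "series_mult complex_ring (F k) ?G e =
      (if supported (U k \<union> ?W) e then F k (cut (U k) e) * ?G (cut ?W e) else 0)"
  proof (subst series_mult_disjoint[where U = "U k" and W = ?W])
    show "semiring complex_ring" by (rule semiring_axioms)
    show "U k \<inter> ?W = {}" using Cons.prems(2)[of k] Cons.prems(3) by fastforce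
    show "supported ?W d" if "?G d \<noteq> \<zero>\<^bsub>complex_ring\<^esub>" for d
      using that by (simp add: IH split: if_splits)
    show "supported (U k) d" if "F k d \<noteq> \<zero>\<^bsub>complex_ring\<^esub>" for d
      using that Cons.prems(1)[of k] by simp
  qed simp_all
  also have "?G (cut ?W e) = (\<Prod>l\<in>set ks. F l (cut (U l) e))"
    unfolding IH cutW by (simp add: supported_cut)
  finally show ?case using Cons.prems(3) by simp
qed

lemma monomial_exponents_eq_iff:
  assumes "distinct (map g is)"
  shows "monomial_exponents (map (\<lambda>i. (g i, k i)) is) = e \<longleftrightarrow>
    (\<forall>i\<in>set is. e (g i) = k i) \<and> supported (g ` set is) e"
proof -
  have out: "monomial_exponents (map (\<lambda>i. (g i, k i)) is) v = 0" if "v \<notin> g ` set is" for v "is"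
    using that by (induction "is") (auto simp: monomial_exponents_def)
  have val: "monomial_exponents (map (\<lambda>i. (g i, k i)) is) (g i) = k i" if "i \<in> set is" for i
    using assms that
  proof (induction "is")
    case (Cons j "is")
    have step: "monomial_exponents (map (\<lambda>i. (g i, k i)) (j # is)) (g i) =
        (if g j = g i then k j else 0) + monomial_exponents (map (\<lambda>i. (g i, k i)) is) (g i)"
      by (simp add: monomial_exponents_def)
    show ?case
    proof (cases "i = j")
      case True
      then have "g i \<notin> g ` set is" using Cons.prems by auto
      then show ?thesis unfolding step using True by (simp add: out)
    next
      case False
      then have "i \<in> set is" "g j \<noteq> g i" using Cons.prems by auto
      then show ?thesis unfolding step using Cons by simp
    qed
  qed simp
  show ?thesis
  proof
    assume "monomial_exponents (map (\<lambda>i. (g i, k i)) is) = e"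
    then show "(\<forall>i\<in>set is. e (g i) = k i) \<and> supported (g ` set is) e"
      using out val by (auto simp: supported_def)
  next
    assume e: "(\<forall>i\<in>set is. e (g i) = k i) \<and> supported (g ` set is) e"
    show "monomial_exponents (map (\<lambda>i. (g i, k i)) is) = e"
    proof
      fix v
      show "monomial_exponents (map (\<lambda>i. (g i, k i)) is) v = e v"
        using e out val by (cases "v \<in> g ` set is") (auto simp: supported_def)
    qed
  qed
qed

section \<open>Coefficients of the expanded kernels and of normal ordered products\<close>

text \<open>Both sides equal (-1)^m (m + n + i)! / (m! n! i!).\<close>

lemma contraction_coefficient:
  "((- of_nat n - 1 :: complex) gchoose m) * of_nat ((m + n + 1 + i - 1) choose i) =
    ((- of_nat (n + i) - 1) gchoose m) * (of_nat (n + i) gchoose n)"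
proof -
  have neg: "((- of_nat k - 1 :: complex) gchoose m) = (-1) ^ m * of_nat ((k + m) choose m)" for k
  proof -
    have "((- of_nat k - 1 :: complex) gchoose m) = (-1) ^ m * (of_nat (k + m) gchoose m)"
      by (subst gbinomial_negated_upper) (simp add: algebra_simps)
    then show ?thesis by (simp only: binomial_gbinomial)
  qed
  have "of_nat ((n + m) choose m) * of_nat ((m + n + i) choose i) =
      (of_nat ((n + i + m) choose m) * of_nat ((n + i) choose n) :: complex)"
    by (simp add: binomial_fact add_ac)
  then show ?thesis
    unfolding neg unfolding binomial_gbinomial[symmetric] by (simp add: mult.assoc)
qed

text \<open>The two fields contribute to this exponent with the modes p = - e x - m - 1 and q = - e
  y - n - 1. The conditions p >= 0 and p + q + 1 = 0 are those of a contraction, and the value is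
  the product of the binomials of the two fields.\<close>

lemma iota_f_conv:
  assumes "x \<noteq> y"
  shows "iota_f m n x y e = (if supported {x, y} e then
    (if - e x - int m - 1 \<ge> 0 \<and> - e x - int m - 1 + (- e y - int n - 1) + 1 = 0
      then (of_int (e x + int m) gchoose m) * (of_int (e y + int n) gchoose n) else 0) else 0)"
proof -
  define t where "t = m + n + 1"
  have iff: "monomial_exponents [(x, - int t - int i), (y, int i)] = e \<longleftrightarrow>
      e x = - int t - int i \<and> e y = int i \<and> supported {x, y} e" for i
    using monomial_exponents_eq_iff[of fst "[(x, - int t - int i), (y, int i)]" snd e] assms by auto
  show ?thesis
  proof (cases "supported {x, y} e \<and> e y \<ge> 0 \<and> e x + e y = - int t")
    case True
    define i where "i = nat (e y)"
    have ey: "e y = int i" and ex: "e x = - int t - int i" using True by (auto simp: i_def)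
    have "{i. monomial_exponents [(x, - int t - int i), (y, int i)] = e} = {i}"
      using True by (auto simp: iff ey ex)
    then have "iota_f m n x y e = ((- of_nat n - 1) gchoose m) * of_nat ((t + i - 1) choose i)"
      unfolding iota_f_def iota_inverse_power_def t_def[symmetric] by simp
    also have "\<dots> = (of_int (e x + int m) gchoose m) * (of_int (e y + int n) gchoose n)"
    proof -
      have "(of_int (e x + int m) :: complex) = - of_nat (n + i) - 1"
        "(of_int (e y + int n) :: complex) = of_nat (n + i)"
        by (simp_all add: ex ey t_def)
      then show ?thesis by (simp only: t_def contraction_coefficient)
    qed
    finally show ?thesis using True by (simp add: ex ey t_def)
  next
    case False
    then have "{i. monomial_exponents [(x, - int t - int i), (y, int i)] = e} = {}"
      by (auto simp: iff)
    then have lhs: "iota_f m n x y e = 0"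
      by (simp only: iota_f_def iota_inverse_power_def sum.empty mult_zero_right flip: t_def)
    \<comment> \<open>The conditions on the modes only give e y >= - n, while the expansion has
      terms only for e y >= 0. In the gap the binomial vanishes, its upper entry being a natural
      number below n.\<close>
    have "(of_int (e y + int n) gchoose n :: complex) = 0"
      if "supported {x, y} e" "- e x - int m - 1 \<ge> 0" "- e x - int m - 1 + (- e y - int n - 1) + 1 = 0"
    proof -
      have "e y < 0" "e y + int n \<ge> 0" using False that by (auto simp: t_def)
      then obtain k where k: "e y + int n = int k" "k < n"
        by (metis add.commute less_add_same_cancel1 nonneg_int_cases of_nat_less_iff add_less_same_cancel2)
      show ?thesis
        unfolding k(1) of_int_of_nat_eq binomial_gbinomial[symmetric] using k(2) by simp
    qed
    then show ?thesis unfolding lhs by auto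
  qed
qed

text \<open>The exponent e v occurs in h^(m)(v) only for n = - e v - m - 1. Then - n - 1 = e v + m,
  which is the upper entry of the binomial in \<open>factor_coeff\<close>.\<close>

definition factor_mode :: "(var \<Rightarrow> int) \<Rightarrow> 'h \<times> nat \<times> var \<Rightarrow> 'h \<times> int"
  where "factor_mode e = (\<lambda>(h, m, v). (h, - e v - int m - 1))"

definition factor_coeff :: "(var \<Rightarrow> int) \<Rightarrow> 'h \<times> nat \<times> var \<Rightarrow> complex"
  where "factor_coeff e = (\<lambda>(h, m, v). of_int (e v + int m) gchoose m)"

definition factor_vars :: "('h \<times> nat \<times> var) list \<Rightarrow> var set"
  where "factor_vars fs = (snd \<circ> snd) ` set fs"

lemma V_rep_zero: "V_rep sc B 0 = \<zero>\<^bsub>V_End sc B\<^esub>"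
proof -
  interpret V: module complex_ring "V_space sc B" by (rule module_V_space)
  have "V_rep sc B (alg_scalar 0 * 1) = 0 \<odot>\<^bsub>V_End sc B\<^esub> \<one>\<^bsub>V_End sc B\<^esub>"
    unfolding V_rep_scale V_rep_one ..
  also have "\<dots> = \<zero>\<^bsub>V_End sc B\<^esub>"
    using V.smult_l_null by (auto intro!: restrict_ext)
  finally show ?thesis by (simp add: alg_scalar_0)
qed

lemma V_rep_closed: "V_rep sc B x \<in> carrier (V_End sc B)"
  by (simp add: V_rep_linear_endos)

lemma V_rep_finsum:
  assumes "finite S" and "\<And>i. i \<in> S \<Longrightarrow> F i = V_rep sc B (f i)"
  shows "finsum (V_End sc B) F S = V_rep sc B (\<Sum>i\<in>S. f i)"
proof -
  interpret E: semiring "V_End sc B" by (rule semiring_V_End)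
  have "finsum (V_End sc B) F S = finsum (V_End sc B) (\<lambda>i. V_rep sc B (f i)) S"
    using assms(2) by (intro E.finsum_cong') (auto simp del: End_algebra_simps intro: V_rep_closed)
  also have "\<dots> = V_rep sc B (\<Sum>i\<in>S. f i)"
    using assms(1)
    by induction (simp_all add: V_rep_zero V_rep_add V_rep_closed del: End_algebra_simps)
  finally show ?thesis .
qed

text \<open>As the variables are distinct, the exponents determine every mode number. A coefficient
  is therefore a single normal-ordered product, or 0 if e involves another variable.\<close>

lemma normal_product_conv:
  assumes "distinct (map (snd \<circ> snd) fs)"
  shows "normal_product sc B fs e = V_rep sc B (if supported (factor_vars fs) e
    then alg_scalar (\<Prod>f\<leftarrow>fs. factor_coeff e f) * mode_normal (map (factor_mode e) fs) else 0)"
proof -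
  interpret E: semiring "V_End sc B" by (rule semiring_V_End)
  let ?vs = "map (snd \<circ> snd) fs" and ?ms = "map (fst \<circ> snd) fs"
  let ?ns = "map (\<lambda>f. snd (factor_mode e f)) fs"
  let ?D = "{ns. length ns = length fs \<and>
    monomial_exponents (map (\<lambda>i. (?vs ! i, - (ns ! i) - int (?ms ! i) - 1)) [0..<length fs]) = e}"
  have vs: "map ((!) ?vs) [0..<length fs] = ?vs" using map_nth[of ?vs] by simp
  have m1: "ns \<in> ?D \<longleftrightarrow> length ns = length fs \<and>
      (\<forall>i<length fs. e (?vs ! i) = - (ns ! i) - int (?ms ! i) - 1) \<and> supported (factor_vars fs) e" for ns
  proof -
    have "(!) ?vs ` set [0..<length fs] = factor_vars fs"
      unfolding set_map[symmetric] vs by (simp add: factor_vars_def)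
    then show ?thesis
      using monomial_exponents_eq_iff[of "(!) ?vs" "[0..<length fs]"] assms
      by (auto simp: vs)
  qed
  have m2: "(\<forall>i<length fs. e (?vs ! i) = - (ns ! i) - int (?ms ! i) - 1) \<longleftrightarrow> ns = ?ns"
    if "length ns = length fs" for ns
    using that by (auto simp: list_eq_iff_nth_eq factor_mode_def case_prod_beta)
  have m3: "ns \<in> ?D \<longleftrightarrow> ns = ?ns \<and> supported (factor_vars fs) e" for ns
  proof (cases "length ns = length fs")
    case True
    show ?thesis unfolding m1 m2[OF True] using True by (simp only: simp_thms)
  next
    case False
    then have "ns \<noteq> ?ns" by auto
    then show ?thesis unfolding m1 using False by (simp only: simp_thms)
  qed
  have D: "?D = (if supported (factor_vars fs) e then {?ns} else {})"
  proof (rule Set.set_eqI)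
    fix ns
    show "ns \<in> ?D \<longleftrightarrow> ns \<in> (if supported (factor_vars fs) e then {?ns} else {})"
      by (subst m3) simp
  qed
  show ?thesis
  proof (cases "supported (factor_vars fs) e")
    case False
    then show ?thesis
      unfolding normal_product_def Let_def D by (simp add: V_rep_zero del: End_algebra_simps)
  next
    case True
    have "map fst (map (factor_mode e) fs) = map fst fs"
      by (simp add: factor_mode_def case_prod_beta)
    then have "normal_modes sc B (map fst fs) ?ns = V_rep sc B (mode_normal (map (factor_mode e) fs))"
      using normal_modes_conv[of sc B "map (factor_mode e) fs"] by (simp only: map_map o_def)
    moreover have "(\<Prod>i<length fs. (of_int (- (?ns ! i) - 1) gchoose (?ms ! i))) = (\<Prod>f\<leftarrow>fs. factor_coeff e f)"
      by (simp add: prod.list_conv_set_nth lessThan_atLeast0 factor_mode_def factor_coeff_def case_prod_beta)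
    ultimately show ?thesis
      unfolding normal_product_def Let_def D
      using True V_rep_closed[of sc B "alg_scalar (\<Prod>f\<leftarrow>fs. factor_coeff e f) * mode_normal (map (factor_mode e) fs)"]
      by (simp add: V_rep_scale[symmetric] del: End_algebra_simps)
  qed
qed

lemma normal_product_closed:
  "distinct (map (snd \<circ> snd) fs) \<Longrightarrow> normal_product sc B fs e \<in> carrier (V_End sc B)"
  unfolding normal_product_conv by (rule V_rep_closed)

lemma normal_product_supported:
  "distinct (map (snd \<circ> snd) fs) \<Longrightarrow> normal_product sc B fs e \<noteq> \<zero>\<^bsub>V_End sc B\<^esub> \<Longrightarrow>
    supported (factor_vars fs) e"
  by (simp add: normal_product_conv V_rep_zero del: End_algebra_simps split: if_splits)

lemma normal_product_cut:
  assumes "distinct (map (snd \<circ> snd) fs)"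
  shows "normal_product sc B fs (cut (factor_vars fs) e) =
    V_rep sc B (alg_scalar (\<Prod>f\<leftarrow>fs. factor_coeff e f) * mode_normal (map (factor_mode e) fs))"
proof -
  have "cut (factor_vars fs) e (snd (snd f)) = e (snd (snd f))" if "f \<in> set fs" for f
    using that by (intro cut_mem) (auto simp: factor_vars_def)
  then have "map (factor_mode (cut (factor_vars fs) e)) fs = map (factor_mode e) fs"
    "map (factor_coeff (cut (factor_vars fs) e)) fs = map (factor_coeff e) fs"
    by (auto simp: factor_mode_def factor_coeff_def case_prod_beta)
  then show ?thesis by (simp only: normal_product_conv[OF assms] supported_cut if_True)
qed

section \<open>The determinant of contractions\<close>

abbreviation field_mode :: "(nat \<Rightarrow> 'h) \<Rightarrow> (nat \<Rightarrow> nat) \<Rightarrow> (nat \<Rightarrow> var) \<Rightarrow> (var \<Rightarrow> int) \<Rightarrow> nat \<Rightarrow> 'h \<times> int"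
  where "field_mode a m v e i \<equiv> factor_mode e (a i, m i, v i)"

abbreviation field_coeff :: "(nat \<Rightarrow> 'h) \<Rightarrow> (nat \<Rightarrow> nat) \<Rightarrow> (nat \<Rightarrow> var) \<Rightarrow> (var \<Rightarrow> int) \<Rightarrow> nat \<Rightarrow> complex"
  where "field_coeff a m v e i \<equiv> factor_coeff e (a i, m i, v i)"

text \<open>A matrix entry becomes a contraction of modes times one quantity belonging to its row
  and one belonging to its column; these can later be taken out of the determinant.\<close>

lemma iota_f_contr:
  assumes "x \<noteq> y" and "supported {x, y} e"
  shows "B h h' * iota_f m n x y e =
    mode_contr B (factor_mode e (h, m, x)) (factor_mode e (h', n, y)) *
      (factor_coeff e (h, m, x) * factor_coeff e (h', n, y))"
  using assms by (simp add: iota_f_conv mode_contr_def factor_mode_def factor_coeff_def)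

context
  fixes B :: "'h \<Rightarrow> 'h \<Rightarrow> complex" and a b :: "nat \<Rightarrow> 'h" and m n :: "nat \<Rightarrow> nat"
    and "is" js :: "nat list"
  assumes dist: "distinct is" "distinct js" and len: "length js = length is"
begin

text \<open>For a fixed permutation the factors involve disjoint pairs of variables, so the
  coefficient of their product is a product of coefficients. The binomials run through all rows and
  all columns whatever the permutation is, and leave a determinant of contractions.\<close>

lemma series_det_conv:
  "series_det (length is) (\<lambda>k l e. B (a (is ! k)) (b (js ! l)) *
      iota_f (m (is ! k)) (n (js ! l)) (X (is ! k)) (Y (js ! l)) e) e =
    (if supported (X ` set is \<union> Y ` set js) e then
      leibniz_det (\<lambda>i j. mode_contr B (field_mode a m X e i) (field_mode b n Y e j)) is js *
      ((\<Prod>i\<in>set is. field_coeff a m X e i) * (\<Prod>j\<in>set js. field_coeff b n Y e j)) else 0)"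
proof -
  let ?\<rho> = "length is"
  let ?C = "\<lambda>k l e. B (a (is ! k)) (b (js ! l)) *
      iota_f (m (is ! k)) (n (js ! l)) (X (is ! k)) (Y (js ! l)) e"
  let ?ct = "\<lambda>i j. mode_contr B (field_mode a m X e i) (field_mode b n Y e j)"
  let ?G = "(\<Prod>i\<in>set is. field_coeff a m X e i) * (\<Prod>j\<in>set js. field_coeff b n Y e j)"
  have prod_nth: "(\<Prod>k<?\<rho>. f (xs ! k)) = (\<Prod>i\<in>set xs. f i)"
    if "distinct xs" "length xs = ?\<rho>" for xs :: "nat list" and f :: "nat \<Rightarrow> complex"
    using that by (intro prod.reindex_bij_betw bij_betw_nth) auto
  have summand: "foldr (series_mult complex_ring) (map (\<lambda>k. ?C k (\<pi> k)) [0..<?\<rho>]) (series_one complex_ring) e =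
      (if supported (X ` set is \<union> Y ` set js) e then (\<Prod>k<?\<rho>. ?ct (is ! k) (js ! \<pi> k)) * ?G else 0)"
    if \<pi>: "\<pi> permutes {..<?\<rho>}" for \<pi>
  proof -
    let ?U = "\<lambda>k. {X (is ! k), Y (js ! \<pi> k)}"
    have less: "\<pi> k < ?\<rho>" if "k < ?\<rho>" for k
      using permutes_in_image[OF \<pi>, of k] that by simp
    have inj: "\<pi> k \<noteq> \<pi> l" if "k \<noteq> l" for k l
      using permutes_inj[OF \<pi>] that by (auto simp: inj_def)
    have image: "\<pi> ` {..<?\<rho>} = {..<?\<rho>}" by (rule permutes_image[OF \<pi>])
    have "(\<Union>k\<in>{..<?\<rho>}. ?U k) = X ` (!) is ` {..<?\<rho>} \<union> Y ` (!) js ` \<pi> ` {..<?\<rho>}" by auto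
    also have "\<dots> = X ` set is \<union> Y ` set js"
      unfolding image using len by (simp add: nth_image lessThan_atLeast0)
    finally have union: "(\<Union>k\<in>set [0..<?\<rho>]. ?U k) = X ` set is \<union> Y ` set js"
      by (simp add: lessThan_atLeast0)
    have "foldr (series_mult complex_ring) (map (\<lambda>k. ?C k (\<pi> k)) [0..<?\<rho>]) (series_one complex_ring) e =
        (if supported (\<Union>k\<in>set [0..<?\<rho>]. ?U k) e then \<Prod>k\<in>set [0..<?\<rho>]. ?C k (\<pi> k) (cut (?U k) e) else 0)"
    proof (rule series_prod_disjoint)
      show "supported (?U k) d" if "?C k (\<pi> k) d \<noteq> 0" for k d
        using that by (auto simp: iota_f_conv split: if_splits)
      show "?U k \<inter> ?U l = {}" if "k \<in> set [0..<?\<rho>]" "l \<in> set [0..<?\<rho>]" "k \<noteq> l" for k l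
        using that dist len inj[of k l] less by (auto simp: nth_eq_iff_index_eq)
    qed simp
    also have "(\<Prod>k\<in>set [0..<?\<rho>]. ?C k (\<pi> k) (cut (?U k) e)) =
        (\<Prod>k<?\<rho>. ?ct (is ! k) (js ! \<pi> k) *
          (field_coeff a m X e (is ! k) * field_coeff b n Y e (js ! \<pi> k)))"
    proof (intro prod.cong)
      fix k
      have "?C k (\<pi> k) (cut (?U k) e) =
          mode_contr B (field_mode a m X (cut (?U k) e) (is ! k)) (field_mode b n Y (cut (?U k) e) (js ! \<pi> k)) *
          (field_coeff a m X (cut (?U k) e) (is ! k) * field_coeff b n Y (cut (?U k) e) (js ! \<pi> k))"
        by (rule iota_f_contr) (simp_all add: supported_cut)
      then show "?C k (\<pi> k) (cut (?U k) e) = ?ct (is ! k) (js ! \<pi> k) *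
          (field_coeff a m X e (is ! k) * field_coeff b n Y e (js ! \<pi> k))"
        by (simp add: factor_mode_def factor_coeff_def)
    qed (simp add: lessThan_atLeast0)
    also have "\<dots> = (\<Prod>k<?\<rho>. ?ct (is ! k) (js ! \<pi> k)) *
        ((\<Prod>k<?\<rho>. field_coeff a m X e (is ! k)) * (\<Prod>k<?\<rho>. field_coeff b n Y e (js ! \<pi> k)))"
      by (simp only: prod.distrib)
    also have "(\<Prod>k<?\<rho>. field_coeff b n Y e (js ! \<pi> k)) = (\<Prod>k<?\<rho>. field_coeff b n Y e (js ! k))"
      using prod.permute[OF \<pi>, of "\<lambda>k. field_coeff b n Y e (js ! k)"] by (simp add: o_def)
    finally show ?thesis
      unfolding union
      using prod_nth[OF dist(1), of "field_coeff a m X e"] prod_nth[OF dist(2) len, of "field_coeff b n Y e"]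
      by simp
  qed
  show ?thesis
    unfolding series_det_def leibniz_det_def sum_distrib_right
    by (auto simp: summand mult.assoc intro!: sum.cong)
qed

lemma series_det_supported:
  "series_det (length is) (\<lambda>k l e. B (a (is ! k)) (b (js ! l)) *
      iota_f (m (is ! k)) (n (js ! l)) (X (is ! k)) (Y (js ! l)) e) e \<noteq> 0 \<Longrightarrow>
    supported (X ` set is \<union> Y ` set js) e"
  by (simp add: series_det_conv split: if_splits)

lemma series_det_cut:
  "series_det (length is) (\<lambda>k l e. B (a (is ! k)) (b (js ! l)) *
      iota_f (m (is ! k)) (n (js ! l)) (X (is ! k)) (Y (js ! l)) e) (cut (X ` set is \<union> Y ` set js) e) =
      leibniz_det (\<lambda>i j. mode_contr B (field_mode a m X e i) (field_mode b n Y e j)) is js *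
      ((\<Prod>i\<in>set is. field_coeff a m X e i) * (\<Prod>j\<in>set js. field_coeff b n Y e j))"
proof -
  let ?e = "cut (X ` set is \<union> Y ` set js) e"
  have "leibniz_det (\<lambda>i j. mode_contr B (field_mode a m X ?e i) (field_mode b n Y ?e j)) is js =
      leibniz_det (\<lambda>i j. mode_contr B (field_mode a m X e i) (field_mode b n Y e j)) is js"
    unfolding leibniz_det_def
  proof (intro sum.cong refl arg_cong2[where f = "(*)"] prod.cong)
    fix \<pi> k assume "\<pi> \<in> {\<pi>. \<pi> permutes {..<length is}}" "k \<in> {..<length is}"
    then have "is ! k \<in> set is" "js ! \<pi> k \<in> set js"
      using len permutes_in_image[of \<pi> "{..<length is}" k] by auto
    then show "mode_contr B (field_mode a m X ?e (is ! k)) (field_mode b n Y ?e (js ! \<pi> k)) =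
        mode_contr B (field_mode a m X e (is ! k)) (field_mode b n Y e (js ! \<pi> k))"
      by (simp add: factor_mode_def)
  qed
  moreover have "(\<Prod>i\<in>set is. field_coeff a m X ?e i) = (\<Prod>i\<in>set is. field_coeff a m X e i)"
    "(\<Prod>j\<in>set js. field_coeff b n Y ?e j) = (\<Prod>j\<in>set js. field_coeff b n Y e j)"
    by (auto simp: factor_coeff_def intro!: prod.cong)
  ultimately show ?thesis by (simp only: series_det_conv supported_cut if_True)
qed

end

section \<open>Increasing sequences and subsets\<close>

lemma increasing_seqs_conv:
  "increasing_seqs r \<rho> = sl ` {I. I \<subseteq> {1..r} \<and> card I = \<rho>}"
proof (intro equalityI subsetI)
  fix xs assume "xs \<in> increasing_seqs r \<rho>"
  then have xs: "length xs = \<rho>" "sorted_wrt (<) xs" "set xs \<subseteq> {1..r}" by (simp_all add: increasing_seqs_def)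
  then have "sl (set xs) = xs" "card (set xs) = \<rho>"
    by (simp_all add: strict_sorted_iff sorted_list_of_set.idem_if_sorted_distinct distinct_card)
  then show "xs \<in> sl ` {I. I \<subseteq> {1..r} \<and> card I = \<rho>}" using xs by (intro image_eqI[of _ _ "set xs"]) auto
next
  fix xs assume "xs \<in> sl ` {I. I \<subseteq> {1..r} \<and> card I = \<rho>}"
  then obtain I where "xs = sl I" "I \<subseteq> {1..r}" "card I = \<rho>" by blast
  moreover from this have "finite I" by (auto intro: finite_subset)
  ultimately show "xs \<in> increasing_seqs r \<rho>" by (simp add: increasing_seqs_def)
qed

lemma inj_on_sl: "inj_on sl {I. I \<subseteq> {1..r} \<and> card I = \<rho>}"
  by (rule inj_on_inverseI[where g = set]) (auto dest: finite_subset)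

lemma omit_sl: "I \<subseteq> {1..r} \<Longrightarrow> omit r (sl I) = sl ({1..r} - I)"
proof (rule strict_sorted_equal)
  assume "I \<subseteq> {1..r}"
  then have "finite I" by (rule finite_subset) simp
  then show "set (omit r (sl I)) = set (sl ({1..r} - I))" by (auto simp: omit_def)
  show "sorted_wrt (<) (omit r (sl I))" unfolding omit_def by (intro sorted_wrt_filter) (simp del: upt_Suc)
qed simp

lemma sum_list_sl: "finite I \<Longrightarrow> sum_list (sl I) = \<Sum>I"
  by (simp add: distinct_sum_list_conv_Sum)

text \<open>Pairs are grouped by their common size \<rho>. Size 0 leaves only the pair of empty
  sets, the uncontracted term, and sets I with more than s elements have no partner.\<close>

lemma sum_subset_pairs:
  fixes f :: "nat set \<Rightarrow> nat set \<Rightarrow> 'y::comm_monoid_add"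
  shows "(\<Sum>I\<in>Pow {1..r}. \<Sum>J | J \<subseteq> {1..s} \<and> card J = card I. f I J) =
    f {} {} + (\<Sum>\<rho>\<in>{1..min r s}. \<Sum>(is, js)\<in>increasing_seqs r \<rho> \<times> increasing_seqs s \<rho>. f (set is) (set js))"
proof -
  let ?S = "\<lambda>r \<rho>. {I. I \<subseteq> {1..r} \<and> card I = \<rho>}"
  have fin: "finite (?S r \<rho>)" for r \<rho> :: nat by (rule finite_subset[of _ "Pow {1..r}"]) auto
  have inner: "(\<Sum>(is, js)\<in>increasing_seqs r \<rho> \<times> increasing_seqs s \<rho>. f (set is) (set js)) =
      (\<Sum>I\<in>?S r \<rho>. \<Sum>J\<in>?S s \<rho>. f I J)" for \<rho>
  proof -
    have *: "set (sl I) = I" if "I \<in> ?S r \<rho>" for I and r :: nat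
      using that by (auto dest: finite_subset)
    show ?thesis
      unfolding sum.cartesian_product[symmetric] increasing_seqs_conv
      by (simp only: sum.reindex[OF inj_on_sl] o_def) (intro sum.cong refl arg_cong2[where f = f] *; assumption)
  qed
  have large: "(\<Sum>J\<in>?S s (card I). f I J) = 0" if "\<not> card I \<le> s" for I
  proof -
    have "?S s (card I) = {}"
      using that card_mono[of "{1..s}"] by (auto dest: card_mono[rotated])
    then show ?thesis by (simp only: sum.empty)
  qed
  have "(\<Sum>I\<in>Pow {1..r}. \<Sum>J\<in>?S s (card I). f I J) =
      (\<Sum>I\<in>(\<Union>\<rho>\<in>{0..min r s}. ?S r \<rho>). \<Sum>J\<in>?S s (card I). f I J)"
  proof (rule sum.mono_neutral_right)
    show "\<forall>I\<in>Pow {1..r} - (\<Union>\<rho>\<in>{0..min r s}. ?S r \<rho>). (\<Sum>J\<in>?S s (card I). f I J) = 0"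
    proof
      fix I assume I: "I \<in> Pow {1..r} - (\<Union>\<rho>\<in>{0..min r s}. ?S r \<rho>)"
      then have "card I \<le> r" using card_mono[of "{1..r}" I] by simp
      then have "\<not> card I \<le> s" using I by auto
      then show "(\<Sum>J\<in>?S s (card I). f I J) = 0" by (rule large)
    qed
  qed auto
  also have "\<dots> = (\<Sum>\<rho>\<in>{0..min r s}. \<Sum>I\<in>?S r \<rho>. \<Sum>J\<in>?S s (card I). f I J)"
    by (rule sum.UNION_disjoint) (simp_all, blast)
  also have "\<dots> = (\<Sum>\<rho>\<in>{0..min r s}. \<Sum>I\<in>?S r \<rho>. \<Sum>J\<in>?S s \<rho>. f I J)"
    by (intro sum.cong refl) simp
  also have "{0..min r s} = insert 0 {1..min r s}" by auto
  also have "(\<Sum>\<rho>\<in>insert 0 {1..min r s}. \<Sum>I\<in>?S r \<rho>. \<Sum>J\<in>?S s \<rho>. f I J) =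
      f {} {} + (\<Sum>\<rho>\<in>{1..min r s}. \<Sum>I\<in>?S r \<rho>. \<Sum>J\<in>?S s \<rho>. f I J)"
  proof -
    have "?S r 0 = {{}}" for r :: nat by (auto dest: finite_subset)
    then show ?thesis by (subst sum.insert) (simp_all del: Collect_empty_eq)
  qed
  finally show ?thesis by (simp only: inner)
qed

section \<open>Comparison of coefficients in the product formula\<close>

lemma alg_scalar_mult_mult:
  "(alg_scalar c * x) * (alg_scalar d * y) = alg_scalar (c * d) * (x * y)"
proof -
  have "x * (alg_scalar d * y) = alg_scalar d * (x * y)"
    unfolding mult.assoc[symmetric] alg_scalar_commute ..
  then show ?thesis by (simp add: mult.assoc alg_scalar_mult)
qed

lemma factor_vars_factors: "factor_vars (factors a m v is) = v ` set is"
  by (force simp: factor_vars_def factors_def)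

lemma factor_vars_append: "factor_vars (fs @ gs) = factor_vars fs \<union> factor_vars gs"
  by (auto simp: factor_vars_def)

lemma distinct_factors:
  "distinct is \<Longrightarrow> distinct js \<Longrightarrow>
    distinct (map (snd \<circ> snd) (factors a m X is @ factors b n Y js))"
  "distinct is \<Longrightarrow> distinct (map (snd \<circ> snd) (factors a m X is))"
  "distinct js \<Longrightarrow> distinct (map (snd \<circ> snd) (factors b n Y js))"
  by (auto simp: factors_def o_def distinct_map inj_on_def)

lemma factors_coeff: "distinct is \<Longrightarrow> (\<Prod>f\<leftarrow>factors a m v is. factor_coeff e f) = (\<Prod>i\<in>set is. field_coeff a m v e i)"
  by (simp add: factors_def o_def prod.distinct_set_conv_list)

lemma factors_mode: "map (factor_mode e) (factors a m v is) = map (field_mode a m v e) is"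
  by (simp add: factors_def o_def)

theorem theorem4p3:
  fixes sc :: "complex \<Rightarrow> 'h::ab_group_add \<Rightarrow> 'h"
    and basis P Q :: "'h set"
    and B :: "'h \<Rightarrow> 'h \<Rightarrow> complex"
    and M r s :: nat
    and a b :: "nat \<Rightarrow> 'h"
    and m n :: "nat \<Rightarrow> nat"
  assumes "finite_dimensional_vector_space sc basis"
    and "card basis = 2 * M"
    and "symmetric_form sc B"
    and "nondegenerate_form B"
    and "maximal_isotropic sc B P"
    and "maximal_isotropic sc B Q"
    and "vector_space.dim sc P = M"
    and "vector_space.dim sc Q = M"
    and "P \<inter> Q = {0}"
    and "{p + q | p q. p \<in> P \<and> q \<in> Q} = UNIV"
    and "r \<ge> 1"
    and "s \<ge> 1"
  shows "series_mult (End_algebra (V_space sc B))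
      (normal_product sc B (factors a m X [1..<Suc r]))
      (normal_product sc B (factors b n Y [1..<Suc s])) =
    series_add (End_algebra (V_space sc B))
      (normal_product sc B (factors a m X [1..<Suc r] @ factors b n Y [1..<Suc s]))
      (series_sum (End_algebra (V_space sc B))
        (\<lambda>\<rho>. series_sum (End_algebra (V_space sc B))
          (\<lambda>(is, js). series_smult (End_algebra (V_space sc B))
            ((-1) ^ (sum_list is + sum_list js) * (-1) ^ (r * \<rho> + \<rho> * (\<rho> + 1) div 2))
            (series_mult (End_algebra (V_space sc B))
              (scalar_series (End_algebra (V_space sc B))
                (series_det \<rho> (\<lambda>k l e.
                  B (a (is ! k)) (b (js ! l)) *
                  iota_f (m (is ! k)) (n (js ! l)) (X (is ! k)) (Y (js ! l)) e)))
              (normal_product sc B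
                (factors a m X (omit r is) @ factors b n Y (omit s js)))))
          (increasing_seqs r \<rho> \<times> increasing_seqs s \<rho>))
        {1..min r s})"
proof
  fix e :: "var \<Rightarrow> int"
  interpret C: contraction_algebra "\<lambda>x y. V_rep sc B x = V_rep sc B y" "\<lambda>c x. alg_scalar c * x"
    "\<lambda>p. mode_letter (fst p) (snd p)" "\<lambda>p. snd p \<ge> 0" "mode_contr B"
    by (rule contraction_algebra_V_rep)
  let ?A = "V_End sc B"
  let ?R = "[1..<Suc r]" and ?S = "[1..<Suc s]"
  let ?\<alpha> = "field_mode a m X e" and ?\<beta> = "field_mode b n Y e"
  let ?gx = "field_coeff a m X e" and ?gy = "field_coeff b n Y e"
  let ?Z = "X ` {1..r} \<union> Y ` {1..s}"
  let ?ct = "\<lambda>i j. mode_contr B (?\<alpha> i) (?\<beta> j)"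
  \<comment> \<open>The binomials of all r + s factors. Every term carries exactly this product: the
    binomials of contracted factors come from the determinant, the others from the normal-ordered
    product.\<close>
  let ?G = "(\<Prod>i\<in>{1..r}. ?gx i) * (\<Prod>j\<in>{1..s}. ?gy j)"
  let ?sgn = "\<lambda>I J. (-1) ^ (\<Sum>I + \<Sum>J) * (-1) ^ (r * card I + card I * (card I + 1) div 2) :: complex"
  let ?t = "\<lambda>I J. alg_scalar (?sgn I J * leibniz_det ?ct (sl I) (sl J)) *
    mode_normal (map ?\<alpha> (sl ({1..r} - I)) @ map ?\<beta> (sl ({1..s} - J)))"
  \<comment> \<open>An exponent that involves any variable other than the r + s given ones has
    coefficient 0 in every term.\<close>
  let ?z = "\<lambda>x. if supported ?Z e then alg_scalar ?G * x else 0"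
  have sets: "set ?R = {1..r}" "set ?S = {1..s}" by auto
  have slR: "sl {1..k} = [1..<Suc k]" for k :: nat
    by (metis atLeastLessThanSuc_atLeastAtMost sorted_list_of_set_range)
  have "series_mult ?A (normal_product sc B (factors a m X ?R)) (normal_product sc B (factors b n Y ?S)) e =
      V_rep sc B (?z (mode_normal (map ?\<alpha> ?R) * mode_normal (map ?\<beta> ?S)))"
  proof -
    let ?F = "factors a m X ?R" and ?H = "factors b n Y ?S"
    have dist: "distinct (map (snd \<circ> snd) ?F)" "distinct (map (snd \<circ> snd) ?H)"
      by (rule distinct_factors, rule distinct_upt)+
    have vars: "factor_vars ?F = X ` {1..r}" "factor_vars ?H = Y ` {1..s}"
      by (simp_all only: factor_vars_factors sets)
    have "series_mult ?A (normal_product sc B ?F) (normal_product sc B ?H) e =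
      (if supported (factor_vars ?F \<union> factor_vars ?H) e
       then normal_product sc B ?F (cut (factor_vars ?F) e) \<otimes>\<^bsub>?A\<^esub> normal_product sc B ?H (cut (factor_vars ?H) e)
       else \<zero>\<^bsub>?A\<^esub>)"
    proof (rule series_mult_disjoint[OF semiring_V_End])
      show "factor_vars ?F \<inter> factor_vars ?H = {}" unfolding vars by auto
    qed (rule normal_product_closed[OF dist(1)] normal_product_closed[OF dist(2)]
        normal_product_supported[OF dist(1)] normal_product_supported[OF dist(2)], assumption?)+
    also have "normal_product sc B ?F (cut (factor_vars ?F) e) \<otimes>\<^bsub>?A\<^esub> normal_product sc B ?H (cut (factor_vars ?H) e) =
      V_rep sc B ((alg_scalar (\<Prod>i\<in>{1..r}. ?gx i) * mode_normal (map ?\<alpha> ?R)) *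
        (alg_scalar (\<Prod>j\<in>{1..s}. ?gy j) * mode_normal (map ?\<beta> ?S)))"
      by (simp only: normal_product_cut dist factors_coeff factors_mode distinct_upt sets V_rep_mult)
    also have "(alg_scalar (\<Prod>i\<in>{1..r}. ?gx i) * mode_normal (map ?\<alpha> ?R)) *
        (alg_scalar (\<Prod>j\<in>{1..s}. ?gy j) * mode_normal (map ?\<beta> ?S)) =
        alg_scalar ?G * (mode_normal (map ?\<alpha> ?R) * mode_normal (map ?\<beta> ?S))"
      by (rule alg_scalar_mult_mult)
    finally show ?thesis by (simp only: vars V_rep_zero if_distrib[of "V_rep sc B"])
  qed
  also have "\<dots> = V_rep sc B (?z (\<Sum>I\<in>Pow {1..r}. \<Sum>J | J \<subseteq> {1..s} \<and> card J = card I. ?t I J))"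
  proof -
    \<comment> \<open>Here the two arguments of \<open>V_rep\<close> are in general different
      elements of the free algebra; they only act equally on V.\<close>
    have "V_rep sc B (alg_scalar ?G * (mode_normal (map ?\<alpha> ?R) * mode_normal (map ?\<beta> ?S))) =
        V_rep sc B (alg_scalar ?G * (\<Sum>I\<in>Pow {1..r}. \<Sum>J | J \<subseteq> {1..s} \<and> card J = card I. ?t I J))"
      by (rule C.eqv_scale[OF C.wick])
    then show ?thesis by (simp only: if_distrib[of "V_rep sc B"])
  qed
  \<comment> \<open>The pair of empty sets is set apart as the first term on the right of the
    formula, and grouping by \<rho> reproduces the nested sums there.\<close>
  also have "?z (\<Sum>I\<in>Pow {1..r}. \<Sum>J | J \<subseteq> {1..s} \<and> card J = card I. ?t I J) =
      ?z (?t {} {}) + (\<Sum>\<rho>\<in>{1..min r s}. \<Sum>(is, js)\<in>increasing_seqs r \<rho> \<times> increasing_seqs s \<rho>. ?z (?t (set is) (set js)))"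
    unfolding sum_subset_pairs by (simp add: distrib_left sum_distrib_left case_prod_beta)
  finally have lhs: "series_mult ?A (normal_product sc B (factors a m X ?R)) (normal_product sc B (factors b n Y ?S)) e =
      V_rep sc B (?z (?t {} {})) \<oplus>\<^bsub>?A\<^esub>
      V_rep sc B (\<Sum>\<rho>\<in>{1..min r s}. \<Sum>(is, js)\<in>increasing_seqs r \<rho> \<times> increasing_seqs s \<rho>. ?z (?t (set is) (set js)))"
    by (simp only: V_rep_add)
  have first: "normal_product sc B (factors a m X ?R @ factors b n Y ?S) e = V_rep sc B (?z (?t {} {}))"
  proof -
    have "normal_product sc B (factors a m X ?R @ factors b n Y ?S) e =
      V_rep sc B (if supported ?Z e then alg_scalar ?G * mode_normal (map ?\<alpha> ?R @ map ?\<beta> ?S) else 0)"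
      by (simp only: normal_product_conv[OF distinct_factors(1)[OF distinct_upt distinct_upt]] factor_vars_append distinct_upt factor_vars_factors
          factors_coeff factors_mode sets map_append prod_list.append)
    \<comment> \<open>For empty I and J both the sign and the determinant are 1.\<close>
    moreover have "?t {} {} = mode_normal (map ?\<alpha> ?R @ map ?\<beta> ?S)"
      by (simp add: alg_scalar_1 slR[unfolded One_nat_def])
    ultimately show ?thesis by (simp only:)
  qed
  have summand: "series_smult ?A ((-1) ^ (sum_list is + sum_list js) * (-1) ^ (r * \<rho> + \<rho> * (\<rho> + 1) div 2))
      (series_mult ?A (scalar_series ?A (series_det \<rho> (\<lambda>k l e. B (a (is ! k)) (b (js ! l)) *
          iota_f (m (is ! k)) (n (js ! l)) (X (is ! k)) (Y (js ! l)) e)))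
        (normal_product sc B (factors a m X (omit r is) @ factors b n Y (omit s js)))) e =
      V_rep sc B (?z (?t (set is) (set js)))"
    if "is": "is \<in> increasing_seqs r \<rho>" and js: "js \<in> increasing_seqs s \<rho>" for "is" js \<rho>
  proof -
    obtain I where I: "is = sl I" "I \<subseteq> {1..r}" "card I = \<rho>" using "is" by (auto simp: increasing_seqs_conv)
    obtain J where J: "js = sl J" "J \<subseteq> {1..s}" "card J = \<rho>" using js by (auto simp: increasing_seqs_conv)
    have fin: "finite I" "finite J" using I(2) J(2) by (auto intro: finite_subset)
    have setI: "set is = I" and setJ: "set js = J" using I J fin by simp_all
    have len: "length is = \<rho>" "length js = length is" and dist: "distinct is" "distinct js"
      using I J by simp_all
    let ?D = "series_det \<rho> (\<lambda>k l e. B (a (is ! k)) (b (js ! l)) *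
          iota_f (m (is ! k)) (n (js ! l)) (X (is ! k)) (Y (js ! l)) e)"
    let ?U = "X ` I \<union> Y ` J" and ?W = "X ` ({1..r} - I) \<union> Y ` ({1..s} - J)"
    let ?rest = "factors a m X (omit r is) @ factors b n Y (omit s js)"
    let ?det = "leibniz_det ?ct is js * ((\<Prod>i\<in>I. ?gx i) * (\<Prod>j\<in>J. ?gy j))"
    let ?grest = "(\<Prod>i\<in>{1..r} - I. ?gx i) * (\<Prod>j\<in>{1..s} - J. ?gy j)"
    let ?N = "mode_normal (map ?\<alpha> (sl ({1..r} - I)) @ map ?\<beta> (sl ({1..s} - J)))"
    have omit: "omit r is = sl ({1..r} - I)" "omit s js = sl ({1..s} - J)"
      using I J by (simp_all add: omit_sl del: One_nat_def)
    have drest: "distinct (map (snd \<circ> snd) ?rest)"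
      unfolding omit by (rule distinct_factors) simp_all
    have sets_omit: "set (sl ({1..r} - I)) = {1..r} - I" "set (sl ({1..s} - J)) = {1..s} - J" by simp_all
    have vars: "factor_vars ?rest = ?W"
      unfolding factor_vars_append factor_vars_factors omit sets_omit ..
    \<comment> \<open>A scalar series has its coefficients in the image of \<open>V_rep\<close> too,
      through the constants of the free algebra.\<close>
    have scal: "scalar_series ?A ?D d = V_rep sc B (alg_scalar (?D d))" for d
      unfolding scalar_series_def V_rep_one[of sc B, symmetric] V_rep_scale[symmetric]
      by (simp only: mult_1_right)
    have "series_mult ?A (scalar_series ?A ?D) (normal_product sc B ?rest) e =
        (if supported (?U \<union> ?W) e
         then scalar_series ?A ?D (cut ?U e) \<otimes>\<^bsub>?A\<^esub> normal_product sc B ?rest (cut ?W e)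
         else \<zero>\<^bsub>?A\<^esub>)"
    proof (rule series_mult_disjoint[OF semiring_V_End])
      show "supported ?U d" if "scalar_series ?A ?D d \<noteq> \<zero>\<^bsub>?A\<^esub>" for d
      proof -
        have "?D d \<noteq> 0"
        proof
          assume "?D d = 0"
          then have "scalar_series ?A ?D d = \<zero>\<^bsub>?A\<^esub>" by (simp only: scal alg_scalar_0 V_rep_zero)
          with that show False by (rule notE)
        qed
        then show ?thesis
          by (rule series_det_supported[OF dist len(2), of B a b m n d, unfolded len(1) setI setJ])
      qed
      show "supported ?W d" if "normal_product sc B ?rest d \<noteq> \<zero>\<^bsub>?A\<^esub>" for d
        using normal_product_supported[OF drest that] by (simp only: vars)
      show "scalar_series ?A ?D d \<in> carrier ?A" for d unfolding scal by (rule V_rep_closed)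
      show "normal_product sc B ?rest d \<in> carrier ?A" for d by (rule normal_product_closed[OF drest])
    qed auto
    also have "scalar_series ?A ?D (cut ?U e) = V_rep sc B (alg_scalar ?det)"
      unfolding scal series_det_cut[OF dist len(2), of B a b m n e, unfolded len(1) setI setJ] ..
    also have "normal_product sc B ?rest (cut ?W e) = V_rep sc B (alg_scalar ?grest * ?N)"
      unfolding vars[symmetric] normal_product_cut[OF drest]
      by (simp only: omit factors_coeff factors_mode sets_omit map_append prod_list.append
          distinct_sorted_list_of_set)
    \<comment> \<open>Contracted and remaining variables make up all of them, so each summand has
      the same support condition as the left-hand side.\<close>
    also have "?U \<union> ?W = ?Z" using I J by auto
    finally have "series_mult ?A (scalar_series ?A ?D) (normal_product sc B ?rest) e =
        V_rep sc B (if supported ?Z e then alg_scalar ?det * (alg_scalar ?grest * ?N) else 0)"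
      by (simp only: V_rep_mult V_rep_zero if_distrib[of "V_rep sc B"])
    then have "series_smult ?A (?sgn I J) (series_mult ?A (scalar_series ?A ?D) (normal_product sc B ?rest)) e =
        V_rep sc B (alg_scalar (?sgn I J) *
          (if supported ?Z e then alg_scalar ?det * (alg_scalar ?grest * ?N) else 0))"
      by (simp only: series_smult_def V_rep_scale)
    also have "alg_scalar (?sgn I J) * (if supported ?Z e then alg_scalar ?det * (alg_scalar ?grest * ?N) else 0) =
        ?z (?t I J)"
    proof -
      have "?G = ((\<Prod>i\<in>I. ?gx i) * (\<Prod>j\<in>J. ?gy j)) * ?grest"
        using prod.subset_diff[OF I(2), of ?gx] prod.subset_diff[OF J(2), of ?gy] by (simp add: mult_ac)
      then have "?sgn I J * (?det * ?grest) = ?G * (?sgn I J * leibniz_det ?ct (sl I) (sl J))"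
        using I(1) J(1) by (simp only: mult_ac)
      then show ?thesis by (simp only: C.scale_scale mult_zero_right if_distrib[of "(*) (alg_scalar (?sgn I J))"])
    qed
    finally show ?thesis
      using I J fin by (simp only: sum_list_sl setI[unfolded I(1)] setJ[unfolded J(1)])
  qed
  have "series_sum ?A (\<lambda>\<rho>. series_sum ?A (\<lambda>(is, js). series_smult ?A
          ((-1) ^ (sum_list is + sum_list js) * (-1) ^ (r * \<rho> + \<rho> * (\<rho> + 1) div 2))
          (series_mult ?A (scalar_series ?A (series_det \<rho> (\<lambda>k l e. B (a (is ! k)) (b (js ! l)) *
              iota_f (m (is ! k)) (n (js ! l)) (X (is ! k)) (Y (js ! l)) e)))
            (normal_product sc B (factors a m X (omit r is) @ factors b n Y (omit s js)))))
        (increasing_seqs r \<rho> \<times> increasing_seqs s \<rho>)) {1..min r s} e =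
      V_rep sc B (\<Sum>\<rho>\<in>{1..min r s}. \<Sum>(is, js)\<in>increasing_seqs r \<rho> \<times> increasing_seqs s \<rho>. ?z (?t (set is) (set js)))"
    unfolding series_sum_def
  proof (rule V_rep_finsum)
    fix \<rho>
    have fin: "finite (increasing_seqs k \<rho>)" for k
      unfolding increasing_seqs_conv by (rule finite_imageI, rule finite_subset[of _ "Pow {1..k}"]) auto
    show "finsum ?A (\<lambda>i. (case i of (is, js) \<Rightarrow> series_smult ?A
          ((-1) ^ (sum_list is + sum_list js) * (-1) ^ (r * \<rho> + \<rho> * (\<rho> + 1) div 2))
          (series_mult ?A (scalar_series ?A (series_det \<rho> (\<lambda>k l e. B (a (is ! k)) (b (js ! l)) *
              iota_f (m (is ! k)) (n (js ! l)) (X (is ! k)) (Y (js ! l)) e)))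
            (normal_product sc B (factors a m X (omit r is) @ factors b n Y (omit s js))))) e)
        (increasing_seqs r \<rho> \<times> increasing_seqs s \<rho>) =
      V_rep sc B (\<Sum>(is, js)\<in>increasing_seqs r \<rho> \<times> increasing_seqs s \<rho>. ?z (?t (set is) (set js)))"
    proof (rule V_rep_finsum)
      fix p assume "p \<in> increasing_seqs r \<rho> \<times> increasing_seqs s \<rho>"
      then obtain "is" js where p: "p = (is, js)"
        and "is \<in> increasing_seqs r \<rho>" "js \<in> increasing_seqs s \<rho>" by (elim SigmaE) simp
      then show "(case p of (is, js) \<Rightarrow> series_smult ?A
          ((-1) ^ (sum_list is + sum_list js) * (-1) ^ (r * \<rho> + \<rho> * (\<rho> + 1) div 2))
          (series_mult ?A (scalar_series ?A (series_det \<rho> (\<lambda>k l e. B (a (is ! k)) (b (js ! l)) *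
              iota_f (m (is ! k)) (n (js ! l)) (X (is ! k)) (Y (js ! l)) e)))
            (normal_product sc B (factors a m X (omit r is) @ factors b n Y (omit s js))))) e =
          V_rep sc B (case p of (is, js) \<Rightarrow> ?z (?t (set is) (set js)))"
        unfolding p prod.case by (intro summand)
    qed (intro finite_cartesian_product fin)
  qed simp
  then show "series_mult ?A (normal_product sc B (factors a m X ?R)) (normal_product sc B (factors b n Y ?S)) e =
    series_add ?A (normal_product sc B (factors a m X ?R @ factors b n Y ?S))
      (series_sum ?A (\<lambda>\<rho>. series_sum ?A (\<lambda>(is, js). series_smult ?A
          ((-1) ^ (sum_list is + sum_list js) * (-1) ^ (r * \<rho> + \<rho> * (\<rho> + 1) div 2))
          (series_mult ?A (scalar_series ?A (series_det \<rho> (\<lambda>k l e. B (a (is ! k)) (b (js ! l)) *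
              iota_f (m (is ! k)) (n (js ! l)) (X (is ! k)) (Y (js ! l)) e)))
            (normal_product sc B (factors a m X (omit r is) @ factors b n Y (omit s js)))))
        (increasing_seqs r \<rho> \<times> increasing_seqs s \<rho>)) {1..min r s}) e"
    unfolding series_add_def lhs first by (simp only:)
qed

end
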